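(* Let $m,n\ge 1$ and $0\le k\le mn$. The operators $q^{\epsilon^L_i},E_i^L,F_i^L$ (assigned to the generators $q^{\epsilon_i},e_i,f_i$ of $U_q(gl_m)$) and $q^{\epsilon^R_k},E_k^R,F_k^R$ (assigned to the generators $q^{\epsilon_k},e_k,f_k$ of $U_q(gl_n)$) make $\wedge^k(\mathbb{C}^{mn})$ into a $U_q(gl_m)\otimes U_q(gl_n)$-module. Furthermore, at $q=1$ this matches the restriction of the $U_1(gl_{mn})$-action on $\wedge^k(\mathbb{C}^{mn})$ to $U_1(gl_m)\otimes U_1(gl_n)$.
   Context: For $N\ge 1$, $U_q(gl_N)$ is the associative $\mathbb{C}(q)$-algebra generated by $e_i,f_i$ ($1\le i\le N-1$) and $q^{\pm\epsilon_i}$ ($1\le i\le N$) with relations: $q^{\epsilon_i}q^{-\epsilon_i}=1$; $[q^{\epsilon_i},q^{\epsilon_j}]=0$; $q^{\epsilon_i}e_jq^{-\epsilon_i}=q^{\delta_{i,j}-\delta_{i,j+1}}e_j$; $q^{\epsilon_i}f_jq^{-\epsilon_i}=q^{-\delta_{i,j}+\delta_{i,j+1}}f_j$; $[e_i,f_j]=\delta_{ij}\frac{q^{h_i}-q^{-h_i}}{q-q^{-1}}$ with $h_i=\epsilon_i-\epsilon_{i+1}$; $[e_i,e_j]=[f_i,f_j]=0$ for $|i-j|>1$; $e_je_i^2-(q+q^{-1})e_ie_je_i+e_i^2e_j=0=f_jf_i^2-(q+q^{-1})f_if_jf_i+f_i^2f_j$ for $|i-j|=1$. For $\alpha=\sum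 a_i\epsilon_i$ with $a_i\in\mathbb{Z}$, $q^\alpha=\prod (q^{\epsilon_i})^{a_i}$. $\wedge^k(\mathbb{C}^N)$ is the $U_q(gl_N)$-module over $\mathbb{C}(q)$ with basis $v_c$, $c\subseteq\{1,\dots,N\}$, $|c|=k$, and action: $q^{\epsilon_i}v_c=qv_c$ if $i\in c$ and $v_c$ otherwise; $e_iv_c=v_{c-\{i+1\}+\{i\}}$ if $i+1\in c,\ i\notin c$ and $0$ otherwise; $f_iv_c=v_{c-\{i\}+\{i+1\}}$ if $i\in c,\ i+1\notin c$ and $0$ otherwise. In $U_q(gl_{mn})$, for $a\le b$ put $E_{a,b}=[e_a,[e_{a+1},[\ldots[e_{b-1},e_b]]]]$ and $F_{a,b}=[[[f_b,f_{b-1}],\ldots],f_a]$, with $E_{a,a}=e_a$, $F_{a,a}=f_a$. Left operators ($1\le i\le m-1$; $\epsilon_i^L$ for $1\le i\le m$): $q^{\epsilon_i^L}=\prod_{j=0}^{n-1}q^{\epsilon_{jm+i}}$, $E_i^L=\sum_{k=1}^{n}\big(\prod_{j=0}^{k-2}q^{-h_{jm+i}}\big)e_{(k-1)m+i}$, $F_i^L=\sum_{k=1}^{n}\big(\prod_{j=k}^{n-1}q^{h_{jm+i}}\big)f_{(k-1)m+i}$. Right operators ($1\le k\le n-1$; $\epsilon_k^R$ for $1\le k\le n$): $q^{\epsilon_k^R}=\prod_{i=1}^m q^{\epsilon_{(k-1)m+i}}$, $E_k^R=\sum_{i=1}^m q^{\beta_i^k}E_{(k-1)m+i,\,km+i-1}$,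 $F_k^R=\sum_{i=1}^m q^{\alpha_i^k}F_{(k-1)m+i,\,km+i-1}$, where $\beta_i^k=\sum_{j=i+1}^m(\epsilon_{km+j}-\epsilon_{(k-1)m+j})$ and $\alpha_i^k=\sum_{j=1}^{i-1}(\epsilon_{(k-1)m+j}-\epsilon_{km+j})$. All these elements act on $\wedge^k(\mathbb{C}^{mn})$ through its $U_q(gl_{mn})$-module structure. "At $q=1$ this matches" means: setting $q=1$ in the matrices of $E_i^L,F_i^L,E_k^R,F_k^R$ in the basis $v_c$ (with diagonal generators acting by the corresponding weights) gives the action of the Chevalley generators of $gl_m(\mathbb{C})$ and $gl_n(\mathbb{C})$ on the classical $gl_{mn}(\mathbb{C})$-module $\wedge^k(\mathbb{C}^{mn})$, restricted along $gl_m\times gl_n\to gl_{mn}$ induced by $\mathbb{C}^{mn}=\mathbb{C}^m\otimes\mathbb{C}^n$, where the basis vector with index $(j-1)m+i$ corresponds to $e_i\otimes e_j$. *)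

theory Defs
  imports
    Complex_Main
    "HOL-Combinatorics.Permutations"
    "HOL-Computational_Algebra.Polynomial_Factorial"
    "HOL-Library.Function_Algebras"
    "HOL-Algebra.Module"
    "HOL-Algebra.QuotRing"
begin

section \<open>Algebras over a field and their modules\<close>

text \<open>The locale \<^locale>\<open>algebra\<close> of HOL-Algebra requires a commutative multiplication, which
  rules out quantum groups.\<close>

locale assoc_algebra = module K A + ring A for K (structure) and A (structure) +
  assumes smult_mult_left:
    "\<lbrakk>r \<in> carrier K; x \<in> carrier A; y \<in> carrier A\<rbrakk> \<Longrightarrow>
      (r \<odot>\<^bsub>A\<^esub> x) \<otimes>\<^bsub>A\<^esub> y = r \<odot>\<^bsub>A\<^esub> (x \<otimes>\<^bsub>A\<^esub> y)"
    and smult_mult_right: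
    "\<lbrakk>r \<in> carrier K; x \<in> carrier A; y \<in> carrier A\<rbrakk> \<Longrightarrow>
      x \<otimes>\<^bsub>A\<^esub> (r \<odot>\<^bsub>A\<^esub> y) = r \<odot>\<^bsub>A\<^esub> (x \<otimes>\<^bsub>A\<^esub> y)"

locale alg_module = A: assoc_algebra K A + V: module K V
  for K (structure) and A (structure) and V (structure) +
  fixes act :: "'b \<Rightarrow> 'e \<Rightarrow> 'e"
  assumes act_closed:
    "\<lbrakk>a \<in> carrier A; v \<in> carrier V\<rbrakk> \<Longrightarrow> act a v \<in> carrier V"
    and act_one:
    "v \<in> carrier V \<Longrightarrow> act \<one>\<^bsub>A\<^esub> v = v"
    and act_mult:
    "\<lbrakk>a \<in> carrier A; b \<in> carrier A; v \<in> carrier V\<rbrakk> \<Longrightarrow>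
      act (a \<otimes>\<^bsub>A\<^esub> b) v = act a (act b v)"
    and act_add_left:
    "\<lbrakk>a \<in> carrier A; b \<in> carrier A; v \<in> carrier V\<rbrakk> \<Longrightarrow>
      act (a \<oplus>\<^bsub>A\<^esub> b) v = act a v \<oplus>\<^bsub>V\<^esub> act b v"
    and act_add_right:
    "\<lbrakk>a \<in> carrier A; v \<in> carrier V; w \<in> carrier V\<rbrakk> \<Longrightarrow>
      act a (v \<oplus>\<^bsub>V\<^esub> w) = act a v \<oplus>\<^bsub>V\<^esub> act a w"
    and act_smult_left:
    "\<lbrakk>r \<in> carrier K; a \<in> carrier A; v \<in> carrier V\<rbrakk> \<Longrightarrow>
      act (r \<odot>\<^bsub>A\<^esub> a) v = r \<odot>\<^bsub>V\<^esub> act a v"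
    and act_smult_right:
    "\<lbrakk>r \<in> carrier K; a \<in> carrier A; v \<in> carrier V\<rbrakk> \<Longrightarrow>
      act a (r \<odot>\<^bsub>V\<^esub> v) = r \<odot>\<^bsub>V\<^esub> act a v"

definition commutator :: "('a, 'b) ring_scheme \<Rightarrow> 'a \<Rightarrow> 'a \<Rightarrow> 'a" where
  "commutator A x y = (x \<otimes>\<^bsub>A\<^esub> y) \<ominus>\<^bsub>A\<^esub> (y \<otimes>\<^bsub>A\<^esub> x)"

definition list_prod :: "('a, 'b) monoid_scheme \<Rightarrow> 'a list \<Rightarrow> 'a" where
  "list_prod A xs = foldr (\<lambda>x y. x \<otimes>\<^bsub>A\<^esub> y) xs \<one>\<^bsub>A\<^esub>"

definition quot_algebra :: "('k, 'a) module \<Rightarrow> 'a set \<Rightarrow> ('k, 'a set) module" where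
  "quot_algebra A I =
    \<lparr>carrier = carrier (A Quot I), mult = mult (A Quot I), one = one (A Quot I),
     zero = zero (A Quot I), add = add (A Quot I),
     smult = (\<lambda>r X. \<Union>x\<in>X. I +>\<^bsub>A\<^esub> (r \<odot>\<^bsub>A\<^esub> x))\<rparr>"


section \<open>The field of rational functions, coordinate spaces and monoid algebras\<close>

type_synonym ratfun = "complex poly fract"

definition Cq :: "ratfun ring" where
  "Cq = \<lparr>carrier = UNIV, mult = (*), one = 1, zero = 0, add = (+)\<rparr>"

definition q_var :: ratfun where
  "q_var = to_fract [:0, 1:]"

text \<open>Regularity at \<open>q = 1\<close> is part of the relation.\<close>

definition has_value_at_1 :: "ratfun \<Rightarrow> complex \<Rightarrow> bool" where
  "has_value_at_1 f z \<longleftrightarrow>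
    (\<exists>a b. poly b 1 \<noteq> 0 \<and> f = to_fract a / to_fract b \<and> z = poly a 1 / poly b 1)"

definition single :: "'a \<Rightarrow> 'a \<Rightarrow> 'k::zero_neq_one" where
  "single x = (\<lambda>y. if y = x then 1 else 0)"

definition scale :: "'k \<Rightarrow> ('a \<Rightarrow> 'k) \<Rightarrow> 'a \<Rightarrow> 'k::times" where
  "scale r f = (\<lambda>x. r * f x)"

text \<open>Only meant for finite \<open>B\<close>; \<^const>\<open>mult\<close> and \<^const>\<open>one\<close> are irrelevant for
  \<^locale>\<open>module\<close>.\<close>

definition coord_space :: "'a set \<Rightarrow> (ratfun, 'a \<Rightarrow> ratfun) module" where
  "coord_space B =
    \<lparr>carrier = {v. \<forall>x. x \<notin> B \<longrightarrow> v x = 0}, mult = undefined, one = undefined,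
     zero = 0, add = (+), smult = scale\<rparr>"

definition monoid_algebra :: "('a, 'b) monoid_scheme \<Rightarrow> (ratfun, 'a \<Rightarrow> ratfun) module" where
  "monoid_algebra M =
    \<lparr>carrier = {f. finite {x. f x \<noteq> 0} \<and> {x. f x \<noteq> 0} \<subseteq> carrier M},
     mult = (\<lambda>f g z. \<Sum>(x, y)\<in>{(x, y). f x \<noteq> 0 \<and> g y \<noteq> 0 \<and> x \<otimes>\<^bsub>M\<^esub> y = z}. f x * g y),
     one = single \<one>\<^bsub>M\<^esub>, zero = 0, add = (+), smult = scale\<rparr>"

definition free_monoid :: "'g set \<Rightarrow> 'g list monoid" where
  "free_monoid S = \<lparr>carrier = lists S, mult = (@), one = []\<rparr>"

definition free_algebra :: "'g set \<Rightarrow> (ratfun, 'g list \<Rightarrow> ratfun) module" where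
  "free_algebra S = monoid_algebra (free_monoid S)"


section \<open>Tensor products of algebras\<close>

text \<open>The monoid algebra of \<open>A \<times> B\<close> is the free vector space on \<open>A \<times> B\<close> with multiplication
  \<open>(a, b) (a', b') = (a a', b b')\<close>. The bilinearity relations are stable under multiplication by
  pairs, so the ideal they generate is the subspace they span.\<close>

definition tensor_relations ::
  "(ratfun, 'a) module \<Rightarrow> (ratfun, 'b) module \<Rightarrow> ('a \<times> 'b \<Rightarrow> ratfun) set" where
  "tensor_relations A B =
    {single (a \<oplus>\<^bsub>A\<^esub> a', b) - single (a, b) - single (a', b) | a a' b.
        a \<in> carrier A \<and> a' \<in> carrier A \<and> b \<in> carrier B} \<union>
    {single (a, b \<oplus>\<^bsub>B\<^esub> b') - single (a, b) - single (a, b') | a b b'.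
        a \<in> carrier A \<and> b \<in> carrier B \<and> b' \<in> carrier B} \<union>
    {single (r \<odot>\<^bsub>A\<^esub> a, b) - scale r (single (a, b)) | r a b.
        a \<in> carrier A \<and> b \<in> carrier B} \<union>
    {single (a, r \<odot>\<^bsub>B\<^esub> b) - scale r (single (a, b)) | r a b.
        a \<in> carrier A \<and> b \<in> carrier B}"

definition tensor_ideal ::
  "(ratfun, 'a) module \<Rightarrow> (ratfun, 'b) module \<Rightarrow> ('a \<times> 'b \<Rightarrow> ratfun) set" where
  "tensor_ideal A B = Idl\<^bsub>monoid_algebra (A \<times>\<times> B)\<^esub> (tensor_relations A B)"

definition tensor_algebra ::
  "(ratfun, 'a) module \<Rightarrow> (ratfun, 'b) module \<Rightarrow> (ratfun, ('a \<times> 'b \<Rightarrow> ratfun) set) module" where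
  "tensor_algebra A B = quot_algebra (monoid_algebra (A \<times>\<times> B)) (tensor_ideal A B)"

definition pure_tensor ::
  "(ratfun, 'a) module \<Rightarrow> (ratfun, 'b) module \<Rightarrow> 'a \<Rightarrow> 'b \<Rightarrow> ('a \<times> 'b \<Rightarrow> ratfun) set" where
  "pure_tensor A B a b = tensor_ideal A B +>\<^bsub>monoid_algebra (A \<times>\<times> B)\<^esub> single (a, b)"


section \<open>The quantum group of \<open>gl\<^sub>N\<close>\<close>

text \<open>\<open>GenK i\<close> and \<open>GenKinv i\<close> stand for \<open>q\<close> to the powers \<open>\<epsilon>\<^sub>i\<close> and \<open>- \<epsilon>\<^sub>i\<close>.\<close>

datatype qgen = GenE nat | GenF nat | GenK nat | GenKinv nat

definition qgens :: "nat \<Rightarrow> qgen set" where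
  "qgens N = GenE ` {1..<N} \<union> GenF ` {1..<N} \<union> GenK ` {1..N} \<union> GenKinv ` {1..N}"

text \<open>A weight \<open>\<Sum>i. a\<^sub>i \<epsilon>\<^sub>i\<close> is represented by its coefficient function.\<close>

type_synonym weight = "nat \<Rightarrow> int"

definition eps :: "nat \<Rightarrow> weight" where
  "eps i = single i"

definition hwt :: "nat \<Rightarrow> weight" where
  "hwt i = eps i - eps (i + 1)"

text \<open>The word in the generators that represents \<open>q\<close> to the power \<open>\<alpha>\<close>.\<close>

definition qpow_word :: "nat \<Rightarrow> weight \<Rightarrow> qgen list" where
  "qpow_word N \<alpha> = concat (map (\<lambda>i. if \<alpha> i \<ge> 0 then replicate (nat (\<alpha> i)) (GenK i)
                                     else replicate (nat (- \<alpha> i)) (GenKinv i)) [1..<N + 1])"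

definition Uq_relations :: "nat \<Rightarrow> (qgen list \<Rightarrow> ratfun) set" where
  "Uq_relations N =
    {single [GenK i, GenKinv i] - single [] | i. i \<in> {1..N}} \<union>
    {single [GenKinv i, GenK i] - single [] | i. i \<in> {1..N}} \<union>
    {single [GenK i, GenK j] - single [GenK j, GenK i] | i j. i \<in> {1..N} \<and> j \<in> {1..N}} \<union>
    {single [GenK i, GenE j, GenKinv i]
        - scale (q_var powi (of_bool (i = j) - of_bool (i = j + 1))) (single [GenE j]) | i j.
        i \<in> {1..N} \<and> j \<in> {1..<N}} \<union>
    {single [GenK i, GenF j, GenKinv i]
        - scale (q_var powi (- of_bool (i = j) + of_bool (i = j + 1))) (single [GenF j]) | i j.
        i \<in> {1..N} \<and> j \<in> {1..<N}} \<union>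
    {single [GenE i, GenF j] - single [GenF j, GenE i]
        - scale (of_bool (i = j) / (q_var - inverse q_var))
            (single (qpow_word N (hwt i)) - single (qpow_word N (- hwt i))) | i j.
        i \<in> {1..<N} \<and> j \<in> {1..<N}} \<union>
    {single [GenE i, GenE j] - single [GenE j, GenE i] | i j.
        i \<in> {1..<N} \<and> j \<in> {1..<N} \<and> \<bar>int i - int j\<bar> > 1} \<union>
    {single [GenF i, GenF j] - single [GenF j, GenF i] | i j.
        i \<in> {1..<N} \<and> j \<in> {1..<N} \<and> \<bar>int i - int j\<bar> > 1} \<union>
    {single [GenE j, GenE i, GenE i] - scale (q_var + inverse q_var) (single [GenE i, GenE j, GenE i])
        + single [GenE i, GenE i, GenE j] | i j.
        i \<in> {1..<N} \<and> j \<in> {1..<N} \<and> \<bar>int i - int j\<bar> = 1} \<union>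
    {single [GenF j, GenF i, GenF i] - scale (q_var + inverse q_var) (single [GenF i, GenF j, GenF i])
        + single [GenF i, GenF i, GenF j] | i j.
        i \<in> {1..<N} \<and> j \<in> {1..<N} \<and> \<bar>int i - int j\<bar> = 1}"

definition Uq_ideal :: "nat \<Rightarrow> (qgen list \<Rightarrow> ratfun) set" where
  "Uq_ideal N = Idl\<^bsub>free_algebra (qgens N)\<^esub> (Uq_relations N)"

type_synonym uq = "(qgen list \<Rightarrow> ratfun) set"

definition Uq :: "nat \<Rightarrow> (ratfun, uq) module" where
  "Uq N = quot_algebra (free_algebra (qgens N)) (Uq_ideal N)"

definition Uq_word :: "nat \<Rightarrow> qgen list \<Rightarrow> uq" where
  "Uq_word N w = Uq_ideal N +>\<^bsub>free_algebra (qgens N)\<^esub> single w"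

definition e_gen :: "nat \<Rightarrow> nat \<Rightarrow> uq" where
  "e_gen N i = Uq_word N [GenE i]"

definition f_gen :: "nat \<Rightarrow> nat \<Rightarrow> uq" where
  "f_gen N i = Uq_word N [GenF i]"

definition qpow :: "nat \<Rightarrow> weight \<Rightarrow> uq" where
  "qpow N \<alpha> = Uq_word N (qpow_word N \<alpha>)"


section \<open>Exterior powers\<close>

definition ext_basis :: "nat \<Rightarrow> nat \<Rightarrow> nat set set" where
  "ext_basis N k = {c. c \<subseteq> {1..N} \<and> card c = k}"

definition ext_space :: "nat \<Rightarrow> nat \<Rightarrow> (ratfun, nat set \<Rightarrow> ratfun) module" where
  "ext_space N k = coord_space (ext_basis N k)"

definition is_ext_action :: "nat \<Rightarrow> nat \<Rightarrow> (uq \<Rightarrow> (nat set \<Rightarrow> ratfun) \<Rightarrow> nat set \<Rightarrow> ratfun) \<Rightarrow> bool"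
  where
  "is_ext_action N k act \<longleftrightarrow>
    alg_module Cq (Uq N) (ext_space N k) act \<and>
    (\<forall>c\<in>ext_basis N k.
      (\<forall>i\<in>{1..N}. act (qpow N (eps i)) (single c) =
         (if i \<in> c then scale q_var (single c) else single c)) \<and>
      (\<forall>i\<in>{1..<N}. act (e_gen N i) (single c) =
         (if i + 1 \<in> c \<and> i \<notin> c then single (c - {i + 1} \<union> {i}) else 0)) \<and>
      (\<forall>i\<in>{1..<N}. act (f_gen N i) (single c) =
         (if i \<in> c \<and> i + 1 \<notin> c then single (c - {i} \<union> {i + 1}) else 0)))"

text \<open>Since the generators generate \<^term>\<open>Uq N\<close>, an action as in \<^const>\<open>is_ext_action\<close> is
  determined on the carriers, so the choice operator does not introduce any ambiguity there.\<close>

definition ext_act :: "nat \<Rightarrow> nat \<Rightarrow> uq \<Rightarrow> (nat set \<Rightarrow> ratfun) \<Rightarrow> nat set \<Rightarrow> ratfun" where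
  "ext_act N k = (SOME act. is_ext_action N k act)"


section \<open>The left and right operators\<close>

text \<open>\<open>e_string N a d\<close> is \<open>[e\<^sub>a, [e\<^sub>a\<^sub>+\<^sub>1, \<dots> e\<^sub>a\<^sub>+\<^sub>d]]\<close> and \<open>f_string N a d\<close> is
  \<open>[[f\<^sub>a\<^sub>+\<^sub>d, \<dots> f\<^sub>a\<^sub>+\<^sub>1], f\<^sub>a]\<close>.\<close>

fun e_string :: "nat \<Rightarrow> nat \<Rightarrow> nat \<Rightarrow> uq" where
  "e_string N a 0 = e_gen N a"
| "e_string N a (Suc d) = commutator (Uq N) (e_gen N a) (e_string N (Suc a) d)"

fun f_string :: "nat \<Rightarrow> nat \<Rightarrow> nat \<Rightarrow> uq" where
  "f_string N a 0 = f_gen N a"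
| "f_string N a (Suc d) = commutator (Uq N) (f_string N (Suc a) d) (f_gen N a)"

definition e_root :: "nat \<Rightarrow> nat \<Rightarrow> nat \<Rightarrow> uq" where
  "e_root N a b = e_string N a (b - a)"

definition f_root :: "nat \<Rightarrow> nat \<Rightarrow> nat \<Rightarrow> uq" where
  "f_root N a b = f_string N a (b - a)"

definition K_left :: "nat \<Rightarrow> nat \<Rightarrow> nat \<Rightarrow> uq" where
  "K_left m n i =
    list_prod (Uq (m * n)) (map (\<lambda>j. qpow (m * n) (eps (j * m + i))) [0..<n])"

text \<open>The factor \<open>\<Prod>j = 0..k - 2\<close> is empty for \<open>k = 1\<close>.\<close>

definition E_left :: "nat \<Rightarrow> nat \<Rightarrow> nat \<Rightarrow> uq" where
  "E_left m n i =
    (\<Oplus>\<^bsub>Uq (m * n)\<^esub>k\<in>{1..n}.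
       list_prod (Uq (m * n)) (map (\<lambda>j. qpow (m * n) (- hwt (j * m + i))) [0..<k - 1])
       \<otimes>\<^bsub>Uq (m * n)\<^esub> e_gen (m * n) ((k - 1) * m + i))"

definition F_left :: "nat \<Rightarrow> nat \<Rightarrow> nat \<Rightarrow> uq" where
  "F_left m n i =
    (\<Oplus>\<^bsub>Uq (m * n)\<^esub>k\<in>{1..n}.
       list_prod (Uq (m * n)) (map (\<lambda>j. qpow (m * n) (hwt (j * m + i))) [k..<n])
       \<otimes>\<^bsub>Uq (m * n)\<^esub> f_gen (m * n) ((k - 1) * m + i))"

definition K_right :: "nat \<Rightarrow> nat \<Rightarrow> nat \<Rightarrow> uq" where
  "K_right m n k =
    list_prod (Uq (m * n)) (map (\<lambda>i. qpow (m * n) (eps ((k - 1) * m + i))) [1..<m + 1])"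

definition beta_wt :: "nat \<Rightarrow> nat \<Rightarrow> nat \<Rightarrow> weight" where
  "beta_wt m i k = (\<Sum>j\<in>{i+1..m}. eps (k * m + j) - eps ((k - 1) * m + j))"

definition alpha_wt :: "nat \<Rightarrow> nat \<Rightarrow> nat \<Rightarrow> weight" where
  "alpha_wt m i k = (\<Sum>j\<in>{1..<i}. eps ((k - 1) * m + j) - eps (k * m + j))"

definition E_right :: "nat \<Rightarrow> nat \<Rightarrow> nat \<Rightarrow> uq" where
  "E_right m n k =
    (\<Oplus>\<^bsub>Uq (m * n)\<^esub>i\<in>{1..m}.
       qpow (m * n) (beta_wt m i k)
       \<otimes>\<^bsub>Uq (m * n)\<^esub> e_root (m * n) ((k - 1) * m + i) (k * m + i - 1))"

definition F_right :: "nat \<Rightarrow> nat \<Rightarrow> nat \<Rightarrow> uq" where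
  "F_right m n k =
    (\<Oplus>\<^bsub>Uq (m * n)\<^esub>i\<in>{1..m}.
       qpow (m * n) (alpha_wt m i k)
       \<otimes>\<^bsub>Uq (m * n)\<^esub> f_root (m * n) ((k - 1) * m + i) (k * m + i - 1))"


section \<open>The classical action on exterior powers\<close>

text \<open>Matrices and vectors are indexed from 1.\<close>

type_synonym gl = "nat \<Rightarrow> nat \<Rightarrow> complex"

definition unit_mat :: "nat \<Rightarrow> nat \<Rightarrow> gl" where
  "unit_mat a b = (\<lambda>i j. if i = a \<and> j = b then 1 else 0)"

definition mat_vec :: "nat \<Rightarrow> gl \<Rightarrow> (nat \<Rightarrow> complex) \<Rightarrow> nat \<Rightarrow> complex" where
  "mat_vec N X w = (\<lambda>a. \<Sum>b\<in>{1..N}. X a b * w b)"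

text \<open>The coordinates of \<open>w\<^sub>0 \<and> \<dots> \<and> w\<^sub>k\<^sub>-\<^sub>1\<close> with respect to the basis \<open>v\<^sub>d\<close> (the wedge of the
  standard basis vectors with indices in \<open>d\<close>, in increasing order) are maximal minors.\<close>

definition wedge :: "nat \<Rightarrow> nat \<Rightarrow> (nat \<Rightarrow> nat \<Rightarrow> complex) \<Rightarrow> nat set \<Rightarrow> complex" where
  "wedge N k w = (\<lambda>d. if d \<in> ext_basis N k then
      \<Sum>\<sigma> | \<sigma> permutes {..<k}.
        of_int (sign \<sigma>) * (\<Prod>p<k. w p (sorted_list_of_set d ! \<sigma> p)) else 0)"

text \<open>The linear extension of the Leibniz rule
  \<open>X (w\<^sub>0 \<and> \<dots> \<and> w\<^sub>k\<^sub>-\<^sub>1) = \<Sum>p. w\<^sub>0 \<and> \<dots> \<and> X w\<^sub>p \<and> \<dots> \<and> w\<^sub>k\<^sub>-\<^sub>1\<close> applied to the basis \<open>v\<^sub>c\<close>.\<close>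

definition gl_ext_act :: "nat \<Rightarrow> nat \<Rightarrow> gl \<Rightarrow> (nat set \<Rightarrow> complex) \<Rightarrow> nat set \<Rightarrow> complex" where
  "gl_ext_act N k X v =
    (\<Sum>c\<in>ext_basis N k. scale (v c)
      (let u = (\<lambda>p. single (sorted_list_of_set c ! p))
       in \<Sum>p<k. wedge N k (u(p := mat_vec N X (u p)))))"

text \<open>The differential \<open>(X, Y) \<mapsto> X \<otimes> 1 + 1 \<otimes> Y\<close>, where the basis vector with index
  \<open>(j - 1) m + i\<close> corresponds to the tensor of the \<open>i\<close>-th and the \<open>j\<close>-th basis vector
  (\<open>1 \<le> i \<le> m\<close>).\<close>

definition gl_embed :: "nat \<Rightarrow> gl \<Rightarrow> gl \<Rightarrow> gl" where
  "gl_embed m X Y =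
    (let ix = (\<lambda>a. (a - 1) mod m + 1); jx = (\<lambda>a. (a - 1) div m + 1)
     in (\<lambda>a b. (if jx a = jx b then X (ix a) (ix b) else 0)
            + (if ix a = ix b then Y (jx a) (jx b) else 0)))"

definition specializes_to_gl ::
  "nat \<Rightarrow> nat \<Rightarrow> ((nat set \<Rightarrow> ratfun) \<Rightarrow> nat set \<Rightarrow> ratfun) \<Rightarrow> gl \<Rightarrow> bool" where
  "specializes_to_gl N k T X \<longleftrightarrow>
    (\<forall>c\<in>ext_basis N k. \<forall>d\<in>ext_basis N k.
      has_value_at_1 (T (single c) d) (gl_ext_act N k X (single c) d))"

text \<open>For a diagonal generator, \<open>T\<close> acts on \<open>v\<^sub>c\<close> by a power of \<open>q\<close> whose exponent is the
  corresponding classical weight of \<open>v\<^sub>c\<close>.\<close>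

definition weights_match_gl ::
  "nat \<Rightarrow> nat \<Rightarrow> ((nat set \<Rightarrow> ratfun) \<Rightarrow> nat set \<Rightarrow> ratfun) \<Rightarrow> gl \<Rightarrow> bool" where
  "weights_match_gl N k T X \<longleftrightarrow>
    (\<forall>c\<in>ext_basis N k. \<exists>w :: int.
      T (single c) = scale (q_var powi w) (single c) \<and>
      gl_ext_act N k X (single c) = scale (of_int w) (single c))"

end

theory Submission
  imports Defs
begin

text \<open>The exterior algebra of \<open>\<complex>\<^sup>N\<close> is a fermionic Fock space, and on it \<open>e\<^sub>i\<close>, \<open>f\<^sub>i\<close> act as the hops
  \<open>\<psi>\<^sub>i\<^sup>\<dagger> \<psi>\<^sub>i\<^sub>+\<^sub>1\<close>, \<open>\<psi>\<^sub>i\<^sub>+\<^sub>1\<^sup>\<dagger> \<psi>\<^sub>i\<close>, because the Jordan-Wigner signs of neighbouring sites cancel. Hence the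
  iterated commutators \<open>E\<^sub>a\<^sub>,\<^sub>b\<close> act as the long hops \<open>\<psi>\<^sub>a\<^sup>\<dagger> \<psi>\<^sub>b\<^sub>+\<^sub>1\<close>. Placing the \<open>m n\<close> sites on a grid, every
  column carries a representation of \<open>U\<^sub>q(gl\<^sub>m)\<close> and every row one of \<open>U\<^sub>q(gl\<^sub>n)\<close>; the left and right
  operators are the iterated coproducts over all columns and all rows, so they satisfy the defining
  relations. In the commutator of a left with a right operator only the four sites of a
  \<open>2 \<times> 2\<close> block contribute, and there two terms cancel. At \<open>q = 1\<close> all prefactors become 1
  and the hops are the classical matrix units.\<close>

section \<open>Linear operators\<close>

text \<open>The quantum groups are given by generators and relations, and \<open>ext_act\<close> is
  known only through a choice operator, so nothing can be computed inside \<open>Uq\<close> itself.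
  Everything is moved into one ring: \<open>linop\<close> consists of all linear maps on functions
  on an arbitrary index set, with no restriction on the support, so that it is a
  \<open>ring_1\<close> and every relation becomes an equation there. The exterior power is cut out
  later by \<open>stab\<close>, and uniqueness of the action identifies \<open>ext_act\<close> with
  these operators. Two obstacles shape the computation: the Serre relation for a sum of many terms,
  and the signs of hops over \<open>m\<close> sites. Adding one column or row at a time reduces the
  former to two summands with known q-commutation; the anticommutation relations absorb the latter.
  The cancellation between left and right operators is an effect of weights: the two surviving
  corner terms differ by \<open>q\<close> to the power \<open>eps b - eps a\<close>, which acts as
  \<open>1/q\<close> on the image of \<open>hop a b\<close>, against a factor \<open>q\<close> from
  reordering.\<close>

typedef 'a linop = "{T :: ('a \<Rightarrow> ratfun) \<Rightarrow> 'a \<Rightarrow> ratfun.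
    (\<forall>v w. T (v + w) = T v + T w) \<and> (\<forall>r v. T (scale r v) = scale r (T v))}"
  morphisms apply_op Linop
  by (rule exI[of _ id]) simp

setup_lifting type_definition_linop

lemma scale_simps:
  fixes r :: ratfun
  shows "scale r (v + w) = scale r v + scale r w" "scale r (v - w) = scale r v - scale r w"
    "scale r (- v) = - scale r v" "scale r 0 = 0" "scale 1 v = v" "scale 0 v = 0"
    "scale r (scale s v) = scale (r * s) v" "scale (r + s) v = scale r v + scale s v"
  by (auto simp: scale_def fun_eq_iff algebra_simps)

instantiation linop :: (type) ring_1
begin

lift_definition zero_linop :: "'a linop" is "\<lambda>v. 0" by (simp add: scale_simps)
lift_definition one_linop :: "'a linop" is "\<lambda>v. v" by simp
lift_definition plus_linop :: "'a linop \<Rightarrow> 'a linop \<Rightarrow> 'a linop" is "\<lambda>S T v. S v + T v"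
  by (simp add: scale_simps)
lift_definition minus_linop :: "'a linop \<Rightarrow> 'a linop \<Rightarrow> 'a linop" is "\<lambda>S T v. S v - T v"
  by (simp add: scale_simps)
lift_definition uminus_linop :: "'a linop \<Rightarrow> 'a linop" is "\<lambda>T v. - T v"
  by (simp add: scale_simps)
lift_definition times_linop :: "'a linop \<Rightarrow> 'a linop \<Rightarrow> 'a linop" is "\<lambda>S T v. S (T v)"
  by simp

instance
proof
  show "(0 :: 'a linop) \<noteq> 1"
  proof (transfer, rule notI)
    assume "(\<lambda>v :: 'a \<Rightarrow> ratfun. 0) = (\<lambda>v. v)"
    then have "(0 :: 'a \<Rightarrow> ratfun) = 1" by metis
    then show False by (auto simp: fun_eq_iff)
  qed
qed (transfer; auto simp: fun_eq_iff)+

end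

lemma linop_eqI: "(\<And>v d. apply_op S v d = apply_op T v d) \<Longrightarrow> S = T"
  by (metis apply_op_inject ext)

lemma apply_op_simps [simp]:
  "apply_op 0 v = 0" "apply_op 1 v = v" "apply_op (S + T) v = apply_op S v + apply_op T v"
  "apply_op (S - T) v = apply_op S v - apply_op T v" "apply_op (- T) v = - apply_op T v"
  "apply_op (S * T) v = apply_op S (apply_op T v)"
  by (transfer; simp)+

lemma apply_op_linear:
  "apply_op T (v + w) = apply_op T v + apply_op T w"
  "apply_op T (scale r v) = scale r (apply_op T v)"
  by (transfer; simp)+

lemma apply_op_zero [simp]: "apply_op T 0 = 0"
  using apply_op_linear(2)[of T 0 0] by (simp add: scale_simps)

lemma apply_op_sum: "apply_op (\<Sum>x\<in>X. f x) v = (\<Sum>x\<in>X. apply_op (f x) v)"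
  by (induction X rule: infinite_finite_induct) auto

definition diag :: "('a \<Rightarrow> ratfun) \<Rightarrow> 'a linop" where
  "diag g = Linop (\<lambda>v d. g d * v d)"

lemma apply_diag [simp]: "apply_op (diag g) v d = g d * v d"
  unfolding diag_def by (subst Linop_inverse) (auto simp: fun_eq_iff scale_def algebra_simps)

lemma diag_mult: "diag g * diag h = diag (\<lambda>d. g d * h d)"
  and diag_diff: "diag g - diag h = diag (\<lambda>d. g d - h d)"
  by (auto intro!: linop_eqI simp: algebra_simps)

text \<open>\<open>linop\<close> carries a ring structure only, so scalars enter as operators; by
  \<open>scal_central\<close> they commute with everything, and \<open>scal_left_commute\<close>
  moves them to the front of a product.\<close>

definition scal :: "ratfun \<Rightarrow> 'a linop" where
  "scal r = diag (\<lambda>_. r)"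

lemma apply_scal: "apply_op (scal r) v = scale r v"
  by (auto simp: scal_def scale_def)

lemma scal_simps:
  "scal 0 = 0" "scal 1 = 1" "scal (r + s) = scal r + scal s" "scal (r * s) = scal r * scal s"
  "scal (r - s) = scal r - scal s" "scal (- r) = - scal r"
  by (auto intro!: linop_eqI simp: apply_scal scale_def algebra_simps)

lemma scal_central: "T * scal r = scal r * T"
  by (rule linop_eqI) (simp add: apply_scal apply_op_linear)

lemma scal_left_commute: "T * (scal r * U) = scal r * (T * U)"
  by (metis mult.assoc scal_central)

section \<open>Fermions\<close>

text \<open>The Jordan-Wigner sign of site \<open>a\<close>: the parity of the occupied sites below
  it. Only finitely many natural numbers lie below \<open>a\<close>, so \<open>card\<close> is a
  true count also for infinite \<open>d\<close>.\<close>

definition jw_sign :: "nat \<Rightarrow> nat set \<Rightarrow> int" where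
  "jw_sign a d = (- 1) ^ card {x \<in> d. x < a}"

lemma jw_sign_square [simp]: "jw_sign a d * jw_sign a d = 1"
  by (simp add: jw_sign_def flip: power_mult_distrib)

lemma jw_sign_insert: "b \<notin> d \<Longrightarrow> jw_sign a (insert b d) =
    (if b < a then - jw_sign a d else jw_sign a d)"
proof -
  assume b: "b \<notin> d"
  have "{x \<in> insert b d. x < a} = (if b < a then insert b {x \<in> d. x < a} else {x \<in> d. x < a})"
    by auto
  then show ?thesis using b by (simp add: jw_sign_def)
qed

lemma jw_sign_remove: "b \<in> d \<Longrightarrow> jw_sign a (d - {b}) = (if b < a then - jw_sign a d else jw_sign a d)"
  using jw_sign_insert[of b "d - {b}" a] by (auto simp: insert_absorb split: if_splits)

text \<open>Creation operator. On coefficient functions it looks backwards: the value at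
  \<open>d\<close> comes from \<open>d - {a}\<close>, so on a basis vector it inserts
  \<open>a\<close>. The annihilator \<open>lower\<close> removes \<open>a\<close> in the same
  manner.\<close>

definition raise :: "nat \<Rightarrow> nat set linop" where
  "raise a = Linop (\<lambda>v d. if a \<in> d then of_int (jw_sign a d) * v (d - {a}) else 0)"

definition lower :: "nat \<Rightarrow> nat set linop" where
  "lower a = Linop (\<lambda>v d. if a \<notin> d then of_int (jw_sign a d) * v (insert a d) else 0)"

lemma apply_raise [simp]:
  "apply_op (raise a) v d = (if a \<in> d then of_int (jw_sign a d) * v (d - {a}) else 0)"
  unfolding raise_def by (subst Linop_inverse) (auto simp: fun_eq_iff scale_def algebra_simps)

lemma apply_lower [simp]:
  "apply_op (lower a) v d = (if a \<notin> d then of_int (jw_sign a d) * v (insert a d) else 0)"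
  unfolding lower_def by (subst Linop_inverse) (auto simp: fun_eq_iff scale_def algebra_simps)

lemma of_int_square_sign: "of_int (jw_sign a d) * (of_int (jw_sign a d) * x) = (x :: ratfun)"
  by (metis jw_sign_square mult.assoc mult_1 of_int_1 of_int_mult)

lemma jw_sign_self [simp]:
  "jw_sign a (insert a d) = jw_sign a d" "jw_sign a (d - {a}) = jw_sign a d"
  unfolding jw_sign_def by (rule arg_cong[where f = "\<lambda>X. (- 1) ^ card X"]; auto)+

text \<open>Removing the smaller of two sites shifts the parity seen by the larger one and not
  conversely, which gives exactly one sign; for \<open>a = b\<close> both products vanish.\<close>

lemma raise_raise: "raise a * raise b = - (raise b * raise a)"
proof (rule linop_eqI)
  fix v d
  show "apply_op (raise a * raise b) v d = apply_op (- (raise b * raise a)) v d"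
    by (cases "a = b") (auto simp: jw_sign_remove insert_commute Diff_insert2[symmetric]
        Diff_insert[symmetric] insert_Diff_if)
qed

lemma lower_lower: "lower a * lower b = - (lower b * lower a)"
proof (rule linop_eqI)
  fix v d
  show "apply_op (lower a * lower b) v d = apply_op (- (lower b * lower a)) v d"
    by (cases "a = b") (auto simp: jw_sign_insert insert_commute)
qed

text \<open>For \<open>a = b\<close> exactly one of the two products survives at a given
  \<open>d\<close>, according to whether \<open>a\<close> lies in \<open>d\<close>, and there the
  sign squares to 1.\<close>

lemma lower_raise: "lower a * raise b = of_bool (a = b) - raise b * lower a"
proof (rule linop_eqI)
  fix v d
  show "apply_op (lower a * raise b) v d = apply_op (of_bool (a = b) - raise b * lower a) v d"
    by (cases "a = b")
      (auto simp: jw_sign_insert jw_sign_remove insert_Diff_if of_int_square_sign insert_absorb)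
qed

lemma raise_raise_self [simp]: "raise a * raise a = 0"
  by (rule linop_eqI) simp

lemma lower_lower_self [simp]: "lower a * lower a = 0"
  by (rule linop_eqI) simp

definition hop :: "nat \<Rightarrow> nat \<Rightarrow> nat set linop" where
  "hop a b = raise a * lower b"

lemma hop_hop:
  "hop a b * hop c d = of_bool (b = c) * hop a d - raise a * raise c * lower b * lower d"
proof -
  have "hop a b * hop c d = raise a * (lower b * raise c) * lower d"
    by (simp add: hop_def mult.assoc)
  then show ?thesis
    by (simp add: lower_raise hop_def algebra_simps)
qed

text \<open>Reversing the two hops swaps both creators and both annihilators, so the quartic term of
  \<open>hop_hop\<close> is unchanged and drops out. What remains is the commutation rule of matrix
  units, whose second quantization the hops are.\<close>

lemma hop_commutator:
  "hop a b * hop c d - hop c d * hop a b = of_bool (b = c) * hop a d - of_bool (a = d) * hop c b"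
proof -
  have "raise a * raise c * lower b * lower d = raise a * raise c * (lower b * lower d)"
    by (simp add: mult.assoc)
  also have "\<dots> = raise c * raise a * (lower d * lower b)"
    by (simp add: raise_raise[of a c] lower_lower[of b d])
  finally have "raise a * raise c * lower b * lower d = raise c * raise a * lower d * lower b"
    by (simp add: mult.assoc)
  then show ?thesis
    by (simp add: hop_hop eq_commute)
qed

lemma hop_commute: "b \<noteq> c \<Longrightarrow> a \<noteq> d \<Longrightarrow> hop a b * hop c d = hop c d * hop a b"
  using hop_commutator[of a b c d] by simp

text \<open>The Pauli principle: the quartic term left by \<open>hop_hop\<close> contains the square
  of a creator or of an annihilator.\<close>

lemma hop_mult_zero:
  "a \<noteq> b \<Longrightarrow> hop a b * hop a c = 0"
  "b \<noteq> c \<Longrightarrow> hop a b * hop c b = 0"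
  by (auto simp: hop_hop mult.assoc)

lemma hop_self: "hop a a = diag (\<lambda>d. of_bool (a \<in> d))"
  by (rule linop_eqI) (auto simp: hop_def of_int_square_sign insert_absorb)

text \<open>\<open>q\<close> to the power \<open>\<alpha>\<close>. Only the values of \<open>\<alpha>\<close> on \<open>{1..N}\<close> matter.\<close>

definition wt_op :: "nat \<Rightarrow> weight \<Rightarrow> nat set linop" where
  "wt_op N \<alpha> = diag (\<lambda>d. \<Prod>a\<in>{1..N}. if a \<in> d then q_var powi \<alpha> a else 1)"

lemma q_var_nonzero [simp]: "q_var \<noteq> 0"
  by (simp add: q_var_def)

lemma wt_op_add: "wt_op N (\<alpha> + \<beta>) = wt_op N \<alpha> * wt_op N \<beta>"
  unfolding wt_op_def diag_mult
  by (rule arg_cong[where f = diag])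
    (auto simp: fun_eq_iff power_int_add simp flip: prod.distrib intro!: prod.cong)

lemma wt_op_zero [simp]: "wt_op N 0 = 1"
  by (rule linop_eqI) (simp add: wt_op_def cong: if_cong)

lemma wt_op_commute: "wt_op N \<alpha> * wt_op N \<beta> = wt_op N \<beta> * wt_op N \<alpha>"
  by (metis add.commute wt_op_add)

lemma wt_op_inverse [simp]: "wt_op N \<alpha> * wt_op N (- \<alpha>) = 1" "wt_op N (- \<alpha>) * wt_op N \<alpha> = 1"
  by (simp_all flip: wt_op_add)

lemma wt_op_raise:
  assumes "a \<in> {1..N}"
  shows "wt_op N \<alpha> * raise a = scal (q_var powi \<alpha> a) * (raise a * wt_op N \<alpha>)"
proof (rule linop_eqI)
  fix v d
  have "(\<Prod>b\<in>{1..N}. if b \<in> d then q_var powi \<alpha> b else 1) =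
    q_var powi \<alpha> a * (\<Prod>b\<in>{1..N}. if b \<in> d - {a} then q_var powi \<alpha> b else 1)" if "a \<in> d"
    using assms that by (subst (1 2) prod.remove[of _ a]) (auto intro!: prod.cong)
  then show "apply_op (wt_op N \<alpha> * raise a) v d
      = apply_op (scal (q_var powi \<alpha> a) * (raise a * wt_op N \<alpha>)) v d"
    by (auto simp: wt_op_def apply_scal scale_def)
qed

lemma wt_op_lower:
  assumes "a \<in> {1..N}"
  shows "wt_op N \<alpha> * lower a = scal (q_var powi (- \<alpha> a)) * (lower a * wt_op N \<alpha>)"
proof (rule linop_eqI)
  fix v d
  have "(\<Prod>b\<in>{1..N}. if b \<in> d then q_var powi \<alpha> b else 1) =
    q_var powi (- \<alpha> a) * (\<Prod>b\<in>{1..N}. if b \<in> insert a d then q_var powi \<alpha> b else 1)" if "a \<notin> d"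
    using assms that
    by (subst (1 2) prod.remove[of _ a]) (auto intro!: prod.cong simp: power_int_minus)
  then show "apply_op (wt_op N \<alpha> * lower a) v d
      = apply_op (scal (q_var powi (- \<alpha> a)) * (lower a * wt_op N \<alpha>)) v d"
    by (auto simp: wt_op_def apply_scal scale_def)
qed

lemma wt_op_hop:
  assumes "a \<in> {1..N}" "b \<in> {1..N}"
  shows "wt_op N \<alpha> * hop a b = scal (q_var powi (\<alpha> a - \<alpha> b)) * (hop a b * wt_op N \<alpha>)"
proof -
  have "wt_op N \<alpha> * hop a b = scal (q_var powi \<alpha> a) * (raise a * (wt_op N \<alpha> * lower b))"
    by (metis hop_def mult.assoc wt_op_raise[OF assms(1)])
  also have "\<dots> = scal (q_var powi \<alpha> a) * (scal (q_var powi (- \<alpha> b)) * (hop a b * wt_op N \<alpha>))"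
    by (metis hop_def mult.assoc scal_left_commute wt_op_lower[OF assms(2)])
  also have "\<dots> = scal (q_var powi \<alpha> a * q_var powi (- \<alpha> b)) * (hop a b * wt_op N \<alpha>)"
    by (simp only: scal_simps mult.assoc)
  also have "q_var powi \<alpha> a * q_var powi (- \<alpha> b) = q_var powi (\<alpha> a - \<alpha> b)"
    by (simp flip: power_int_add)
  finally show ?thesis .
qed

lemma wt_op_hop_commute:
  assumes "a \<in> {1..N}" "b \<in> {1..N}" "\<alpha> a = \<alpha> b"
  shows "wt_op N \<alpha> * hop a b = hop a b * wt_op N \<alpha>"
  using wt_op_hop[OF assms(1,2), of \<alpha>] assms(3) by (simp add: scal_simps)

lemma apply_wt_op_eps:
  assumes "a \<in> {1..N}"
  shows "apply_op (wt_op N (eps a)) v d = (if a \<in> d then q_var else 1) * v d"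
    and "apply_op (wt_op N (- eps a)) v d = (if a \<in> d then inverse q_var else 1) * v d"
proof -
  have "(\<Prod>b\<in>{1..N}. if b \<in> d then q_var powi (eps a b) else 1)
      = (\<Prod>b\<in>{1..N}. if b = a then (if a \<in> d then q_var else 1) else 1)"
    by (rule prod.cong) (auto simp: eps_def single_def)
  then show "apply_op (wt_op N (eps a)) v d = (if a \<in> d then q_var else 1) * v d"
    using assms by (simp add: wt_op_def)
  have "(\<Prod>b\<in>{1..N}. if b \<in> d then q_var powi ((- eps a) b) else 1)
      = (\<Prod>b\<in>{1..N}. if b = a then (if a \<in> d then inverse q_var else 1) else 1)"
    by (rule prod.cong) (auto simp: eps_def single_def power_int_minus)
  then show "apply_op (wt_op N (- eps a)) v d = (if a \<in> d then inverse q_var else 1) * v d"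
    using assms by (simp add: wt_op_def)
qed

section \<open>Representations of the quantum group by operators\<close>

text \<open>Commutation up to a power of \<open>q\<close>, with the exponent kept as an integer: for
  products the exponents add, for inverses they change sign, so commuting past a composite operator
  is integer arithmetic.\<close>

definition qcomm :: "int \<Rightarrow> 'a linop \<Rightarrow> 'a linop \<Rightarrow> bool" where
  "qcomm k S T \<longleftrightarrow> S * T = scal (q_var powi k) * (T * S)"

lemma qcomm_0: "qcomm 0 S T \<longleftrightarrow> S * T = T * S"
  by (simp add: qcomm_def scal_simps)

lemma qcomm_sym: "qcomm k S T \<Longrightarrow> qcomm (- k) T S"
proof -
  assume "qcomm k S T"
  then have "scal (q_var powi (- k)) * (S * T) = scal (q_var powi (- k) * q_var powi k) * (T * S)"
    by (simp add: qcomm_def scal_simps mult.assoc)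
  also have "q_var powi (- k) * q_var powi k = 1"
    by (simp flip: power_int_add)
  finally show ?thesis by (simp add: qcomm_def scal_simps)
qed

lemma qcomm_mult_left:
  assumes "qcomm k S U" "qcomm l T U"
  shows "qcomm (k + l) (S * T) U"
proof -
  have "S * T * U = S * (scal (q_var powi l) * (U * T))"
    using assms(2) by (simp add: qcomm_def mult.assoc)
  also have "\<dots> = scal (q_var powi l) * (S * U * T)"
    by (simp add: scal_left_commute mult.assoc)
  also have "\<dots> = scal (q_var powi l * q_var powi k) * (U * (S * T))"
    using assms(1) by (simp add: qcomm_def scal_simps mult.assoc)
  finally show ?thesis
    by (simp add: qcomm_def power_int_add mult.commute)
qed

lemma qcomm_mult_right:
  assumes "qcomm k S T" "qcomm l S U"
  shows "qcomm (k + l) S (T * U)"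
  using qcomm_sym[OF qcomm_mult_left[OF qcomm_sym[OF assms(1)] qcomm_sym[OF assms(2)]]] by
      (simp add: add.commute)

lemma qcomm_inverse:
  assumes "qcomm k S T" "S * S' = 1" "S' * S = 1"
  shows "qcomm (- k) S' T"
proof -
  have "S' * (T * S) * S' = S' * (scal (q_var powi (- k)) * (S * T)) * S'"
    using qcomm_sym[OF assms(1)] by (simp add: qcomm_def)
  also have "\<dots> = scal (q_var powi (- k)) * (S' * S * T * S')"
    by (simp add: scal_left_commute mult.assoc)
  finally show ?thesis
    using assms(2,3) by (simp add: qcomm_def mult.assoc)
qed

lemma qcomm_add_right: "qcomm k S T \<Longrightarrow> qcomm k S U \<Longrightarrow> qcomm k S (T + U)"
  by (simp add: qcomm_def algebra_simps)

section \<open>Quantum Serre expressions of sums and products\<close>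

definition serre :: "'a linop \<Rightarrow> 'a linop \<Rightarrow> 'a linop" where
  "serre S T = T * S * S - scal (q_var + inverse q_var) * (S * T * S) + S * S * T"

text \<open>The Serre relation of a coproduct: \<open>A\<close>, \<open>C\<close> come from one
  tensor factor, while \<open>B\<close>, \<open>D\<close> come from the other and carry a Cartan
  twist. Within a factor only the Serre relation is known, but the pairs that meet across factors
  q-commute. The mixed terms, sorted by multidegree, reduce to at most two words each, whose
  coefficients vanish because \<open>t * q = 1\<close>.\<close>

lemma serre_add:
  assumes BA: "qcomm (- 2) B A" and DA: "qcomm 1 D A" and BC: "qcomm 1 B C"
    and "serre A C = 0" "serre B D = 0"
  shows "serre (A + B) (C + D) = 0"
proof -
  define t where "t = inverse q_var"
  let ?q = q_var and ?s = "q_var + t"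
  have tq: "t * ?q = 1" by (simp add: t_def)
  have ba: "B * A = scal (t * t) * (A * B)"
    using BA by (simp add: qcomm_def t_def power_int_minus power2_eq_square)
  have da: "D * A = scal ?q * (A * D)" and bc: "B * C = scal ?q * (C * B)"
    using DA BC by (simp_all add: qcomm_def)
  \<comment> \<open>\<open>B\<close> is moved to the right past \<open>A\<close> and
    \<open>C\<close>, whose own order stays; the normal forms are \<open>C A B\<close>,
    \<open>A C B\<close> and \<open>C B B\<close>.\<close>
  have c1: "C * B * A = scal (t * t) * (C * A * B)"
    by (metis ba mult.assoc scal_left_commute)
  have c2: "B * C * A = scal t * (C * A * B)"
  proof -
    have "B * C * A = scal ?q * (scal (t * t) * (C * A * B))"
      by (metis bc c1 mult.assoc)
    also have "\<dots> = scal (?q * (t * t)) * (C * A * B)" by (simp only: scal_simps mult.assoc)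
    also have "?q * (t * t) = t" using tq by (metis mult.left_commute mult.right_neutral
        mult.commute)
    finally show ?thesis .
  qed
  have c3: "A * B * C = scal ?q * (A * C * B)"
    by (metis bc mult.assoc scal_left_commute)
  have c4: "B * A * C = scal t * (A * C * B)"
  proof -
    have "B * A * C = scal (t * t) * (scal ?q * (A * C * B))"
      by (metis ba c3 mult.assoc)
    also have "\<dots> = scal (t * t * ?q) * (A * C * B)" by (simp only: scal_simps mult.assoc)
    also have "t * t * ?q = t" using tq by (metis mult.assoc mult.right_neutral)
    finally show ?thesis .
  qed
  have c5: "B * C * B = scal ?q * (C * B * B)" by (metis bc mult.assoc)
  have c6: "B * B * C = scal (?q * ?q) * (C * B * B)"
    by (metis bc mult.assoc scal_left_commute scal_simps(4))
  \<comment> \<open>In the words with \<open>D\<close> it is \<open>A\<close> that moves to the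
    left, past \<open>D\<close> and \<open>B\<close>; the normal forms are \<open>A A D\<close>,
    \<open>A D B\<close> and \<open>A B D\<close>.\<close>
  have c7: "D * A * A = scal (?q * ?q) * (A * A * D)"
    by (metis da mult.assoc scal_left_commute scal_simps(4))
  have c8: "A * D * A = scal ?q * (A * A * D)" by (metis da mult.assoc scal_left_commute)
  have d1: "D * A * B = scal ?q * (A * D * B)" by (metis da mult.assoc)
  have d2: "D * B * A = scal t * (A * D * B)"
  proof -
    have "D * B * A = scal (t * t) * (scal ?q * (A * D * B))"
      by (metis ba d1 mult.assoc scal_left_commute)
    also have "\<dots> = scal (t * t * ?q) * (A * D * B)" by (simp only: scal_simps mult.assoc)
    also have "t * t * ?q = t" using tq by (metis mult.assoc mult.right_neutral)
    finally show ?thesis .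
  qed
  have d4: "B * A * D = scal (t * t) * (A * B * D)" by (metis ba mult.assoc)
  have d3: "B * D * A = scal t * (A * B * D)"
  proof -
    have "B * D * A = scal ?q * (scal (t * t) * (A * B * D))"
      by (metis da d4 mult.assoc scal_left_commute)
    also have "\<dots> = scal (?q * (t * t)) * (A * B * D)" by (simp only: scal_simps mult.assoc)
    also have "?q * (t * t) = t" using tq by (metis mult.left_commute mult.right_neutral
        mult.commute)
    finally show ?thesis .
  qed
  note expand = scal_simps(1-5) distrib_left distrib_right left_diff_distrib right_diff_distrib
      mult.assoc
  have "serre (A + B) (C + D) = serre A C + serre B D
     + (C * A * B + C * B * A - scal ?s * (A * C * B + B * C * A) + A * B * C + B * A * C)
     + (C * B * B - scal ?s * (B * C * B) + B * B * C)
     + (D * A * A - scal ?s * (A * D * A) + A * A * D)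
     + (D * A * B + D * B * A - scal ?s * (A * D * B + B * D * A) + A * B * D + B * A * D)"
    by (simp add: serre_def t_def algebra_simps)
  also have "C * A * B + C * B * A - scal ?s * (A * C * B + B * C * A) + A * B * C + B * A * C
      = scal (1 + t * t - ?s * t) * (C * A * B) + scal (?q + t - ?s) * (A * C * B)"
    unfolding c1 c2 c3 c4 by (simp add: expand)
  also have "C * B * B - scal ?s * (B * C * B) + B * B * C
      = scal (1 - ?s * ?q + ?q * ?q) * (C * B * B)"
    unfolding c5 c6 by (simp add: expand)
  also have "D * A * A - scal ?s * (A * D * A) + A * A * D
      = scal (?q * ?q - ?s * ?q + 1) * (A * A * D)"
    unfolding c7 c8 by (simp add: expand)
  also have "D * A * B + D * B * A - scal ?s * (A * D * B + B * D * A) + A * B * D + B * A * D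
      = scal (?q + t - ?s) * (A * D * B) + scal (1 + t * t - ?s * t) * (A * B * D)"
    unfolding d1 d2 d3 d4 by (simp add: expand)
  also have "1 + t * t - ?s * t = 0" "1 - ?s * ?q + ?q * ?q = 0" "?q * ?q - ?s * ?q + 1 = 0"
    "?q + t - ?s = 0"
    using tq by (simp_all add: algebra_simps)
  ultimately show ?thesis
    using assms(4,5) by (simp add: scal_simps)
qed

lemma serre_zero: "S * S = 0 \<Longrightarrow> S * T * S = 0 \<Longrightarrow> serre S T = 0"
  by (simp add: serre_def mult.assoc)

text \<open>The Serre expression is quadratic in its first and linear in its second argument, so
  twists that commute with everything leave the factor \<open>U * U * V\<close>. This serves the
  twisted summands of the coproduct, where twist and generator belong to different tensor
  factors.\<close>

lemma serre_mult:
  assumes "U * V = V * U" and "U * S = S * U" "U * T = T * U" "V * S = S * V" "V * T = T * V"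
  shows "serre (U * S) (V * T) = U * U * V * serre S T"
proof -
  have "V * T * (U * S) * (U * S) = U * U * V * (T * S * S)"
    using assms by (metis (no_types, lifting) mult.assoc)
  moreover have "U * S * (V * T) * (U * S) = U * U * V * (S * T * S)"
    using assms by (metis (no_types, lifting) mult.assoc)
  moreover have "U * S * (U * S) * (V * T) = U * U * V * (S * S * T)"
    using assms by (metis (no_types, lifting) mult.assoc)
  ultimately show ?thesis
    by (simp add: serre_def distrib_left right_diff_distrib scal_left_commute)
qed

text \<open>The defining relations of the quantum group as equations between operators. The inverse
  of \<open>K i\<close> is a separate parameter \<open>L i\<close>, just as the presentation has
  separate generators, and the denominator \<open>q - 1/q\<close> is cleared in
  \<open>E_F\<close>.\<close>

locale uq_rep =
  fixes N :: nat and E F K L :: "nat \<Rightarrow> 'a linop"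
  assumes K_L: "i \<in> {1..N} \<Longrightarrow> K i * L i = 1" "i \<in> {1..N} \<Longrightarrow> L i * K i = 1"
    and K_K: "i \<in> {1..N} \<Longrightarrow> j \<in> {1..N} \<Longrightarrow> K i * K j = K j * K i"
    and K_E: "i \<in> {1..N} \<Longrightarrow> j \<in> {1..<N} \<Longrightarrow>
      qcomm (of_bool (i = j) - of_bool (i = j + 1)) (K i) (E j)"
    and K_F: "i \<in> {1..N} \<Longrightarrow> j \<in> {1..<N} \<Longrightarrow>
      qcomm (- of_bool (i = j) + of_bool (i = j + 1)) (K i) (F j)"
    and E_F: "i \<in> {1..<N} \<Longrightarrow> j \<in> {1..<N} \<Longrightarrow>
      scal (q_var - inverse q_var) * (E i * F j - F j * E i)
        = (if i = j then K i * L (i + 1) - L i * K (i + 1) else 0)"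
    and E_E: "i \<in> {1..<N} \<Longrightarrow> j \<in> {1..<N} \<Longrightarrow> \<bar>int i - int j\<bar> > 1 \<Longrightarrow> E i * E j = E j * E i"
    and F_F: "i \<in> {1..<N} \<Longrightarrow> j \<in> {1..<N} \<Longrightarrow> \<bar>int i - int j\<bar> > 1 \<Longrightarrow> F i * F j = F j * F i"
    and serre_E: "i \<in> {1..<N} \<Longrightarrow> j \<in> {1..<N} \<Longrightarrow> \<bar>int i - int j\<bar> = 1 \<Longrightarrow> serre (E i) (E j) = 0"
    and serre_F: "i \<in> {1..<N} \<Longrightarrow> j \<in> {1..<N} \<Longrightarrow> \<bar>int i - int j\<bar> = 1 \<Longrightarrow> serre (F i) (F j) = 0"
begin

lemma L_comm:
  assumes "i \<in> {1..N}" "j \<in> {1..N}"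
  shows "L i * K j = K j * L i" "L i * L j = L j * L i"
proof -
  have *: "qcomm 0 (L i) (K j)" if "i \<in> {1..N}" "j \<in> {1..N}" for i j
    using qcomm_inverse[of 0 "K i" "K j" "L i"] K_L K_K that by (simp add: qcomm_0)
  then show "L i * K j = K j * L i" using assms by (simp add: qcomm_0)
  show "L i * L j = L j * L i"
    using qcomm_inverse[of 0 "K j" "L i" "L j"] K_L *[OF assms] assms by (simp add: qcomm_0)
qed

lemma L_E: "i \<in> {1..N} \<Longrightarrow> j \<in> {1..<N} \<Longrightarrow> qcomm (- of_bool (i = j) + of_bool (i = j + 1)) (L i) (E j)"
  using qcomm_inverse[OF K_E[of i j] K_L] by simp

lemma L_F: "i \<in> {1..N} \<Longrightarrow> j \<in> {1..<N} \<Longrightarrow> qcomm (of_bool (i = j) - of_bool (i = j + 1)) (L i) (F j)"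
  using qcomm_inverse[OF K_F[of i j] K_L] by simp

end

definition cartan :: "nat \<Rightarrow> nat \<Rightarrow> int" where
  "cartan i j = 2 * of_bool (i = j) - of_bool (i = j + 1) - of_bool (i + 1 = j)"

context uq_rep
begin

lemma H_comm:
  assumes "i \<in> {1..<N}" "j \<in> {1..<N}"
  shows "qcomm (cartan i j) (K i * L (i + 1)) (E j)" "qcomm (- cartan i j) (L i * K (i + 1)) (E j)"
    "qcomm (- cartan i j) (K i * L (i + 1)) (F j)" "qcomm (cartan i j) (L i * K (i + 1)) (F j)"
proof -
  have i: "i \<in> {1..N}" "i + 1 \<in> {1..N}" using assms by auto
  show "qcomm (cartan i j) (K i * L (i + 1)) (E j)"
    using qcomm_mult_left[OF K_E[OF i(1) assms(2)] L_E[OF i(2) assms(2)]]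
    by (rule back_subst[of "\<lambda>k. qcomm k _ _"]) (auto simp: cartan_def)
  show "qcomm (- cartan i j) (L i * K (i + 1)) (E j)"
    using qcomm_mult_left[OF L_E[OF i(1) assms(2)] K_E[OF i(2) assms(2)]]
    by (rule back_subst[of "\<lambda>k. qcomm k _ _"]) (auto simp: cartan_def)
  show "qcomm (- cartan i j) (K i * L (i + 1)) (F j)"
    using qcomm_mult_left[OF K_F[OF i(1) assms(2)] L_F[OF i(2) assms(2)]]
    by (rule back_subst[of "\<lambda>k. qcomm k _ _"]) (auto simp: cartan_def)
  show "qcomm (cartan i j) (L i * K (i + 1)) (F j)"
    using qcomm_mult_left[OF L_F[OF i(1) assms(2)] K_F[OF i(2) assms(2)]]
    by (rule back_subst[of "\<lambda>k. qcomm k _ _"]) (auto simp: cartan_def)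
qed

end

text \<open>The sites form an arbitrary injective sequence, since the anticommutation relations do
  not see where a site lies; so one lemma serves columns, rows and the whole exterior algebra. The
  Serre relations hold termwise: every term contains \<open>S * S\<close> or
  \<open>S * T * S\<close>, and both are zero.\<close>

lemma fermion_rep:
  assumes a: "\<And>k. k \<in> {1..N} \<Longrightarrow> a k \<in> {1..M}" and inj: "inj_on a {1..N}"
  shows "uq_rep N (\<lambda>k. hop (a k) (a (k + 1))) (\<lambda>k. hop (a (k + 1)) (a k))
    (\<lambda>k. wt_op M (eps (a k))) (\<lambda>k. wt_op M (- eps (a k)))"
proof
  have eq: "a i = a j \<longleftrightarrow> i = j" if "i \<in> {1..N}" "j \<in> {1..N}" for i j
    by (rule inj_on_eq_iff[OF inj that])
  fix i j
  show "i \<in> {1..N} \<Longrightarrow> wt_op M (eps (a i)) * wt_op M (- eps (a i)) = 1"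
    "i \<in> {1..N} \<Longrightarrow> wt_op M (- eps (a i)) * wt_op M (eps (a i)) = 1"
    by simp_all
  show "wt_op M (eps (a i)) * wt_op M (eps (a j)) = wt_op M (eps (a j)) * wt_op M (eps (a i))"
    by (rule wt_op_commute)
  show "qcomm (of_bool (i = j) - of_bool (i = j + 1)) (wt_op M (eps (a i))) (hop (a j) (a (j + 1)))"
    if "i \<in> {1..N}" "j \<in> {1..<N}"
    using that a[of j] a[of "j + 1"] wt_op_hop[of "a j" M "a (j + 1)"]
      wt_op_hop[of "a (j + 1)" M "a j"] eq[of j i] eq[of "j + 1" i]
    by (auto simp: qcomm_def eps_def single_def)
  show "qcomm (- of_bool (i = j) + of_bool (i = j + 1)) (wt_op M (eps (a i)))
      (hop (a (j + 1)) (a j))"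
    if "i \<in> {1..N}" "j \<in> {1..<N}"
    using that a[of j] a[of "j + 1"] wt_op_hop[of "a j" M "a (j + 1)"]
      wt_op_hop[of "a (j + 1)" M "a j"] eq[of j i] eq[of "j + 1" i]
    by (auto simp: qcomm_def eps_def single_def)
  show "scal (q_var - inverse q_var) * (hop (a i) (a (i + 1)) * hop (a (j + 1)) (a j)
        - hop (a (j + 1)) (a j) * hop (a i) (a (i + 1)))
      = (if i = j then wt_op M (eps (a i)) * wt_op M (- eps (a (i + 1)))
          - wt_op M (- eps (a i)) * wt_op M (eps (a (i + 1))) else 0)"
    if ij: "i \<in> {1..<N}" "j \<in> {1..<N}"
  proof (cases "i = j")
    case True
    have "a i \<in> {1..M}" "a (i + 1) \<in> {1..M}" using ij a[of i] a[of "i + 1"] by auto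
    \<comment> \<open>Occupation numbers \<open>x\<close>, \<open>y\<close> are 0 or 1, and for
      these \<open>(q - 1/q) (x - y)\<close> equals \<open>q^(x-y) - q^(y-x)\<close>: the q-integer
      is the ordinary integer.\<close>
    then have "scal (q_var - inverse q_var) * (hop (a i) (a i) - hop (a (i + 1)) (a (i + 1)))
        = wt_op M (eps (a i)) * wt_op M (- eps (a (i + 1)))
          - wt_op M (- eps (a i)) * wt_op M (eps (a (i + 1)))"
      by (intro linop_eqI)
        (simp add: apply_scal scale_def hop_self diag_diff apply_wt_op_eps del: atLeastAtMost_iff,
            simp add: algebra_simps)
    then show ?thesis using True by (simp add: hop_commutator)
  next
    case False
    then show ?thesis using ij eq[of i j] eq[of "i + 1" "j + 1"] by (simp add: hop_commutator)
  qed
  show "hop (a i) (a (i + 1)) * hop (a j) (a (j + 1)) = hop (a j) (a (j + 1)) * hop (a i)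
      (a (i + 1))"
    if "i \<in> {1..<N}" "j \<in> {1..<N}" "\<bar>int i - int j\<bar> > 1"
    using that by (intro hop_commute) (auto simp: eq)
  show "hop (a (i + 1)) (a i) * hop (a (j + 1)) (a j) = hop (a (j + 1)) (a j) * hop (a (i + 1))
      (a i)"
    if "i \<in> {1..<N}" "j \<in> {1..<N}" "\<bar>int i - int j\<bar> > 1"
    using that by (intro hop_commute) (auto simp: eq)
  \<comment> \<open>Interchanging the first two factors costs a single hop; in both resulting
    products the factor next to the last \<open>hop b c\<close> shares its creator or its
    annihilator with it.\<close>
  have hop3: "hop b c * hop c d * hop b c = 0" "hop b c * hop d b * hop b c = 0" if "b \<noteq> c" "d \<noteq> b"
      "d \<noteq> c" for b c d
  proof -
    have "hop b c * hop c d = hop c d * hop b c + hop b d"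
      using hop_commutator[of b c c d] that by (simp add: algebra_simps)
    then show "hop b c * hop c d * hop b c = 0"
      using that by (simp add: distrib_right mult.assoc hop_mult_zero)
    have "hop b c * hop d b = hop d b * hop b c - hop d c"
      using hop_commutator[of b c d b] that by (simp add: algebra_simps)
    then show "hop b c * hop d b * hop b c = 0"
      using that by (simp add: left_diff_distrib mult.assoc hop_mult_zero)
  qed
  show "serre (hop (a i) (a (i + 1))) (hop (a j) (a (j + 1))) = 0"
    "serre (hop (a (i + 1)) (a i)) (hop (a (j + 1)) (a j)) = 0"
    if ij: "i \<in> {1..<N}" "j \<in> {1..<N}" "\<bar>int i - int j\<bar> = 1"
  proof -
    have "a i \<noteq> a (i + 1)" using ij eq[of i "i + 1"] by simp
    moreover consider "j = i + 1" | "i = j + 1" using ij by linarith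
    then have "hop (a i) (a (i + 1)) * hop (a j) (a (j + 1)) * hop (a i) (a (i + 1)) = 0 \<and>
      hop (a (i + 1)) (a i) * hop (a (j + 1)) (a j) * hop (a (i + 1)) (a i) = 0"
    proof cases
      case 1
      then show ?thesis using ij eq[of i "i + 1"] eq[of i "i + 2"] eq[of "i + 1" "i + 2"]
          hop3[of "a i" "a (i + 1)" "a (i + 2)"] hop3[of "a (i + 1)" "a i" "a (i + 2)"]
        by simp
    next
      case 2
      then show ?thesis using ij eq[of i j] eq[of i "i + 1"] eq[of "j" "i + 1"]
          hop3[of "a i" "a (i + 1)" "a j"] hop3[of "a (i + 1)" "a i" "a j"]
        by simp
    qed
    ultimately show "serre (hop (a i) (a (i + 1))) (hop (a j) (a (j + 1))) = 0"
      "serre (hop (a (i + 1)) (a i)) (hop (a (j + 1)) (a j)) = 0"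
      by (auto intro!: serre_zero simp: hop_mult_zero)
  qed
qed

lemma qcomm_add_left: "qcomm k S U \<Longrightarrow> qcomm k T U \<Longrightarrow> qcomm k (S + T) U"
  by (simp add: qcomm_def algebra_simps)

lemma mult_commute_middle: "b * c = c * b \<Longrightarrow> (a * b) * (c * d) = (a * c) * (b * d)"
  for a :: "'a::semigroup_mult"
  by (metis mult.assoc)

lemma cartan_sym: "cartan i j = cartan j i"
  by (auto simp: cartan_def)

text \<open>The coproduct \<open>e \<mapsto> e \<otimes> 1 + q\<^sup>-\<^sup>h \<otimes> e\<close>, \<open>f \<mapsto> f \<otimes> q\<^sup>h + 1 \<otimes> f\<close>.\<close>

lemma uq_rep_coproduct:
  assumes rep: "uq_rep N E F K L" and rep': "uq_rep N E' F' K' L'"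
    and comm: "\<And>S T. S \<in> E ` {1..<N} \<union> F ` {1..<N} \<union> K ` {1..N} \<union> L ` {1..N} \<Longrightarrow>
      T \<in> E' ` {1..<N} \<union> F' ` {1..<N} \<union> K' ` {1..N} \<union> L' ` {1..N} \<Longrightarrow> S * T = T * S"
  shows "uq_rep N (\<lambda>i. E i + L i * K (i + 1) * E' i) (\<lambda>i. F i * (K' i * L' (i + 1)) + F' i)
    (\<lambda>i. K i * K' i) (\<lambda>i. L i * L' i)"
proof -
  interpret A: uq_rep N E F K L by (rule rep)
  interpret B: uq_rep N E' F' K' L' by (rule rep')
  define Hi where "Hi i = L i * K (i + 1)" for i
  define H where "H i = K i * L (i + 1)" for i
  define Hi' where "Hi' i = L' i * K' (i + 1)" for i
  define H' where "H' i = K' i * L' (i + 1)" for i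
  \<comment> \<open>The hypothesis covers the generators only; adding the Cartan products to both
    sets lets the single fact \<open>cm\<close> handle the twists as well.\<close>
  define X where "X = E ` {1..<N} \<union> F ` {1..<N} \<union> K ` {1..N} \<union> L ` {1..N} \<union> H ` {1..<N} \<union> Hi `
      {1..<N}"
  define X' where "X' = E' ` {1..<N} \<union> F' ` {1..<N} \<union> K' ` {1..N} \<union> L' ` {1..N} \<union> H' ` {1..<N} \<union>
      Hi' ` {1..<N}"
  have mem: "i \<in> {1..<N} \<Longrightarrow> E i \<in> X" "i \<in> {1..<N} \<Longrightarrow> F i \<in> X" "i \<in> {1..N} \<Longrightarrow> K i \<in> X"
    "i \<in> {1..N} \<Longrightarrow> L i \<in> X" "i \<in> {1..<N} \<Longrightarrow> H i \<in> X" "i \<in> {1..<N} \<Longrightarrow> Hi i \<in> X" for i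
    by (auto simp: X_def)
  have mem': "i \<in> {1..<N} \<Longrightarrow> E' i \<in> X'" "i \<in> {1..<N} \<Longrightarrow> F' i \<in> X'" "i \<in> {1..N} \<Longrightarrow> K' i \<in> X'"
    "i \<in> {1..N} \<Longrightarrow> L' i \<in> X'" "i \<in> {1..<N} \<Longrightarrow> H' i \<in> X'" "i \<in> {1..<N} \<Longrightarrow> Hi' i \<in> X'" for i
    by (auto simp: X'_def)
  have prod_comm: "S * T * U = U * (S * T)" if "S * U = U * S" "T * U = U * T" for S T U :: "'a
      linop"
    using that by (metis mult.assoc)
  have c1: "S * T = T * S" if S: "S \<in> X" and T: "T \<in> E' ` {1..<N} \<union> F' ` {1..<N} \<union> K' ` {1..N} \<union> L'
      ` {1..N}" for S T
  proof -
    consider "S \<in> E ` {1..<N} \<union> F ` {1..<N} \<union> K ` {1..N} \<union> L ` {1..N}"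
      | i where "i \<in> {1..<N}" "S = K i * L (i + 1)" | i where "i \<in> {1..<N}" "S = L i * K (i + 1)"
      using S unfolding X_def H_def Hi_def by blast
    then show ?thesis
    proof cases
      case 1
      then show ?thesis by (rule comm[OF _ T])
    next
      case 2
      show ?thesis unfolding 2(2) by (rule prod_comm; rule comm[OF _ T]) (use 2(1) in auto)
    next
      case 3
      show ?thesis unfolding 3(2) by (rule prod_comm; rule comm[OF _ T]) (use 3(1) in auto)
    qed
  qed
  have cm: "S * T = T * S" if S: "S \<in> X" and T: "T \<in> X'" for S T
  proof -
    consider "T \<in> E' ` {1..<N} \<union> F' ` {1..<N} \<union> K' ` {1..N} \<union> L' ` {1..N}"
      | i where "i \<in> {1..<N}" "T = K' i * L' (i + 1)" | i where "i \<in> {1..<N}" "T = L' i * K'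
          (i + 1)"
      using T unfolding X'_def H'_def Hi'_def by blast
    then show ?thesis
    proof cases
      case 1
      then show ?thesis by (rule c1[OF S])
    next
      case 2
      show ?thesis unfolding 2(2) by (rule prod_comm[symmetric]; rule c1[OF S, symmetric])
          (use 2(1) in auto)
    next
      case 3
      show ?thesis unfolding 3(2) by (rule prod_comm[symmetric]; rule c1[OF S, symmetric])
          (use 3(1) in auto)
    qed
  qed
  have cq: "qcomm 0 S T" "qcomm 0 T S" if "S \<in> X" "T \<in> X'" for S T
    using cm[OF that] by (simp_all add: qcomm_0)
  have KH: "qcomm 0 (K i) (H j)" "qcomm 0 (K i) (Hi j)" if "i \<in> {1..N}" "j \<in> {1..<N}" for i j
    using that A.K_K[of i j] A.K_K[of i "j + 1"] A.L_comm(1)[of j i] A.L_comm(1)[of "j + 1" i]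
      prod_comm[of "K j" "K i" "L (j + 1)"] prod_comm[of "L j" "K i" "K (j + 1)"]
    by (auto simp: qcomm_0 H_def Hi_def)
  have KH': "qcomm 0 (K' i) (H' j)" "qcomm 0 (K' i) (Hi' j)" if "i \<in> {1..N}" "j \<in> {1..<N}" for i j
    using that B.K_K[of i j] B.K_K[of i "j + 1"] B.L_comm(1)[of j i] B.L_comm(1)[of "j + 1" i]
      prod_comm[of "K' j" "K' i" "L' (j + 1)"] prod_comm[of "L' j" "K' i" "K' (j + 1)"]
    by (auto simp: qcomm_0 H'_def Hi'_def)
  have LH: "qcomm 0 (L i) (Hi j)" if "i \<in> {1..N}" "j \<in> {1..<N}" for i j
    using that A.L_comm(2)[of i j] A.L_comm(1)[of i "j + 1"]
      prod_comm[of "L j" "L i" "K (j + 1)"]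
    by (auto simp: qcomm_0 Hi_def)
  have LH': "qcomm 0 (L' i) (H' j)" if "i \<in> {1..N}" "j \<in> {1..<N}" for i j
    using that B.L_comm(2)[of i "j + 1"] B.L_comm(1)[of i "j"]
      prod_comm[of "K' j" "L' i" "L' (j + 1)"]
    by (auto simp: qcomm_0 H'_def)
  have HiHi: "Hi i * Hi j = Hi j * Hi i" if "i \<in> {1..<N}" "j \<in> {1..<N}" for i j
    using qcomm_mult_left[OF LH[of i j] KH(2)[of "i + 1" j]] that by (simp add: qcomm_0 Hi_def)
  have H'H': "H' i * H' j = H' j * H' i" if "i \<in> {1..<N}" "j \<in> {1..<N}" for i j
    using qcomm_mult_left[OF KH'(1)[of i j] LH'[of "i + 1" j]] that by (simp add: qcomm_0 H'_def)
  note HE = A.H_comm[folded H_def Hi_def] and HE' = B.H_comm[folded H'_def Hi'_def]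
  have "uq_rep N (\<lambda>i. E i + Hi i * E' i) (\<lambda>i. F i * H' i + F' i) (\<lambda>i. K i * K' i) (\<lambda>i. L i * L' i)"
  proof
    fix i j
    show "K i * K' i * (L i * L' i) = 1" if "i \<in> {1..N}"
      using mult_commute_middle[OF cm[OF mem(4) mem'(3), symmetric]] A.K_L B.K_L that by simp
    show "L i * L' i * (K i * K' i) = 1" if "i \<in> {1..N}"
      using mult_commute_middle[OF cm[OF mem(3) mem'(4), symmetric]] A.K_L B.K_L that by simp
    show "K i * K' i * (K j * K' j) = K j * K' j * (K i * K' i)" if "i \<in> {1..N}" "j \<in> {1..N}"
      using mult_commute_middle[OF cm[OF mem(3) mem'(3), symmetric], of j i]
        mult_commute_middle[OF cm[OF mem(3) mem'(3), symmetric], of i j] A.K_K B.K_K that by simp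
    show "qcomm (of_bool (i = j) - of_bool (i = j + 1)) (K i * K' i) (E j + Hi j * E' j)"
      if ij: "i \<in> {1..N}" "j \<in> {1..<N}"
    proof (rule qcomm_add_right)
      show "qcomm (of_bool (i = j) - of_bool (i = j + 1)) (K i * K' i) (E j)"
        using qcomm_mult_left[OF A.K_E[OF ij] cq(2)[OF mem(1) mem'(3)]] ij by simp
      have "qcomm 0 (K i * K' i) (Hi j)"
        using qcomm_mult_left[OF KH(2)[OF ij] cq(2)[OF mem(6) mem'(3)]] ij by simp
      moreover have "qcomm (of_bool (i = j) - of_bool (i = j + 1)) (K i * K' i) (E' j)"
        using qcomm_mult_left[OF cq(1)[OF mem(3) mem'(1)] B.K_E[OF ij]] ij by simp
      ultimately show "qcomm (of_bool (i = j) - of_bool (i = j + 1)) (K i * K' i) (Hi j * E' j)"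
        using qcomm_mult_right[of 0 _ "Hi j"] by fastforce
    qed
    show "qcomm (- of_bool (i = j) + of_bool (i = j + 1)) (K i * K' i) (F j * H' j + F' j)"
      if ij: "i \<in> {1..N}" "j \<in> {1..<N}"
    proof (rule qcomm_add_right)
      show "qcomm (- of_bool (i = j) + of_bool (i = j + 1)) (K i * K' i) (F' j)"
        using qcomm_mult_left[OF cq(1)[OF mem(3) mem'(2)] B.K_F[OF ij]] ij by simp
      have "qcomm 0 (K i * K' i) (H' j)"
        using qcomm_mult_left[OF cq(1)[OF mem(3) mem'(5)] KH'(1)[OF ij]] ij by simp
      moreover have "qcomm (- of_bool (i = j) + of_bool (i = j + 1)) (K i * K' i) (F j)"
        using qcomm_mult_left[OF A.K_F[OF ij] cq(2)[OF mem(2) mem'(3)]] ij by simp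
      ultimately show "qcomm (- of_bool (i = j) + of_bool (i = j + 1)) (K i * K' i) (F j * H' j)"
        using qcomm_mult_right[of _ _ "F j" 0] by fastforce
    qed
    show "scal (q_var - inverse q_var) * ((E i + Hi i * E' i) * (F j * H' j + F' j)
          - (F j * H' j + F' j) * (E i + Hi i * E' i))
        = (if i = j then K i * K' i * (L (i + 1) * L' (i + 1)) - L i * L' i *
            (K (i + 1) * K' (i + 1)) else 0)"
      if ij: "i \<in> {1..<N}" "j \<in> {1..<N}"
    proof -
      \<comment> \<open>The one cross term whose factors do not commute individually: moving the
        twist \<open>Hi i\<close> past \<open>F j\<close> contributes the exponent
        \<open>cartan i j\<close>, moving \<open>E' i\<close> past \<open>H' j\<close> contributes
        \<open>- cartan j i\<close>.\<close>
      have 1: "Hi i * E' i * (F j * H' j) = F j * H' j * (Hi i * E' i)"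
      proof -
        have "qcomm (cartan i j - cartan j i) (Hi i * E' i) (F j * H' j)"
          using qcomm_mult_right[OF qcomm_mult_left[OF HE(4)[OF ij]
              cq(2)[OF mem(2)[OF ij(2)] mem'(1)[OF ij(1)]]]
              qcomm_mult_left[OF cq(1)[OF mem(6)[OF ij(1)] mem'(5)[OF ij(2)]]
                  qcomm_sym[OF HE'(1)[OF ij(2,1)]]]]
          by simp
        then show ?thesis by (simp add: cartan_sym[of i j] qcomm_0)
      qed
      have 2: "E i * F' j = F' j * E i" "Hi i * F' j = F' j * Hi i" "H' j * E i = E i * H' j"
        using cm ij mem mem' by metis+
      have "(E i + Hi i * E' i) * (F j * H' j + F' j) - (F j * H' j + F' j) * (E i + Hi i * E' i)
        = (E i * F j - F j * E i) * H' j + Hi i * (E' i * F' j - F' j * E' i)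
          + (E i * F' j - F' j * E i) + (Hi i * E' i * (F j * H' j) - F j * H' j * (Hi i * E' i))
          + (F j * (E i * H' j - H' j * E i)) + ((Hi i * F' j - F' j * Hi i) * E' i)"
        by (simp add: algebra_simps)
      also have "\<dots> = (E i * F j - F j * E i) * H' j + Hi i * (E' i * F' j - F' j * E' i)"
        by (simp add: 1 2)
      finally have "scal (q_var - inverse q_var) * ((E i + Hi i * E' i) * (F j * H' j + F' j)
          - (F j * H' j + F' j) * (E i + Hi i * E' i))
        = (scal (q_var - inverse q_var) * (E i * F j - F j * E i)) * H' j
          + Hi i * (scal (q_var - inverse q_var) * (E' i * F' j - F' j * E' i))"
        by (simp add: distrib_left mult.assoc scal_left_commute[of "Hi i"])
      \<comment> \<open>Telescoping: the mixed terms \<open>Hi H'\<close> of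
        \<open>(H - Hi) H' + Hi (H' - Hi')\<close> cancel.\<close>
      also have "\<dots> = (if i = j then H i * H' i - Hi i * Hi' i else 0)"
        by (simp only: A.E_F[OF ij] B.E_F[OF ij])
          (simp add: H_def H'_def Hi_def Hi'_def left_diff_distrib right_diff_distrib)
      also have "H i * H' i = K i * K' i * (L (i + 1) * L' (i + 1))"
        unfolding H_def H'_def
        by (rule mult_commute_middle) (use ij in \<open>auto intro!: cm mem mem'\<close>)
      also have "Hi i * Hi' i = L i * L' i * (K (i + 1) * K' (i + 1))"
        unfolding Hi_def Hi'_def
        by (rule mult_commute_middle) (use ij in \<open>auto intro!: cm mem mem'\<close>)
      finally show ?thesis .
    qed
    show "(E i + Hi i * E' i) * (E j + Hi j * E' j) = (E j + Hi j * E' j) * (E i + Hi i * E' i)"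
      if ij: "i \<in> {1..<N}" "j \<in> {1..<N}" "\<bar>int i - int j\<bar> > 1"
    proof -
      have c: "cartan i j = 0" "cartan j i = 0" using ij(3) by (auto simp: cartan_def)
      have "qcomm 0 (E i) (Hi j * E' j)"
        using qcomm_mult_right[OF qcomm_sym[OF HE(2)[OF ij(2,1)]]
            cq(1)[OF mem(1)[OF ij(1)] mem'(1)[OF ij(2)]]] c by simp
      moreover have "qcomm 0 (Hi i * E' i) (E j)"
        using qcomm_mult_left[OF HE(2)[OF ij(1,2)] cq(2)[OF mem(1)[OF ij(2)] mem'(1)[OF ij(1)]]] c
            by simp
      moreover have "qcomm 0 (Hi i * E' i) (Hi j * E' j)"
      proof -
        have "Hi i * E' i * (Hi j * E' j) = Hi i * Hi j * (E' i * E' j)"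
          by (rule mult_commute_middle) (use ij cm mem mem' in metis)
        also have "\<dots> = Hi j * Hi i * (E' j * E' i)"
          using B.E_E[OF ij] HiHi[OF ij(1,2)] by simp
        also have "\<dots> = Hi j * E' j * (Hi i * E' i)"
          by (rule mult_commute_middle) (use ij cm mem mem' in metis)
        finally show ?thesis by (simp add: qcomm_0)
      qed
      moreover have "qcomm 0 (E i) (E j)" using A.E_E[OF ij] by (simp add: qcomm_0)
      ultimately show ?thesis unfolding qcomm_0[symmetric]
        by (intro qcomm_add_left qcomm_add_right)
    qed
    show "(F i * H' i + F' i) * (F j * H' j + F' j) = (F j * H' j + F' j) * (F i * H' i + F' i)"
      if ij: "i \<in> {1..<N}" "j \<in> {1..<N}" "\<bar>int i - int j\<bar> > 1"
    proof -
      have c: "cartan i j = 0" "cartan j i = 0" using ij(3) by (auto simp: cartan_def)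
      have "qcomm 0 (F' i) (F j * H' j)"
        using qcomm_mult_right[OF cq(2)[OF mem(2)[OF ij(2)] mem'(2)[OF ij(1)]]
            qcomm_sym[OF HE'(3)[OF ij(2,1)]]] c by simp
      moreover have "qcomm 0 (F i * H' i) (F' j)"
        using qcomm_mult_left[OF cq(1)[OF mem(2)[OF ij(1)] mem'(2)[OF ij(2)]] HE'(3)[OF ij(1,2)]] c
            by simp
      moreover have "qcomm 0 (F i * H' i) (F j * H' j)"
      proof -
        have "F i * H' i * (F j * H' j) = F i * F j * (H' i * H' j)"
          by (rule mult_commute_middle) (use ij cm mem mem' in metis)
        also have "\<dots> = F j * F i * (H' j * H' i)"
          using A.F_F[OF ij] H'H'[OF ij(1,2)] by simp
        also have "\<dots> = F j * H' j * (F i * H' i)"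
          by (rule mult_commute_middle) (use ij cm mem mem' in metis)
        finally show ?thesis by (simp add: qcomm_0)
      qed
      moreover have "qcomm 0 (F' i) (F' j)" using B.F_F[OF ij] by (simp add: qcomm_0)
      ultimately show ?thesis unfolding qcomm_0[symmetric]
        by (intro qcomm_add_left qcomm_add_right)
    qed
    show "serre (E i + Hi i * E' i) (E j + Hi j * E' j) = 0"
      if ij: "i \<in> {1..<N}" "j \<in> {1..<N}" "\<bar>int i - int j\<bar> = 1"
    proof (rule serre_add)
      \<comment> \<open>The exponents \<open>- 2\<close>, \<open>1\<close>, \<open>1\<close>
        demanded by \<open>serre_add\<close> are negated Cartan entries, contributed by the twist in
        front of \<open>E'\<close>.\<close>
      have c: "cartan i j = - 1" "cartan j i = - 1" "cartan i i = 2" using ij(3) by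
          (auto simp: cartan_def)
      show "qcomm (- 2) (Hi i * E' i) (E i)"
        using qcomm_mult_left[OF HE(2)[OF ij(1,1)] cq(2)[OF mem(1)[OF ij(1)] mem'(1)[OF ij(1)]]] c
            by simp
      show "qcomm 1 (Hi j * E' j) (E i)"
        using qcomm_mult_left[OF HE(2)[OF ij(2,1)] cq(2)[OF mem(1)[OF ij(1)] mem'(1)[OF ij(2)]]] c
            by simp
      show "qcomm 1 (Hi i * E' i) (E j)"
        using qcomm_mult_left[OF HE(2)[OF ij(1,2)] cq(2)[OF mem(1)[OF ij(2)] mem'(1)[OF ij(1)]]] c
            by simp
      have "serre (Hi i * E' i) (Hi j * E' j) = Hi i * Hi i * Hi j * serre (E' i) (E' j)"
        by (rule serre_mult) (use ij cm mem mem' HiHi in metis)+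
      then show "serre (Hi i * E' i) (Hi j * E' j) = 0" using B.serre_E[OF ij] by simp
    qed (rule A.serre_E[OF ij])
    show "serre (F i * H' i + F' i) (F j * H' j + F' j) = 0"
      if ij: "i \<in> {1..<N}" "j \<in> {1..<N}" "\<bar>int i - int j\<bar> = 1"
    proof -
      have c: "cartan i j = - 1" "cartan j i = - 1" "cartan i i = 2" using ij(3) by
          (auto simp: cartan_def)
      have FH: "F i * H' i = H' i * F i" "F j * H' j = H' j * F j"
        using ij cm mem mem' by metis+
      \<comment> \<open>For \<open>F\<close> the twist sits on the summand from the first tensor
        factor, so the summands enter \<open>serre_add\<close> in the opposite order.\<close>
      have "serre (F' i + F i * H' i) (F' j + F j * H' j) = 0"
      proof (rule serre_add)
        show "qcomm (- 2) (F i * H' i) (F' i)"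
          using qcomm_mult_left[OF cq(1)[OF mem(2)[OF ij(1)] mem'(2)[OF ij(1)]] HE'(3)[OF ij(1,1)]]
              c by simp
        show "qcomm 1 (F j * H' j) (F' i)"
          using qcomm_mult_left[OF cq(1)[OF mem(2)[OF ij(2)] mem'(2)[OF ij(1)]] HE'(3)[OF ij(2,1)]]
              c by simp
        show "qcomm 1 (F i * H' i) (F' j)"
          using qcomm_mult_left[OF cq(1)[OF mem(2)[OF ij(1)] mem'(2)[OF ij(2)]] HE'(3)[OF ij(1,2)]]
              c by simp
        have "serre (H' i * F i) (H' j * F j) = H' i * H' i * H' j * serre (F i) (F j)"
          by (rule serre_mult) (use ij cm mem mem' H'H' in metis)+
        then show "serre (F i * H' i) (F j * H' j) = 0" using A.serre_F[OF ij] FH by simp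
      qed (rule B.serre_F[OF ij])
      then show ?thesis by (simp add: add.commute)
    qed
  qed
  then show ?thesis by (simp add: Hi_def H'_def)
qed

section \<open>Left and right operators\<close>

text \<open>The Cartan factor that the iterated coproduct puts in front of the \<open>j\<close>-th
  summand: for \<open>b\<close> one generator step after \<open>a\<close> it is \<open>- h\<close>,
  summed over the positions that \<open>lt\<close> places before \<open>j\<close>; with
  \<open>a\<close> and \<open>b\<close> exchanged it is \<open>+ h\<close>.\<close>

definition grid_wt :: "'j set \<Rightarrow> ('j \<Rightarrow> 'j \<Rightarrow> bool) \<Rightarrow> ('j \<Rightarrow> nat) \<Rightarrow> ('j \<Rightarrow> nat) \<Rightarrow> 'j \<Rightarrow> weight" where
  "grid_wt J lt a b j = (\<Sum>j'\<in>{j' \<in> J. lt j' j}. eps (b j') - eps (a j'))"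

text \<open>Both the left and the right operators have this shape: \<open>E\<close> and \<open>F\<close> differ by reversing
  the order \<open>lt\<close> and exchanging \<open>a\<close> and \<open>b\<close>.\<close>

definition grid_op :: "nat \<Rightarrow> 'j set \<Rightarrow> ('j \<Rightarrow> 'j \<Rightarrow> bool) \<Rightarrow> ('j \<Rightarrow> nat) \<Rightarrow> ('j \<Rightarrow> nat) \<Rightarrow> nat set linop"
    where
  "grid_op M J lt a b = (\<Sum>j\<in>J. wt_op M (grid_wt J lt a b j) * hop (a j) (b j))"

lemma sum_fun_apply: "(\<Sum>x\<in>X. f x) y = (\<Sum>x\<in>X. f x y)"
  by (induction X rule: infinite_finite_induct) auto

lemma eps_apply: "eps a b = of_bool (a = b)"
  by (auto simp: eps_def single_def)

lemma grid_wt_apply: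
  "grid_wt J lt a b j x = (\<Sum>j'\<in>{j' \<in> J. lt j' j}. of_bool (b j' = x) - of_bool (a j' = x))"
  by (simp add: grid_wt_def sum_fun_apply eps_apply)

lemma sum_commute:
  fixes y :: "'a::ring"
  assumes "\<And>x. x \<in> X \<Longrightarrow> f x * y = y * f x"
  shows "(\<Sum>x\<in>X. f x) * y = y * (\<Sum>x\<in>X. f x)"
  using assms by (simp add: sum_distrib_left sum_distrib_right)

lemma wt_op_grid_commute:
  assumes "\<And>j. j \<in> J \<Longrightarrow> a j \<in> {1..M} \<and> b j \<in> {1..M} \<and> \<alpha> (a j) = \<alpha> (b j)"
  shows "grid_op M J lt a b * wt_op M \<alpha> = wt_op M \<alpha> * grid_op M J lt a b"
  unfolding grid_op_def
  by (rule sum_commute) (metis assms mult.assoc wt_op_commute wt_op_hop_commute)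

lemma hop_grid_commute:
  assumes cd: "c \<in> {1..M}" "d \<in> {1..M}"
    and ne: "\<And>j. j \<in> J \<Longrightarrow> a j \<notin> {c, d} \<and> b j \<notin> {c, d}"
  shows "grid_op M J lt a b * hop c d = hop c d * grid_op M J lt a b"
  unfolding grid_op_def
proof (rule sum_commute)
  fix j assume j: "j \<in> J"
  have "grid_wt J lt a b j c = 0" "grid_wt J lt a b j d = 0"
    using ne by (auto simp: grid_wt_apply intro!: sum.neutral)
  then have "wt_op M (grid_wt J lt a b j) * hop c d = hop c d * wt_op M (grid_wt J lt a b j)"
    using cd by (simp add: wt_op_hop_commute)
  moreover have "hop (a j) (b j) * hop c d = hop c d * hop (a j) (b j)"
    using ne[OF j] by (intro hop_commute) auto
  ultimately show "wt_op M (grid_wt J lt a b j) * hop (a j) (b j) * hop c d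
      = hop c d * (wt_op M (grid_wt J lt a b j) * hop (a j) (b j))"
    by (metis mult.assoc)
qed

text \<open>The two shapes of the coproduct: with \<open><\<close> the new position carries the
  weights of all older ones, with \<open>>\<close> its own weight multiplies all older terms. This
  is how \<open>E\<close> and \<open>F\<close> acquire their different twists.\<close>

lemma grid_op_Suc:
  fixes a b :: "nat \<Rightarrow> nat"
  shows "grid_op M {..<Suc n} (<) a b = grid_op M {..<n} (<) a b
      + wt_op M (\<Sum>j<n. eps (b j) - eps (a j)) * hop (a n) (b n)"
    and "grid_op M {..<Suc n} (>) a b
      = wt_op M (eps (b n) - eps (a n)) * grid_op M {..<n} (>) a b + hop (a n) (b n)"
proof -
  have "grid_wt {..<Suc n} (<) a b j = grid_wt {..<n} (<) a b j" if "j < n" for j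
    unfolding grid_wt_def using that by (intro sum.cong) auto
  moreover have "grid_wt {..<Suc n} (<) a b n = (\<Sum>j<n. eps (b j) - eps (a j))"
    unfolding grid_wt_def by (intro sum.cong) auto
  ultimately show "grid_op M {..<Suc n} (<) a b = grid_op M {..<n} (<) a b
      + wt_op M (\<Sum>j<n. eps (b j) - eps (a j)) * hop (a n) (b n)"
    by (simp add: grid_op_def lessThan_Suc add.commute)
  have "grid_wt {..<Suc n} (>) a b j = eps (b n) - eps (a n) + grid_wt {..<n} (>) a b j" if "j < n"
      for j
  proof -
    have "{j' \<in> {..<Suc n}. j' > j} = insert n {j' \<in> {..<n}. j' > j}" using that by auto
    then show ?thesis by (simp add: grid_wt_def)
  qed
  moreover have "grid_wt {..<Suc n} (>) a b n = 0"
    unfolding grid_wt_def by (intro sum.neutral) auto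
  ultimately show "grid_op M {..<Suc n} (>) a b
      = wt_op M (eps (b n) - eps (a n)) * grid_op M {..<n} (>) a b + hop (a n) (b n)"
    by (simp add: grid_op_def lessThan_Suc add.commute wt_op_add sum_distrib_left mult.assoc)
qed

lemma uq_rep_trivial: "uq_rep N (\<lambda>_. 0) (\<lambda>_. 0) (\<lambda>_. 1) (\<lambda>_. 1)"
  by unfold_locales (auto simp: qcomm_def serre_def)

text \<open>The older columns commute with column \<open>n\<close>, as
  \<open>uq_rep_coproduct\<close> demands: the sites are disjoint, hops are even in the fermions,
  and the weights of one side vanish on the sites of the other. The induction starts from the
  trivial representation on no columns.\<close>

lemma grid_rep:
  fixes n :: nat
  assumes ix: "\<And>i j. i \<in> {1..N} \<Longrightarrow> j < n \<Longrightarrow> ix i j \<in> {1..M}"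
    and inj: "\<And>i j i' j'. i \<in> {1..N} \<Longrightarrow> j < n \<Longrightarrow> i' \<in> {1..N} \<Longrightarrow> j' < n \<Longrightarrow>
      ix i j = ix i' j' \<Longrightarrow> i = i' \<and> j = j'"
  shows "uq_rep N (\<lambda>i. grid_op M {..<n} (<) (ix i) (ix (i + 1)))
    (\<lambda>i. grid_op M {..<n} (>) (ix (i + 1)) (ix i))
    (\<lambda>i. wt_op M (\<Sum>j<n. eps (ix i j))) (\<lambda>i. wt_op M (- (\<Sum>j<n. eps (ix i j))))"
  using assms
proof (induction n)
  case 0
  show ?case using uq_rep_trivial[of N]
    by (simp only: grid_op_def lessThan_0 sum.empty minus_zero wt_op_zero)
next
  case (Suc n)
  have IH: "uq_rep N (\<lambda>i. grid_op M {..<n} (<) (ix i) (ix (i + 1)))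
    (\<lambda>i. grid_op M {..<n} (>) (ix (i + 1)) (ix i))
    (\<lambda>i. wt_op M (\<Sum>j<n. eps (ix i j))) (\<lambda>i. wt_op M (- (\<Sum>j<n. eps (ix i j))))"
        (is "uq_rep N ?E ?F ?K ?L")
    by (rule Suc.IH) (use Suc.prems less_SucI in blast)+
  have rep': "uq_rep N (\<lambda>k. hop (ix k n) (ix (k + 1) n)) (\<lambda>k. hop (ix (k + 1) n) (ix k n))
    (\<lambda>k. wt_op M (eps (ix k n))) (\<lambda>k. wt_op M (- eps (ix k n)))" (is "uq_rep N ?E' ?F' ?K' ?L'")
  proof (rule fermion_rep)
    show "ix k n \<in> {1..M}" if "k \<in> {1..N}" for k by (rule Suc.prems(1)[OF that lessI])
    show "inj_on (\<lambda>k. ix k n) {1..N}"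
      by (rule inj_onI) (blast dest: Suc.prems(2)[OF _ lessI _ lessI])
  qed
  have ixn: "ix i n \<in> {1..M}" if "i \<in> {1..N}" for i using Suc.prems(1) that by simp
  have ixj: "ix i j \<in> {1..M}" if "i \<in> {1..N}" "j < n" for i j using Suc.prems(1) that by simp
  have ne: "ix i j \<noteq> ix i' n" if "i \<in> {1..N}" "i' \<in> {1..N}" "j < n" for i i' j
    using Suc.prems(2)[of i j i' n] that by auto
  have zero: "(\<Sum>j<n. eps (ix i j)) (ix i' n) = 0" if "i \<in> {1..N}" "i' \<in> {1..N}" for i i'
    using ne that by (auto simp: sum_fun_apply eps_apply intro!: sum.neutral)
  have gE: "grid_op M {..<n} lt (ix i) (ix i') * T = T * grid_op M {..<n} lt (ix i) (ix i')"
    if "i \<in> {1..N}" "i' \<in> {1..N}"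
      and T: "T \<in> ?E' ` {1..<N} \<union> ?F' ` {1..<N} \<union> ?K' ` {1..N} \<union> ?L' ` {1..N}" for i i' lt T
  proof -
    consider k where "k \<in> {1..<N}" "T = ?E' k" | k where "k \<in> {1..<N}" "T = ?F' k"
      | k where "k \<in> {1..N}" "T = ?K' k" | k where "k \<in> {1..N}" "T = ?L' k"
      using T unfolding Un_iff image_iff by blast
    then show ?thesis
    proof cases
      case 1
      then show ?thesis using that(1,2) ixn[of k] ixn[of "k + 1"] ne[of _ k] ne[of _ "k + 1"]
        by (simp only:, intro hop_grid_commute) force+
    next
      case 2
      then show ?thesis using that(1,2) ixn[of k] ixn[of "k + 1"] ne[of _ k] ne[of _ "k + 1"]
        by (simp only:, intro hop_grid_commute) force+
    next
      case 3
      then show ?thesis using that(1,2) ne[of _ k] ixj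
        by (simp only:, intro wt_op_grid_commute) (force simp: eps_apply)
    next
      case 4
      then show ?thesis using that(1,2) ne[of _ k] ixj
        by (simp only:, intro wt_op_grid_commute) (force simp: eps_apply)
    qed
  qed
  have gK: "wt_op M \<alpha> * T = T * wt_op M \<alpha>"
    if \<alpha>: "\<And>i. i \<in> {1..N} \<Longrightarrow> \<alpha> (ix i n) = 0" and T: "T \<in> ?E' ` {1..<N} \<union> ?F' ` {1..<N} \<union> ?K' `
        {1..N} \<union> ?L' ` {1..N}" for \<alpha> T
  proof -
    consider k where "k \<in> {1..<N}" "T = ?E' k" | k where "k \<in> {1..<N}" "T = ?F' k" | \<beta> where "T =
        wt_op M \<beta>"
      using T unfolding Un_iff image_iff by blast
    then show ?thesis
    proof cases
      case 1
      then show ?thesis using \<alpha>[of k] \<alpha>[of "k + 1"] ixn[of k] ixn[of "k + 1"]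
        by (simp only:, intro wt_op_hop_commute) auto
    next
      case 2
      then show ?thesis using \<alpha>[of k] \<alpha>[of "k + 1"] ixn[of k] ixn[of "k + 1"]
        by (simp only:, intro wt_op_hop_commute) auto
    next
      case 3
      then show ?thesis by (simp add: wt_op_commute)
    qed
  qed
  have "uq_rep N (\<lambda>i. ?E i + ?L i * ?K (i + 1) * ?E' i) (\<lambda>i. ?F i * (?K' i * ?L' (i + 1)) + ?F' i)
    (\<lambda>i. ?K i * ?K' i) (\<lambda>i. ?L i * ?L' i)"
  proof (rule uq_rep_coproduct[OF IH rep'])
    fix S T
    assume S: "S \<in> ?E ` {1..<N} \<union> ?F ` {1..<N} \<union> ?K ` {1..N} \<union> ?L ` {1..N}"
      and T: "T \<in> ?E' ` {1..<N} \<union> ?F' ` {1..<N} \<union> ?K' ` {1..N} \<union> ?L' ` {1..N}"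
    consider k where "k \<in> {1..<N}" "S = ?E k" | k where "k \<in> {1..<N}" "S = ?F k"
      | k where "k \<in> {1..N}" "S = ?K k" | k where "k \<in> {1..N}" "S = ?L k"
      using S unfolding Un_iff image_iff by blast
    then show "S * T = T * S"
    proof cases
      case 1
      show ?thesis unfolding 1(2) by (rule gE[OF _ _ T]) (use 1(1) in auto)
    next
      case 2
      show ?thesis unfolding 2(2) by (rule gE[OF _ _ T]) (use 2(1) in auto)
    next
      case 3
      show ?thesis unfolding 3(2) by (rule gK[OF _ T]) (rule zero[OF 3(1)])
    next
      case 4
      show ?thesis unfolding 4(2) by (rule gK[OF _ T]) (simp add: zero[OF 4(1)])
    qed
  qed
  moreover have "?L i * ?K (i + 1) = wt_op M (\<Sum>j<n. eps (ix (i + 1) j) - eps (ix i j))" for i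
    by (simp add: sum_subtractf flip: wt_op_add)
  \<comment> \<open>The coproduct puts the twist behind \<open>?F i\<close>, whereas
    \<open>grid_op\<close> has it in front; it involves the new column only and so commutes.\<close>
  moreover have "?F i * (?K' i * ?L' (i + 1)) = wt_op M (eps (ix i n) - eps (ix (i + 1) n)) * ?F i"
    if i: "i \<in> {1..<N}" for i
  proof -
    have "?F i * ?K' i = ?K' i * ?F i" "?F i * ?L' (i + 1) = ?L' (i + 1) * ?F i"
      by (rule gE; use i in force)+
    then have "?F i * (?K' i * ?L' (i + 1)) = ?K' i * ?L' (i + 1) * ?F i"
      by (metis mult.assoc)
    then show ?thesis by (simp flip: wt_op_add)
  qed
  moreover have "?K i * ?K' i = wt_op M (\<Sum>j<Suc n. eps (ix i j))"
    "?L i * ?L' i = wt_op M (- (\<Sum>j<Suc n. eps (ix i j)))" for i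
    by (simp_all add: add.commute flip: wt_op_add)
  ultimately show ?case
    \<comment> \<open>The form of \<open>?F\<close> just derived holds for \<open>i\<close> in
      \<open>{1..<N}\<close> only; with the locale unfolded these bounds are at hand wherever
      \<open>?F i\<close> occurs.\<close>
    unfolding uq_rep_def by (simp add: grid_op_Suc cong: if_cong)
qed


section \<open>Commutation of operators along rows with operators along columns\<close>

lemma wt_hop_mult:
  assumes "a \<in> {1..M}" "b \<in> {1..M}"
  shows "(wt_op M \<alpha> * hop a b) * (wt_op M \<beta> * hop c d)
    = scal (q_var powi (\<beta> b - \<beta> a)) * (wt_op M (\<alpha> + \<beta>) * (hop a b * hop c d))"
proof -
  have "hop a b * wt_op M \<beta> = scal (q_var powi (\<beta> b - \<beta> a)) * (wt_op M \<beta> * hop a b)"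
    using qcomm_sym[of "\<beta> a - \<beta> b" "wt_op M \<beta>" "hop a b"] wt_op_hop[OF assms, of \<beta>]
    by (simp add: qcomm_def)
  then show ?thesis
    by (metis (no_types, lifting) mult.assoc scal_left_commute wt_op_add)
qed

text \<open>After the hop, site \<open>a\<close> is occupied and site \<open>b\<close> is empty, so
  the weight operator reads off \<open>q\<close> to the power \<open>- 1\<close>.\<close>

lemma wt_op_absorb:
  assumes "a \<in> {1..M}" "b \<in> {1..M}" "a \<noteq> b"
  shows "wt_op M (eps b - eps a) * hop a b = scal (inverse q_var) * hop a b"
proof -
  have "wt_op M (eps b - eps a) = wt_op M (- eps a) * wt_op M (eps b)"
    by (simp flip: wt_op_add)
  then show ?thesis
    using assms
    by (intro linop_eqI) (simp add: apply_wt_op_eps apply_scal scale_def hop_def del: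
        atLeastAtMost_iff)
qed

text \<open>A term of one operator and a term of the other commute by themselves unless they meet in
  exactly one corner \<open>(r\<^sub>1, c\<^sub>0)\<close> or \<open>(r\<^sub>0, c\<^sub>1)\<close>; these two contributions cancel.\<close>

lemma grid_op_commute:
  assumes ix: "\<And>p j. p \<in> I \<Longrightarrow> j \<in> J \<Longrightarrow> ix p j \<in> {1..M}"
    and inj: "\<And>p j p' j'. p \<in> I \<Longrightarrow> j \<in> J \<Longrightarrow> p' \<in> I \<Longrightarrow> j' \<in> J \<Longrightarrow>
      ix p j = ix p' j' \<longleftrightarrow> p = p' \<and> j = j'"
    and fin: "finite I" "finite J"
    and r: "r0 \<in> I" "r1 \<in> I" "r0 \<noteq> r1" and c: "c0 \<in> J" "c1 \<in> J" "c0 \<noteq> c1"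
    and lt_c1: "{j \<in> J. lt j c1} = insert c0 {j \<in> J. lt j c0}" and irr: "\<not> lt c0 c0" "\<not> lt c1 c1"
    and adj: "\<And>j. j \<in> J - {c0, c1} \<Longrightarrow> lt c0 j \<longleftrightarrow> lt c1 j"
    and lt_r0: "{p \<in> I. lt' p r0} = insert r1 {p \<in> I. lt' p r1}" and irr': "\<not> lt' r0 r0" "\<not> lt' r1
        r1"
    and adj': "\<And>p. p \<in> I - {r0, r1} \<Longrightarrow> lt' r0 p \<longleftrightarrow> lt' r1 p"
  shows "grid_op M J lt (ix r0) (ix r1) * grid_op M I lt' (\<lambda>p. ix p c0) (\<lambda>p. ix p c1)
    = grid_op M I lt' (\<lambda>p. ix p c0) (\<lambda>p. ix p c1) * grid_op M J lt (ix r0) (ix r1)"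
proof -
  define l where "l = grid_wt J lt (ix r0) (ix r1)"
  define u where "u = grid_wt I lt' (\<lambda>p. ix p c0) (\<lambda>p. ix p c1)"
  define X where "X j = wt_op M (l j) * hop (ix r0 j) (ix r1 j)" for j
  define Y where "Y p = wt_op M (u p) * hop (ix p c0) (ix p c1)" for p
  \<comment> \<open>The hypotheses make \<open>c0\<close> the direct predecessor of
    \<open>c1\<close> for \<open>lt\<close>, and \<open>r1\<close> the direct predecessor of
    \<open>r0\<close> for \<open>lt'\<close>: the two orders cross the block in opposite
    senses.\<close>
  have lt1: "lt c0 c1" "\<not> lt c1 c0" "lt' r1 r0" "\<not> lt' r0 r1"
    using lt_c1 irr lt_r0 irr' r c by blast+
  \<comment> \<open>On grid sites the weights of a family see only the two lines that its hops
    connect: \<open>r0\<close>, \<open>r1\<close> for \<open>l\<close>, and \<open>c0\<close>,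
    \<open>c1\<close> for \<open>u\<close>.\<close>
  have lval: "l j (ix p j') = (if lt j' j then of_bool (p = r1) - of_bool (p = r0) else 0)"
    if "p \<in> I" "j' \<in> J" for j p j'
  proof -
    have "l j (ix p j') = (\<Sum>x\<in>{x \<in> J. lt x j}. if x = j' then of_bool (p = r1) - of_bool (p = r0)
        else 0)"
      unfolding l_def grid_wt_apply
      by (rule sum.cong) (use that r in \<open>auto simp: inj\<close>)
    then show ?thesis using that fin by simp
  qed
  have uval: "u p (ix p' j) = (if lt' p' p then of_bool (j = c1) - of_bool (j = c0) else 0)"
    if "p' \<in> I" "j \<in> J" for j p p'
  proof -
    have "u p (ix p' j) = (\<Sum>x\<in>{x \<in> I. lt' x p}. if x = p' then of_bool (j = c1) - of_bool (j = c0)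
        else 0)"
      unfolding u_def grid_wt_apply
      by (rule sum.cong) (use that c in \<open>auto simp: inj\<close>)
    then show ?thesis using that fin by simp
  qed
  have XY: "X j * Y p = scal (q_var powi (u p (ix r1 j) - u p (ix r0 j)))
      * (wt_op M (l j + u p) * (hop (ix r0 j) (ix r1 j) * hop (ix p c0) (ix p c1)))"
    and YX: "Y p * X j = scal (q_var powi (l j (ix p c1) - l j (ix p c0)))
      * (wt_op M (l j + u p) * (hop (ix p c0) (ix p c1) * hop (ix r0 j) (ix r1 j)))"
    if "j \<in> J" "p \<in> I" for j p
  proof -
    show "X j * Y p = scal (q_var powi (u p (ix r1 j) - u p (ix r0 j)))
        * (wt_op M (l j + u p) * (hop (ix r0 j) (ix r1 j) * hop (ix p c0) (ix p c1)))"
      unfolding X_def Y_def by (rule wt_hop_mult) (use that r c ix in blast)+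
    show "Y p * X j = scal (q_var powi (l j (ix p c1) - l j (ix p c0)))
        * (wt_op M (l j + u p) * (hop (ix p c0) (ix p c1) * hop (ix r0 j) (ix r1 j)))"
      unfolding X_def Y_def add.commute[of "l j"] by (rule wt_hop_mult) (use that r c ix in blast)+
  qed
  have zero: "X j * Y p - Y p * X j = 0"
    if jp: "j \<in> J" "p \<in> I" "(j, p) \<noteq> (c0, r1)" "(j, p) \<noteq> (c1, r0)" for j p
  proof -
    have ne: "ix r0 c0 \<noteq> ix r1 c0" "ix r0 c0 \<noteq> ix r0 c1" "ix r1 c1 \<noteq> ix r0 c1" "ix r1 c1 \<noteq> ix r1 c0"
      using r c by (auto simp: inj)
    \<comment> \<open>In the first two cases both hops create at \<open>(r0, c0)\<close> or both
      annihilate at \<open>(r1, c1)\<close>, so both products are zero.\<close>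
    consider "j = c0" "p = r0" | "j = c1" "p = r1" | "j \<in> J - {c0, c1} \<or> p \<in> I - {r0, r1}"
      using jp by auto
    then show ?thesis
    proof cases
      case 1
      then show ?thesis using jp ne by (simp add: XY YX hop_mult_zero)
    next
      case 2
      then show ?thesis using jp ne by (simp add: XY YX hop_mult_zero)
    next
      case 3
      \<comment> \<open>A line outside the pair lies on the same side of both members of the pair,
        so no power of \<open>q\<close> arises; and off the block the two hops share no
        site.\<close>
      have "u p (ix r1 j) - u p (ix r0 j) = 0" "l j (ix p c1) - l j (ix p c0) = 0"
        using 3 jp r c lt1 irr irr' adj[of j] adj'[of p] by (auto simp: lval uval)
      moreover have "hop (ix r0 j) (ix r1 j) * hop (ix p c0) (ix p c1)
          = hop (ix p c0) (ix p c1) * hop (ix r0 j) (ix r1 j)"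
        using 3 jp r c by (intro hop_commute) (auto simp: inj)
      ultimately show ?thesis using jp by (simp add: XY YX)
    qed
  qed
  have corners: "(X c0 * Y r1 - Y r1 * X c0) + (X c1 * Y r0 - Y r0 * X c1) = 0"
  proof -
    let ?a = "ix r0 c0" and ?b = "ix r1 c1"
    have "X c0 * Y r1 - Y r1 * X c0 = wt_op M (l c0 + u r1)
        * (hop ?a (ix r1 c0) * hop (ix r1 c0) ?b - hop (ix r1 c0) ?b * hop ?a (ix r1 c0))"
      using r c lt1 irr irr' by (simp add: XY YX lval uval scal_simps right_diff_distrib)
    then have 1: "X c0 * Y r1 - Y r1 * X c0 = wt_op M (l c0 + u r1) * hop ?a ?b"
      using r c by (simp add: hop_commutator inj)
    \<comment> \<open>At this corner \<open>lt c0 c1\<close> and \<open>lt' r1 r0\<close> give one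
      and the same factor \<open>q\<close> for both orders of the product; the other corner gave
      none.\<close>
    have "X c1 * Y r0 - Y r0 * X c1 = scal q_var * (wt_op M (l c1 + u r0)
        * (hop (ix r0 c1) ?b * hop ?a (ix r0 c1) - hop ?a (ix r0 c1) * hop (ix r0 c1) ?b))"
      using r c lt1 irr irr' by (simp add: XY YX lval uval right_diff_distrib)
    also have "\<dots> = scal q_var * (wt_op M (l c1 + u r0) * (- hop ?a ?b))"
      using r c by (simp add: hop_commutator inj)
    \<comment> \<open>The site \<open>ix r1 c0\<close> drops out of the sum of the two extra
      weights. What is left acts on \<open>hop ?a ?b\<close> as \<open>1/q\<close> and uses up the
      factor \<open>q\<close>.\<close>
    also have "l c1 + u r0 = (l c0 + u r1) + (eps ?b - eps ?a)"
    proof -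
      have "l c1 = (eps (ix r1 c0) - eps ?a) + l c0"
        unfolding l_def grid_wt_def lt_c1 using irr fin by simp
      moreover have "u r0 = (eps ?b - eps (ix r1 c0)) + u r1"
        unfolding u_def grid_wt_def lt_r0 using irr' fin by simp
      ultimately show ?thesis by (simp only:) (simp add: algebra_simps)
    qed
    also have "wt_op M (l c0 + u r1 + (eps ?b - eps ?a)) * (- hop ?a ?b)
        = - (wt_op M (l c0 + u r1) * (wt_op M (eps ?b - eps ?a) * hop ?a ?b))"
      by (simp only: wt_op_add mult.assoc mult_minus_right)
    also have "\<dots> = - (wt_op M (l c0 + u r1) * (scal (inverse q_var) * hop ?a ?b))"
      using r c ix[of r0 c0] ix[of r1 c1] by (subst wt_op_absorb) (auto simp: inj)
    also have "scal q_var * \<dots> = - (scal (q_var * inverse q_var) *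
        (wt_op M (l c0 + u r1) * hop ?a ?b))"
      by (simp only: scal_left_commute[of "wt_op M (l c0 + u r1)"] mult_minus_right scal_simps
          mult.assoc)
    finally have "X c1 * Y r0 - Y r0 * X c1 = - (wt_op M (l c0 + u r1) * hop ?a ?b)"
      by (simp add: scal_simps)
    then show ?thesis using 1 by simp
  qed
  have "(\<Sum>j\<in>J. X j) * (\<Sum>p\<in>I. Y p) - (\<Sum>p\<in>I. Y p) * (\<Sum>j\<in>J. X j)
      = (\<Sum>j\<in>J. \<Sum>p\<in>I. X j * Y p - Y p * X j)"
    by (simp add: sum_product sum_subtractf sum.swap[of _ I J])
  also have "\<dots> = (\<Sum>z\<in>J \<times> I. X (fst z) * Y (snd z) - Y (snd z) * X (fst z))"
    by (simp add: sum.cartesian_product case_prod_unfold)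
  also have "\<dots> = (\<Sum>z\<in>{(c0, r1), (c1, r0)}. X (fst z) * Y (snd z) - Y (snd z) * X (fst z))"
    by (rule sum.mono_neutral_right) (use fin r c in \<open>auto simp del: right_minus_eq intro!: zero\<close>)
  also have "\<dots> = 0" using corners c by simp
  finally show ?thesis by (simp add: grid_op_def X_def Y_def l_def u_def)
qed

section \<open>Algebras and their modules\<close>

lemma Cq_simps [simp]:
  "carrier Cq = UNIV" "x \<otimes>\<^bsub>Cq\<^esub> y = x * y" "x \<oplus>\<^bsub>Cq\<^esub> y = x + y" "\<one>\<^bsub>Cq\<^esub> = 1" "\<zero>\<^bsub>Cq\<^esub> = 0"
  by (simp_all add: Cq_def)

lemma cring_Cq: "cring Cq"
proof (rule cringI)
  show "abelian_group Cq"
    by (rule abelian_groupI) (auto simp: algebra_simps intro: exI[of _ "- x" for x])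
  show "comm_monoid Cq"
    by (rule comm_monoidI) (auto simp: algebra_simps)
qed (auto simp: algebra_simps)

lemma coord_space_simps [simp]:
  "v \<in> carrier (coord_space B) \<longleftrightarrow> (\<forall>x. x \<notin> B \<longrightarrow> v x = 0)"
  "v \<oplus>\<^bsub>coord_space B\<^esub> w = v + w" "\<zero>\<^bsub>coord_space B\<^esub> = 0" "r \<odot>\<^bsub>coord_space B\<^esub> v = scale r v"
  by (simp_all add: coord_space_def)

lemma module_coord_space: "module Cq (coord_space B)"
proof (rule moduleI[OF cring_Cq])
  show "abelian_group (coord_space B)"
  proof (rule abelian_groupI)
    fix v assume "v \<in> carrier (coord_space B)"
    then show "\<exists>w\<in>carrier (coord_space B). w \<oplus>\<^bsub>coord_space B\<^esub> v = \<zero>\<^bsub>coord_space B\<^esub>"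
      by (intro bexI[of _ "- v"]) (auto simp del: zero_fun_apply simp: fun_eq_iff)
  qed (auto simp: fun_eq_iff)
qed (auto simp: scale_def algebra_simps fun_eq_iff)

lemma single_apply: "single x y = of_bool (y = x)"
  by (simp add: single_def)

text \<open>Linear induction, one basis vector at a time. It is stated for bare functions because it
  serves algebra elements and vectors alike.\<close>

lemma finite_support_induct [consumes 2, case_names zero add]:
  fixes f :: "'a \<Rightarrow> ratfun"
  assumes fin: "finite {x. f x \<noteq> 0}" and sub: "{x. f x \<noteq> 0} \<subseteq> S" and zero: "P 0"
    and add: "\<And>r x g. x \<in> S \<Longrightarrow> finite {x. g x \<noteq> 0} \<Longrightarrow> {x. g x \<noteq> 0} \<subseteq> S \<Longrightarrow> P g \<Longrightarrow>
      P (scale r (single x) + g)"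
  shows "P f"
proof -
  have "P f" if "finite A" "A \<subseteq> S" "{x. f x \<noteq> 0} \<subseteq> A" for A f
    using that
  proof (induction A arbitrary: f)
    case empty
    then have "f = 0" by (auto simp: fun_eq_iff)
    then show ?case using zero by (simp only:)
  next
    case (insert a A)
    let ?g = "f(a := 0)"
    have g: "{x. ?g x \<noteq> 0} \<subseteq> A" using insert.prems by auto
    then have "P ?g" using insert by blast
    moreover have "finite {x. ?g x \<noteq> 0}" "{x. ?g x \<noteq> 0} \<subseteq> S"
      using finite_subset[OF g] insert.hyps g insert.prems(1) by blast+
    ultimately have "P (scale (f a) (single a) + ?g)" using insert.prems by (intro add) auto
    also have "scale (f a) (single a) + ?g = f"
      by (auto simp: fun_eq_iff scale_def single_apply)
    finally show ?case .
  qed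
  then show ?thesis using fin sub by blast
qed

subsection \<open>Monoid algebras\<close>

lemma monoid_algebra_simps:
  "f \<in> carrier (monoid_algebra M) \<longleftrightarrow> finite {x. f x \<noteq> 0} \<and> {x. f x \<noteq> 0} \<subseteq> carrier M"
  "f \<oplus>\<^bsub>monoid_algebra M\<^esub> g = f + g" "\<zero>\<^bsub>monoid_algebra M\<^esub> = 0"
  "\<one>\<^bsub>monoid_algebra M\<^esub> = single \<one>\<^bsub>M\<^esub>" "r \<odot>\<^bsub>monoid_algebra M\<^esub> f = scale r f"
  by (simp_all add: monoid_algebra_def)

text \<open>The definition sums over the actual supports, which change with the factors; fixed
  finite supersets give all terms of a bilinearity identity the same index sets.\<close>

lemma monoid_algebra_mult:
  assumes fin: "finite A" "finite B" and sub: "{x. f x \<noteq> 0} \<subseteq> A" "{y. g y \<noteq> 0} \<subseteq> B"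
  shows "(f \<otimes>\<^bsub>monoid_algebra M\<^esub> g) z = (\<Sum>x\<in>A. \<Sum>y\<in>B. f x * g y * of_bool (x \<otimes>\<^bsub>M\<^esub> y = z))"
proof -
  have "(f \<otimes>\<^bsub>monoid_algebra M\<^esub> g) z
      = (\<Sum>p\<in>{(x, y). f x \<noteq> 0 \<and> g y \<noteq> 0 \<and> x \<otimes>\<^bsub>M\<^esub> y = z}. f (fst p) * g (snd p) * of_bool
          (fst p \<otimes>\<^bsub>M\<^esub> snd p = z))"
    by (auto simp: monoid_algebra_def case_prod_unfold intro!: sum.cong)
  also have "\<dots> = (\<Sum>p\<in>A \<times> B. f (fst p) * g (snd p) * of_bool (fst p \<otimes>\<^bsub>M\<^esub> snd p = z))"
    by (rule sum.mono_neutral_left) (use fin sub in auto)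
  finally show ?thesis by (simp add: sum.cartesian_product case_prod_unfold)
qed

lemma monoid_algebra_mult_support:
  "{z. (f \<otimes>\<^bsub>monoid_algebra M\<^esub> g) z \<noteq> 0} \<subseteq> (\<lambda>(x, y). x \<otimes>\<^bsub>M\<^esub> y) ` ({x. f x \<noteq> 0} \<times> {y. g y \<noteq> 0})"
proof
  fix z assume "z \<in> {z. (f \<otimes>\<^bsub>monoid_algebra M\<^esub> g) z \<noteq> 0}"
  then have "(\<Sum>(x, y)\<in>{(x, y). f x \<noteq> 0 \<and> g y \<noteq> 0 \<and> x \<otimes>\<^bsub>M\<^esub> y = z}. f x * g y) \<noteq> 0"
    by (simp add: monoid_algebra_def)
  then obtain p where "p \<in> {(x, y). f x \<noteq> 0 \<and> g y \<noteq> 0 \<and> x \<otimes>\<^bsub>M\<^esub> y = z}"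
    by (meson sum.not_neutral_contains_not_neutral)
  then have "f (fst p) \<noteq> 0 \<and> g (snd p) \<noteq> 0 \<and> fst p \<otimes>\<^bsub>M\<^esub> snd p = z"
    by (simp add: case_prod_unfold)
  then have "fst p \<in> {x. f x \<noteq> 0}" "snd p \<in> {y. g y \<noteq> 0}" "z = (\<lambda>(x, y). x \<otimes>\<^bsub>M\<^esub> y) p"
    by (auto simp only: case_prod_unfold mem_Collect_eq)
  then show "z \<in> (\<lambda>(x, y). x \<otimes>\<^bsub>M\<^esub> y) ` ({x. f x \<noteq> 0} \<times> {y. g y \<noteq> 0})"
    by (metis image_eqI mem_Times_iff)
qed

lemma monoid_algebra_mult_single:
  "single x \<otimes>\<^bsub>monoid_algebra M\<^esub> single y = single (x \<otimes>\<^bsub>M\<^esub> y)"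
proof
  fix z
  have "{x'. single x x' \<noteq> (0 :: ratfun)} \<subseteq> {x}" "{y'. single y y' \<noteq> (0 :: ratfun)} \<subseteq> {y}"
    by (auto simp: single_apply)
  then show "(single x \<otimes>\<^bsub>monoid_algebra M\<^esub> single y) z = single (x \<otimes>\<^bsub>M\<^esub> y) z"
    using monoid_algebra_mult[of "{x}" "{y}" "single x" "single y" M z]
    by (auto simp: single_apply)
qed

lemma monoid_algebra_closed:
  assumes f: "f \<in> carrier (monoid_algebra M)"
  shows "- f \<in> carrier (monoid_algebra M)" "scale r f \<in> carrier (monoid_algebra M)"
    "g \<in> carrier (monoid_algebra M) \<Longrightarrow> f + g \<in> carrier (monoid_algebra M)"
    "g \<in> carrier (monoid_algebra M) \<Longrightarrow> f - g \<in> carrier (monoid_algebra M)"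
proof -
  have *: "h \<in> carrier (monoid_algebra M)"
    if "{x. h x \<noteq> 0} \<subseteq> {x. f x \<noteq> 0} \<union> {x. g x \<noteq> 0}" "g \<in> carrier (monoid_algebra M)" for g h
    using f that finite_subset[OF that(1)] by (auto simp: monoid_algebra_simps)
  show "- f \<in> carrier (monoid_algebra M)" "scale r f \<in> carrier (monoid_algebra M)"
    by (rule *[OF _ f]; auto simp: scale_def)+
  show "f + g \<in> carrier (monoid_algebra M)" "f - g \<in> carrier (monoid_algebra M)"
    if "g \<in> carrier (monoid_algebra M)"
    by (rule *[OF _ that]; auto)+
qed

lemma single_closed: "x \<in> carrier M \<Longrightarrow> single x \<in> carrier (monoid_algebra M)"
  by (auto simp: monoid_algebra_simps single_apply)

lemma monoid_algebra_induct [consumes 1, case_names zero add]: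
  assumes "f \<in> carrier (monoid_algebra M)" and "P 0"
    and "\<And>r x g. x \<in> carrier M \<Longrightarrow> g \<in> carrier (monoid_algebra M) \<Longrightarrow> P g \<Longrightarrow>
      P (scale r (single x) + g)"
  shows "P f"
  using finite_support_induct[of f "carrier M" P] assms by (auto simp: monoid_algebra_simps)

lemma (in monoid) assoc_algebra_monoid_algebra: "assoc_algebra Cq (monoid_algebra G)"
proof -
  let ?A = "monoid_algebra G"
  have mult_closed: "f \<otimes>\<^bsub>?A\<^esub> g \<in> carrier ?A" if "f \<in> carrier ?A" "g \<in> carrier ?A" for f g
    unfolding monoid_algebra_simps
  proof
    have "(\<lambda>(x, y). x \<otimes> y) ` ({x. f x \<noteq> 0} \<times> {y. g y \<noteq> 0}) \<subseteq> carrier G"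
      using that by (auto simp: monoid_algebra_simps)
    then show "{z. (f \<otimes>\<^bsub>?A\<^esub> g) z \<noteq> 0} \<subseteq> carrier G"
      by (rule order.trans[OF monoid_algebra_mult_support])
    have "finite ((\<lambda>(x, y). x \<otimes> y) ` ({x. f x \<noteq> 0} \<times> {y. g y \<noteq> 0}))"
      using that by (auto simp: monoid_algebra_simps)
    then show "finite {z. (f \<otimes>\<^bsub>?A\<^esub> g) z \<noteq> 0}"
      by (rule finite_subset[OF monoid_algebra_mult_support])
  qed
  have l_distr: "(f + g) \<otimes>\<^bsub>?A\<^esub> h = f \<otimes>\<^bsub>?A\<^esub> h + g \<otimes>\<^bsub>?A\<^esub> h"
    and r_distr: "h \<otimes>\<^bsub>?A\<^esub> (f + g) = h \<otimes>\<^bsub>?A\<^esub> f + h \<otimes>\<^bsub>?A\<^esub> g"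
    if "f \<in> carrier ?A" "g \<in> carrier ?A" "h \<in> carrier ?A" for f g h
  proof -
    let ?B = "{x. f x \<noteq> 0} \<union> {x. g x \<noteq> 0}" and ?C = "{x. h x \<noteq> 0}"
    have fin: "finite ?B" "finite ?C" using that by (auto simp: monoid_algebra_simps)
    show "(f + g) \<otimes>\<^bsub>?A\<^esub> h = f \<otimes>\<^bsub>?A\<^esub> h + g \<otimes>\<^bsub>?A\<^esub> h"
      by (rule ext, unfold plus_fun_apply, subst (1 2 3) monoid_algebra_mult[OF fin])
        (auto simp: sum.distrib algebra_simps)
    show "h \<otimes>\<^bsub>?A\<^esub> (f + g) = h \<otimes>\<^bsub>?A\<^esub> f + h \<otimes>\<^bsub>?A\<^esub> g"
      by (rule ext, unfold plus_fun_apply, subst (1 2 3) monoid_algebra_mult[OF fin(2,1)])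
        (auto simp: sum.distrib algebra_simps)
  qed
  have scale_mult: "scale r f \<otimes>\<^bsub>?A\<^esub> g = scale r (f \<otimes>\<^bsub>?A\<^esub> g)" "f \<otimes>\<^bsub>?A\<^esub> scale r g = scale r
      (f \<otimes>\<^bsub>?A\<^esub> g)"
    if "f \<in> carrier ?A" "g \<in> carrier ?A" for r f g
  proof -
    let ?B = "{x. f x \<noteq> 0}" and ?C = "{x. g x \<noteq> 0}"
    have fin: "finite ?B" "finite ?C" using that by (auto simp: monoid_algebra_simps)
    show "scale r f \<otimes>\<^bsub>?A\<^esub> g = scale r (f \<otimes>\<^bsub>?A\<^esub> g)"
      by (rule ext, unfold scale_def, subst (1 2) monoid_algebra_mult[OF fin])
        (auto simp: sum_distrib_left algebra_simps)
    show "f \<otimes>\<^bsub>?A\<^esub> scale r g = scale r (f \<otimes>\<^bsub>?A\<^esub> g)"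
      by (rule ext, unfold scale_def, subst (1 2) monoid_algebra_mult[OF fin])
        (auto simp: sum_distrib_left algebra_simps)
  qed
  have zero_mult: "0 \<otimes>\<^bsub>?A\<^esub> g = 0" "f \<otimes>\<^bsub>?A\<^esub> 0 = 0" for f g
    by (auto simp: monoid_algebra_def fun_eq_iff)
  have assoc_single: "single x \<otimes>\<^bsub>?A\<^esub> single y \<otimes>\<^bsub>?A\<^esub> single z = single x \<otimes>\<^bsub>?A\<^esub>
      (single y \<otimes>\<^bsub>?A\<^esub> single z)"
    if "x \<in> carrier G" "y \<in> carrier G" "z \<in> carrier G" for x y z
    using that by (simp add: monoid_algebra_mult_single m_assoc)
  note closed = mult_closed monoid_algebra_closed single_closed
  \<comment> \<open>Linear induction in each argument reduces associativity to basis elements, where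
    it is that of the monoid.\<close>
  have assoc: "f \<otimes>\<^bsub>?A\<^esub> g \<otimes>\<^bsub>?A\<^esub> h = f \<otimes>\<^bsub>?A\<^esub> (g \<otimes>\<^bsub>?A\<^esub> h)"
    if f: "f \<in> carrier ?A" and g: "g \<in> carrier ?A" and h: "h \<in> carrier ?A" for f g h
    using f
  proof (induction rule: monoid_algebra_induct)
    case (add r x f')
    have *: "single x \<otimes>\<^bsub>?A\<^esub> g \<otimes>\<^bsub>?A\<^esub> h = single x \<otimes>\<^bsub>?A\<^esub> (g \<otimes>\<^bsub>?A\<^esub> h)"
      using g
    proof (induction rule: monoid_algebra_induct)
      case (add s y g')
      have "single x \<otimes>\<^bsub>?A\<^esub> single y \<otimes>\<^bsub>?A\<^esub> h = single x \<otimes>\<^bsub>?A\<^esub> (single y \<otimes>\<^bsub>?A\<^esub> h)"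
        using h
      proof (induction rule: monoid_algebra_induct)
        case (add t z h')
        then show ?case using \<open>x \<in> carrier G\<close> \<open>y \<in> carrier G\<close>
          by (simp add: l_distr r_distr scale_mult closed assoc_single del: plus_fun_apply)
      qed (simp add: zero_mult del: zero_fun_apply)
      then show ?case using add \<open>x \<in> carrier G\<close> h
        by (simp add: l_distr r_distr scale_mult closed del: plus_fun_apply)
    qed (simp add: zero_mult del: zero_fun_apply)
    then show ?case using add g h
      by (simp add: l_distr r_distr scale_mult closed del: plus_fun_apply)
  qed (simp add: zero_mult del: zero_fun_apply)
  have one_mult: "single \<one> \<otimes>\<^bsub>?A\<^esub> f = f" "f \<otimes>\<^bsub>?A\<^esub> single \<one> = f" if f: "f \<in> carrier ?A" for f
  proof -
    have "single \<one> \<otimes>\<^bsub>?A\<^esub> f = f \<and> f \<otimes>\<^bsub>?A\<^esub> single \<one> = f"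
      using f
    proof (induction rule: monoid_algebra_induct)
      case (add r x g)
      then show ?case
        by (simp add: l_distr r_distr scale_mult closed monoid_algebra_mult_single del:
            plus_fun_apply)
    qed (simp add: zero_mult del: zero_fun_apply)
    then show "single \<one> \<otimes>\<^bsub>?A\<^esub> f = f" "f \<otimes>\<^bsub>?A\<^esub> single \<one> = f" by auto
  qed
  have zero_closed: "0 \<in> carrier ?A" by (simp add: monoid_algebra_simps)
  note simps = monoid_algebra_simps(2-5)
  have group: "abelian_group ?A"
  proof (rule abelian_groupI)
    fix f assume "f \<in> carrier ?A"
    then show "\<exists>g\<in>carrier ?A. g \<oplus>\<^bsub>?A\<^esub> f = \<zero>\<^bsub>?A\<^esub>"
      unfolding simps by (intro bexI[of _ "- f"] closed(2)) auto
  qed (simp_all add: simps closed zero_closed add.assoc add.commute)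
  show ?thesis
  proof (intro assoc_algebra.intro assoc_algebra_axioms.intro)
    show "module Cq ?A"
      by (rule moduleI[OF cring_Cq group])
        (auto simp: simps closed scale_simps del: ext)
    show "ring ?A"
    proof (rule ringI[OF group])
      show "monoid ?A"
        by (rule monoidI) (auto simp: simps closed assoc one_mult)
    qed (auto simp: simps l_distr r_distr)
  qed (auto simp: simps scale_mult)
qed

subsection \<open>Linear extension of a function on a basis\<close>

definition lin :: "('a \<Rightarrow> 's linop) \<Rightarrow> ('a \<Rightarrow> ratfun) \<Rightarrow> 's linop" where
  "lin h f = (\<Sum>x\<in>{x. f x \<noteq> 0}. scal (f x) * h x)"

lemma lin_superset:
  "finite A \<Longrightarrow> {x. f x \<noteq> 0} \<subseteq> A \<Longrightarrow> lin h f = (\<Sum>x\<in>A. scal (f x) * h x)"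
  unfolding lin_def by (rule sum.mono_neutral_left) (auto simp: scal_simps)

lemma lin_single [simp]: "lin h (single x) = h x"
  using lin_superset[of "{x}" "single x" h] by (simp add: single_apply scal_simps)

lemma lin_zero [simp]: "lin h 0 = 0"
  by (simp add: lin_def)

lemma lin_add:
  assumes "finite {x. f x \<noteq> 0}" "finite {x. g x \<noteq> 0}"
  shows "lin h (f + g) = lin h f + lin h g" "lin h (f - g) = lin h f - lin h g"
proof -
  let ?A = "{x. f x \<noteq> 0} \<union> {x. g x \<noteq> 0}"
  have fin: "finite ?A" using assms by simp
  have "lin h f = (\<Sum>x\<in>?A. scal (f x) * h x)" "lin h g = (\<Sum>x\<in>?A. scal (g x) * h x)"
    "lin h (f + g) = (\<Sum>x\<in>?A. scal ((f + g) x) * h x)" "lin h (f - g) =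
        (\<Sum>x\<in>?A. scal ((f - g) x) * h x)"
    by (rule lin_superset[OF fin]; auto)+
  then show "lin h (f + g) = lin h f + lin h g" "lin h (f - g) = lin h f - lin h g"
    by (simp_all add: scal_simps distrib_right left_diff_distrib sum.distrib sum_subtractf)
qed

lemma lin_scale:
  assumes "finite {x. f x \<noteq> 0}"
  shows "lin h (scale r f) = scal r * lin h f"
proof -
  have "lin h (scale r f) = (\<Sum>x\<in>{x. f x \<noteq> 0}. scal (scale r f x) * h x)"
    by (rule lin_superset) (use assms in \<open>auto simp: scale_def\<close>)
  then show ?thesis by (simp add: lin_def scale_def scal_simps sum_distrib_left mult.assoc)
qed

text \<open>A representation by operators on the full function space. The conditions are confined to
  the carrier, because maps such as \<open>quot_map\<close> are meaningful only there.\<close>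

definition alg_map :: "(ratfun, 'a) module \<Rightarrow> ('a \<Rightarrow> 's linop) \<Rightarrow> bool" where
  "alg_map A \<phi> \<longleftrightarrow> \<phi> \<one>\<^bsub>A\<^esub> = 1 \<and>
    (\<forall>x\<in>carrier A. \<forall>y\<in>carrier A. \<phi> (x \<otimes>\<^bsub>A\<^esub> y) = \<phi> x * \<phi> y) \<and>
    (\<forall>x\<in>carrier A. \<forall>y\<in>carrier A. \<phi> (x \<oplus>\<^bsub>A\<^esub> y) = \<phi> x + \<phi> y) \<and>
    (\<forall>r. \<forall>x\<in>carrier A. \<phi> (r \<odot>\<^bsub>A\<^esub> x) = scal r * \<phi> x)"

text \<open>The universal property of the monoid algebra: multiplicativity on basis elements extends
  bilinearly, by linear induction in both arguments.\<close>

lemma (in monoid) alg_map_lin: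
  assumes one: "h \<one> = 1" and mult: "\<And>x y. x \<in> carrier G \<Longrightarrow> y \<in> carrier G \<Longrightarrow> h (x \<otimes> y) = h x * h y"
  shows "alg_map (monoid_algebra G) (lin h)"
proof -
  interpret A: assoc_algebra Cq "monoid_algebra G" by (rule assoc_algebra_monoid_algebra)
  let ?A = "monoid_algebra G"
  note simps = monoid_algebra_simps(2-5)
  have finD: "finite {x. f x \<noteq> 0}" if "f \<in> carrier ?A" for f
    using that by (simp add: monoid_algebra_simps)
  have lin_mult: "lin h (f \<otimes>\<^bsub>?A\<^esub> g) = lin h f * lin h g" if f: "f \<in> carrier ?A" and g: "g \<in> carrier
      ?A" for f g
    using f
  proof (induction rule: monoid_algebra_induct)
    case zero
    show ?case using A.l_null[OF g] by (simp only: simps lin_zero mult_zero_left)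
  next
    case (add r x f')
    have x: "single x \<in> carrier ?A" and f': "f' \<in> carrier ?A"
      using add(1,2) by (simp_all add: single_closed)
    have *: "lin h (single x \<otimes>\<^bsub>?A\<^esub> g) = h x * lin h g"
      using g
    proof (induction rule: monoid_algebra_induct)
      case zero
      show ?case using A.r_null[OF x] by (simp only: simps lin_zero mult_zero_right)
    next
      case (add s y g')
      have y: "single y \<in> carrier ?A" and g': "g' \<in> carrier ?A"
        using add(1,2) by (simp_all add: single_closed)
      have "single x \<otimes>\<^bsub>?A\<^esub> (scale s (single y) + g') = scale s (single (x \<otimes> y)) + single x \<otimes>\<^bsub>?A\<^esub> g'"
        using A.r_distr[OF A.smult_closed[of s, OF _ y] g' x] A.smult_mult_right[OF _ x y, of s]
        by (simp add: simps monoid_algebra_mult_single)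
      moreover have "finite {z. scale s (single (x \<otimes> y)) z \<noteq> 0}" "finite
          {z. scale s (single y) z \<noteq> 0}"
        "finite {z. (single x \<otimes>\<^bsub>?A\<^esub> g') z \<noteq> 0}" "finite {z. single (x \<otimes> y) z \<noteq> (0 :: ratfun)}"
        "finite {z. single y z \<noteq> (0 :: ratfun)}"
        "finite {z. g' z \<noteq> 0}"
        using x y g' finD by (auto simp: scale_def single_apply)
      ultimately show ?case using add.IH add.hyps \<open>x \<in> carrier G\<close>
        by (simp add: lin_add lin_scale mult distrib_left scal_left_commute del: plus_fun_apply)
    qed
    have "(scale r (single x) + f') \<otimes>\<^bsub>?A\<^esub> g = scale r (single x \<otimes>\<^bsub>?A\<^esub> g) + f' \<otimes>\<^bsub>?A\<^esub> g"
      using A.l_distr[OF A.smult_closed[of r, OF _ x] f' g] A.smult_mult_left[OF _ x g, of r]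
      by (simp add: simps)
    moreover have "finite {z. scale r (single x \<otimes>\<^bsub>?A\<^esub> g) z \<noteq> 0}" "finite
        {z. scale r (single x) z \<noteq> 0}"
      "finite {z. (single x \<otimes>\<^bsub>?A\<^esub> g) z \<noteq> 0}" "finite {z. single x z \<noteq> (0 :: ratfun)}"
      "finite {z. (f' \<otimes>\<^bsub>?A\<^esub> g) z \<noteq> 0}" "finite {z. f' z \<noteq> 0}"
      using finD[of "scale r (single x \<otimes>\<^bsub>?A\<^esub> g)"] finD[of "scale r (single x)"] finD[OF x]
          finD[OF f']
        finD[of "single x \<otimes>\<^bsub>?A\<^esub> g"] finD[of "f' \<otimes>\<^bsub>?A\<^esub> g"] x f' g
        A.smult_closed[of r "single x"] A.smult_closed[of r "single x \<otimes>\<^bsub>?A\<^esub> g"]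
      by (simp_all add: simps)
    ultimately show ?case using add.IH *
      by (simp add: lin_add lin_scale distrib_right mult.assoc del: plus_fun_apply)
  qed
  show ?thesis
    unfolding alg_map_def simps
    by (intro conjI ballI allI lin_mult lin_add lin_scale finD) (simp_all add: one)
qed

subsection \<open>Quotients\<close>

locale algebra_ideal = assoc_algebra K A + I: ideal I A
  for K :: "('k, 'l) ring_scheme" (structure) and A :: "('k, 'a) module" (structure) and I
begin

text \<open>In a unital algebra a scalar multiple of \<open>x\<close> is the product of a scalar
  multiple of 1 with \<open>x\<close>, so every ring ideal is a subspace.\<close>

lemma ideal_smult_closed:
  assumes "r \<in> carrier K" "x \<in> I"
  shows "r \<odot>\<^bsub>A\<^esub> x \<in> I"
proof -
  have x: "x \<in> carrier A" using assms(2) by (rule I.a_Hcarr)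
  have "r \<odot>\<^bsub>A\<^esub> x = (r \<odot>\<^bsub>A\<^esub> \<one>\<^bsub>A\<^esub>) \<otimes>\<^bsub>A\<^esub> x"
    using smult_mult_left[OF assms(1) one_closed x] x by simp
  then show ?thesis using assms by (simp add: I.I_l_closed smult_closed)
qed

text \<open>The union defining the scalar action runs over equal cosets: changing the representative
  by an element of the ideal changes its multiple by an element of the ideal.\<close>

lemma quot_smult:
  assumes r: "r \<in> carrier K" and x: "x \<in> carrier A"
  shows "r \<odot>\<^bsub>quot_algebra A I\<^esub> (I +>\<^bsub>A\<^esub> x) = I +>\<^bsub>A\<^esub> (r \<odot>\<^bsub>A\<^esub> x)"
proof -
  have "I +>\<^bsub>A\<^esub> (r \<odot>\<^bsub>A\<^esub> y) = I +>\<^bsub>A\<^esub> (r \<odot>\<^bsub>A\<^esub> x)" if y: "y \<in> I +>\<^bsub>A\<^esub> x" for y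
  proof -
    obtain i where i: "i \<in> I" "y = i \<oplus>\<^bsub>A\<^esub> x"
      using y by (auto simp: a_r_coset_def')
    then have "r \<odot>\<^bsub>A\<^esub> y = r \<odot>\<^bsub>A\<^esub> i \<oplus>\<^bsub>A\<^esub> r \<odot>\<^bsub>A\<^esub> x"
      using r x by (simp add: smult_r_distr I.a_Hcarr)
    then have "r \<odot>\<^bsub>A\<^esub> y \<in> I +>\<^bsub>A\<^esub> (r \<odot>\<^bsub>A\<^esub> x)"
      using ideal_smult_closed[OF r i(1)] by (auto simp: a_r_coset_def')
    then show ?thesis
      by (rule I.a_repr_independence'[symmetric]) (rule smult_closed[OF r x])
  qed
  moreover have "x \<in> I +>\<^bsub>A\<^esub> x" using x by (rule I.a_rcos_self)
  ultimately have "(\<Union>y\<in>I +>\<^bsub>A\<^esub> x. I +>\<^bsub>A\<^esub> (r \<odot>\<^bsub>A\<^esub> y)) = I +>\<^bsub>A\<^esub> (r \<odot>\<^bsub>A\<^esub> x)"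
    by (intro SUP_eq_const) blast+
  then show ?thesis by (simp only: quot_algebra_def module.simps)
qed

lemma quot_simps:
  "X \<in> carrier (quot_algebra A I) \<longleftrightarrow> (\<exists>x\<in>carrier A. X = I +>\<^bsub>A\<^esub> x)"
  "x \<in> carrier A \<Longrightarrow> y \<in> carrier A \<Longrightarrow>
    (I +>\<^bsub>A\<^esub> x) \<otimes>\<^bsub>quot_algebra A I\<^esub> (I +>\<^bsub>A\<^esub> y) = I +>\<^bsub>A\<^esub> (x \<otimes>\<^bsub>A\<^esub> y)"
  "x \<in> carrier A \<Longrightarrow> y \<in> carrier A \<Longrightarrow>
    (I +>\<^bsub>A\<^esub> x) \<oplus>\<^bsub>quot_algebra A I\<^esub> (I +>\<^bsub>A\<^esub> y) = I +>\<^bsub>A\<^esub> (x \<oplus>\<^bsub>A\<^esub> y)"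
  "\<one>\<^bsub>quot_algebra A I\<^esub> = I +>\<^bsub>A\<^esub> \<one>\<^bsub>A\<^esub>" "\<zero>\<^bsub>quot_algebra A I\<^esub> = I +>\<^bsub>A\<^esub> \<zero>\<^bsub>A\<^esub>"
  by (auto simp: quot_algebra_def FactRing_simps I.rcoset_mult_add I.a_rcos_sum I.a_rcos_const)

lemma quot_eqI:
  assumes "x \<in> carrier A" "y \<in> carrier A" "x \<ominus>\<^bsub>A\<^esub> y \<in> I"
  shows "I +>\<^bsub>A\<^esub> x = I +>\<^bsub>A\<^esub> y"
proof -
  have "x = (x \<ominus>\<^bsub>A\<^esub> y) \<oplus>\<^bsub>A\<^esub> y"
    using assms(1,2) by (simp add: a_minus_def a_assoc l_neg)
  then have "x \<in> I +>\<^bsub>A\<^esub> y" using assms(3) by (auto simp: a_r_coset_def')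
  then show ?thesis by (rule I.a_repr_independence'[symmetric]) (rule assms(2))
qed

lemma assoc_algebra_quot: "assoc_algebra K (quot_algebra A I)"
proof -
  let ?Q = "quot_algebra A I"
  have closed: "x \<in> carrier A \<Longrightarrow> I +>\<^bsub>A\<^esub> x \<in> carrier ?Q" for x
    by (auto simp: quot_simps)
  note simps = quot_simps(2-5) quot_smult closed
  have elim: "\<exists>x. x \<in> carrier A \<and> X = I +>\<^bsub>A\<^esub> x" if "X \<in> carrier ?Q" for X
    using that by (auto simp: quot_simps)
  have group: "abelian_group ?Q"
  proof (rule abelian_groupI)
    fix X assume "X \<in> carrier ?Q"
    then obtain x where "x \<in> carrier A" "X = I +>\<^bsub>A\<^esub> x" using elim by blast
    then show "\<exists>Y\<in>carrier ?Q. Y \<oplus>\<^bsub>?Q\<^esub> X = \<zero>\<^bsub>?Q\<^esub>"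
      by (intro bexI[of _ "I +>\<^bsub>A\<^esub> (\<ominus>\<^bsub>A\<^esub> x)"]) (auto simp: simps l_neg)
  qed (auto dest!: elim simp: simps a_ac)
  show ?thesis
  proof (intro assoc_algebra.intro assoc_algebra_axioms.intro)
    show "module K ?Q"
      by (rule moduleI[OF R.is_cring group])
        (auto dest!: elim simp: simps smult_l_distr smult_r_distr smult_assoc1)
    show "ring ?Q"
    proof (rule ringI[OF group])
      show "monoid ?Q"
        by (rule monoidI) (auto dest!: elim simp: simps m_assoc)
    qed (auto dest!: elim simp: simps l_distr r_distr)
  qed (auto dest!: elim simp: simps smult_mult_left smult_mult_right)
qed

end

text \<open>Evaluation at an arbitrary representative, which is independent of the choice as soon as
  the map vanishes on the ideal.\<close>

definition quot_map :: "('a \<Rightarrow> 's linop) \<Rightarrow> 'a set \<Rightarrow> 's linop" where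
  "quot_map \<phi> X = \<phi> (SOME x. x \<in> X)"

lemma alg_map_zero:
  assumes "assoc_algebra Cq A" "alg_map A \<phi>"
  shows "\<phi> \<zero>\<^bsub>A\<^esub> = 0"
proof -
  interpret assoc_algebra Cq A by fact
  have "\<phi> (\<zero>\<^bsub>A\<^esub> \<oplus>\<^bsub>A\<^esub> \<zero>\<^bsub>A\<^esub>) = \<phi> \<zero>\<^bsub>A\<^esub> + \<phi> \<zero>\<^bsub>A\<^esub>"
    using assms(2) by (auto simp only: alg_map_def M.zero_closed)
  then show ?thesis by simp
qed

lemma alg_map_minus:
  assumes "assoc_algebra Cq A" "alg_map A \<phi>" "x \<in> carrier A" "y \<in> carrier A"
  shows "\<phi> (x \<ominus>\<^bsub>A\<^esub> y) = \<phi> x - \<phi> y"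
proof -
  interpret assoc_algebra Cq A by fact
  have "\<phi> (x \<ominus>\<^bsub>A\<^esub> y) + \<phi> y = \<phi> ((x \<ominus>\<^bsub>A\<^esub> y) \<oplus>\<^bsub>A\<^esub> y)"
    using assms by (simp add: alg_map_def)
  also have "(x \<ominus>\<^bsub>A\<^esub> y) \<oplus>\<^bsub>A\<^esub> y = x"
    using assms(3,4) by (simp add: a_minus_def M.a_assoc M.l_neg)
  finally show ?thesis by (simp add: algebra_simps)
qed

lemma alg_map_kernel_ideal:
  assumes "assoc_algebra Cq A" "alg_map A \<phi>"
  shows "ideal {x \<in> carrier A. \<phi> x = 0} A"
proof -
  interpret assoc_algebra Cq A by fact
  show ?thesis
  proof (rule idealI)
    show "ring A" by (rule ring_axioms)
    show "subgroup {x \<in> carrier A. \<phi> x = 0} (add_monoid A)"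
    proof (rule M.add.subgroupI)
      fix x assume "x \<in> {x \<in> carrier A. \<phi> x = 0}"
      then show "\<ominus>\<^bsub>A\<^esub> x \<in> {x \<in> carrier A. \<phi> x = 0}"
        using alg_map_minus[OF assms M.zero_closed, of x] alg_map_zero[OF assms]
        by (simp add: M.minus_eq)
    qed (use assms(2) alg_map_zero[OF assms] in \<open>auto simp: alg_map_def\<close>)
  qed (use assms(2) in \<open>auto simp: alg_map_def\<close>)
qed

text \<open>The kernel of an algebra map is an ideal; once it contains the relations, it contains
  the ideal they generate, and evaluation at representatives is well defined.\<close>

lemma quot_map:
  assumes A: "assoc_algebra Cq A" and \<phi>: "alg_map A \<phi>"
    and S: "S \<subseteq> carrier A" and zero: "\<forall>x\<in>S. \<phi> x = 0"
  defines "I \<equiv> Idl\<^bsub>A\<^esub> S"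
  shows "algebra_ideal Cq A I"
    and "x \<in> carrier A \<Longrightarrow> quot_map \<phi> (I +>\<^bsub>A\<^esub> x) = \<phi> x"
    and "alg_map (quot_algebra A I) (quot_map \<phi>)"
proof -
  interpret assoc_algebra Cq A by fact
  interpret algebra_ideal Cq A I
    unfolding I_def by (intro algebra_ideal.intro A genideal_ideal S)
  show "algebra_ideal Cq A I" by unfold_locales
  have I: "\<phi> x = 0" if "x \<in> I" for x
    using genideal_minimal[OF alg_map_kernel_ideal[OF A \<phi>], of S] S zero that
    unfolding I_def by blast
  have val: "quot_map \<phi> (I +>\<^bsub>A\<^esub> x) = \<phi> x" if x: "x \<in> carrier A" for x
  proof -
    have "(SOME y. y \<in> I +>\<^bsub>A\<^esub> x) \<in> I +>\<^bsub>A\<^esub> x"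
      by (rule someI) (rule I.a_rcos_self[OF x])
    then obtain i where "i \<in> I" "(SOME y. y \<in> I +>\<^bsub>A\<^esub> x) = i \<oplus>\<^bsub>A\<^esub> x"
      by (auto simp: a_r_coset_def')
    then show ?thesis using \<phi> x I by (auto simp: quot_map_def alg_map_def I.a_Hcarr)
  qed
  then show "x \<in> carrier A \<Longrightarrow> quot_map \<phi> (I +>\<^bsub>A\<^esub> x) = \<phi> x" .
  show "alg_map (quot_algebra A I) (quot_map \<phi>)"
    unfolding alg_map_def
    by (auto dest!: quot_simps(1)[THEN iffD1] simp: quot_simps(2-5) quot_smult val smult_closed
        \<phi>[unfolded alg_map_def])
qed

subsection \<open>Modules from algebra maps\<close>

text \<open>Operators act on functions on all of \<open>'s\<close>; this is the invariance that lets
  them restrict to the coordinate subspace of \<open>B\<close>.\<close>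

definition stab :: "'s set \<Rightarrow> 's linop \<Rightarrow> bool" where
  "stab B T \<longleftrightarrow> (\<forall>v\<in>carrier (coord_space B). apply_op T v \<in> carrier (coord_space B))"

lemma stab_simps:
  "stab B (scal r)" "stab B S \<Longrightarrow> stab B T \<Longrightarrow> stab B (S + T)" "stab B S \<Longrightarrow> stab B T \<Longrightarrow> stab B (S * T)"
  by (simp_all add: stab_def apply_scal scale_def)

lemma alg_module_alg_map:
  assumes "assoc_algebra Cq A" "alg_map A \<phi>" "\<And>x. x \<in> carrier A \<Longrightarrow> stab B (\<phi> x)"
  shows "alg_module Cq A (coord_space B) (\<lambda>x. apply_op (\<phi> x))"
proof (intro alg_module.intro alg_module_axioms.intro)
  show "module Cq (coord_space B)" by (rule module_coord_space)
  fix x v assume "x \<in> carrier A" "v \<in> carrier (coord_space B)"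
  then show "apply_op (\<phi> x) v \<in> carrier (coord_space B)"
    using assms(3) unfolding stab_def by blast
qed (use assms(1,2) in \<open>auto simp: alg_map_def apply_op_linear apply_scal simp del: plus_fun_apply\<close>)

lemma alg_map_finsum:
  assumes "assoc_algebra Cq A" "alg_map A \<phi>" "finite J" "\<And>j. j \<in> J \<Longrightarrow> x j \<in> carrier A"
  shows "\<phi> (\<Oplus>\<^bsub>A\<^esub>j\<in>J. x j) = (\<Sum>j\<in>J. \<phi> (x j))" and "(\<Oplus>\<^bsub>A\<^esub>j\<in>J. x j) \<in> carrier A"
proof -
  interpret assoc_algebra Cq A by fact
  show "(\<Oplus>\<^bsub>A\<^esub>j\<in>J. x j) \<in> carrier A" using assms(4) by (intro M.finsum_closed) auto
  show "\<phi> (\<Oplus>\<^bsub>A\<^esub>j\<in>J. x j) = (\<Sum>j\<in>J. \<phi> (x j))"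
    using assms(3,4)
  proof (induction J rule: finite_induct)
    case empty
    then show ?case using alg_map_zero[OF assms(1,2)] by simp
  next
    case (insert i J)
    then have "(\<Oplus>\<^bsub>A\<^esub>j\<in>insert i J. x j) = x i \<oplus>\<^bsub>A\<^esub> (\<Oplus>\<^bsub>A\<^esub>j\<in>J. x j)"
      by (intro M.finsum_insert) auto
    moreover have "(\<Oplus>\<^bsub>A\<^esub>j\<in>J. x j) \<in> carrier A" "x i \<in> carrier A"
      using insert by (auto intro!: M.finsum_closed)
    ultimately show ?case using insert assms(2) by (simp add: alg_map_def)
  qed
qed

lemma alg_map_list_prod:
  assumes "assoc_algebra Cq A" "alg_map A \<phi>" "set xs \<subseteq> carrier A"
  shows "\<phi> (list_prod A xs) = prod_list (map \<phi> xs)" "list_prod A xs \<in> carrier A"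
proof -
  interpret assoc_algebra Cq A by fact
  have "\<phi> (list_prod A xs) = prod_list (map \<phi> xs) \<and> list_prod A xs \<in> carrier A"
    using assms(3)
  proof (induction xs)
    case Nil
    show ?case using assms(2) by (simp add: list_prod_def alg_map_def)
  next
    case (Cons x xs)
    then show ?case using assms(2) by (auto simp: list_prod_def alg_map_def)
  qed
  then show "\<phi> (list_prod A xs) = prod_list (map \<phi> xs)" "list_prod A xs \<in> carrier A" by auto
qed

lemma alg_map_commutator:
  assumes "assoc_algebra Cq A" "alg_map A \<phi>" "x \<in> carrier A" "y \<in> carrier A"
  shows "\<phi> (commutator A x y) = \<phi> x * \<phi> y - \<phi> y * \<phi> x" "commutator A x y \<in> carrier A"
proof -
  interpret assoc_algebra Cq A by fact
  show "commutator A x y \<in> carrier A"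
    using assms(3,4) by (simp add: commutator_def)
  show "\<phi> (commutator A x y) = \<phi> x * \<phi> y - \<phi> y * \<phi> x"
    unfolding commutator_def using assms by (subst alg_map_minus) (auto simp: alg_map_def)
qed

subsection \<open>Tensor products\<close>

text \<open>The universal property of the tensor product: commuting images make
  \<open>\<phi> a * \<psi> b\<close> multiplicative in the pair \<open>(a, b)\<close>, and the
  linear extension kills the bilinearity relations. The last claim carries an invariant coordinate
  subspace over to the tensor product.\<close>

lemma tensor_map:
  fixes A :: "(ratfun, 'a) module" and B :: "(ratfun, 'b) module"
  assumes A: "assoc_algebra Cq A" and B: "assoc_algebra Cq B"
    and \<phi>: "alg_map A \<phi>" and \<psi>: "alg_map B \<psi>"
    and comm: "\<And>a b. a \<in> carrier A \<Longrightarrow> b \<in> carrier B \<Longrightarrow> \<phi> a * \<psi> b = \<psi> b * \<phi> a"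
  defines "\<rho> \<equiv> quot_map (lin (\<lambda>(a, b). \<phi> a * \<psi> b))"
  shows "assoc_algebra Cq (tensor_algebra A B)" and "alg_map (tensor_algebra A B) \<rho>"
    and "a \<in> carrier A \<Longrightarrow> b \<in> carrier B \<Longrightarrow> \<rho> (pure_tensor A B a b) = \<phi> a * \<psi> b"
    and "(\<And>a. a \<in> carrier A \<Longrightarrow> stab X (\<phi> a)) \<Longrightarrow> (\<And>b. b \<in> carrier B \<Longrightarrow> stab X (\<psi> b)) \<Longrightarrow>
      t \<in> carrier (tensor_algebra A B) \<Longrightarrow> stab X (\<rho> t)"
proof -
  interpret A: assoc_algebra Cq A by fact
  interpret B: assoc_algebra Cq B by fact
  interpret M: monoid "A \<times>\<times> B"
    by (rule DirProd_monoid) (rule A.monoid_axioms B.monoid_axioms)+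
  let ?M = "monoid_algebra (A \<times>\<times> B)" and ?h = "\<lambda>(a, b). \<phi> a * \<psi> b"
  have alg: "assoc_algebra Cq ?M" by (rule M.assoc_algebra_monoid_algebra)
  have lin: "alg_map ?M (lin ?h)"
  proof (rule M.alg_map_lin)
    show "?h \<one>\<^bsub>A \<times>\<times> B\<^esub> = 1" using \<phi> \<psi> by (simp add: alg_map_def)
    fix x y assume "x \<in> carrier (A \<times>\<times> B)" "y \<in> carrier (A \<times>\<times> B)"
    then have "fst x \<in> carrier A" "snd x \<in> carrier B" "fst y \<in> carrier A" "snd y \<in> carrier B"
      by (auto simp: DirProd_def)
    then show "?h (x \<otimes>\<^bsub>A \<times>\<times> B\<^esub> y) = ?h x * ?h y"
      using \<phi> \<psi> mult_commute_middle[OF comm[of "fst y" "snd x", symmetric], of "\<phi> (fst x)" "\<psi>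
          (snd y)"]
      by (simp add: mult_DirProd' case_prod_unfold alg_map_def)
  qed
  have closed: "single (a, b) \<in> carrier ?M" if "a \<in> carrier A" "b \<in> carrier B" for a b
    using that by (intro single_closed) (simp add: DirProd_def)
  have finD: "finite {x. f x \<noteq> 0}" if "f \<in> carrier ?M" for f
    using that by (simp add: monoid_algebra_simps)
  have rel: "tensor_relations A B \<subseteq> carrier ?M"
    unfolding tensor_relations_def using A.smult_closed B.smult_closed
    by (auto intro!: monoid_algebra_closed closed)
  have ker: "\<forall>x\<in>tensor_relations A B. lin ?h x = 0"
  proof
    fix x assume x: "x \<in> tensor_relations A B"
    note simps = lin_add lin_scale finD monoid_algebra_closed closed A.smult_closed B.smult_closed
      \<phi>[unfolded alg_map_def] \<psi>[unfolded alg_map_def]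
    show "lin ?h x = 0"
      using x unfolding tensor_relations_def Un_iff mem_Collect_eq
      by (elim disjE exE conjE; hypsubst)
        (simp_all add: simps distrib_left distrib_right mult.assoc scal_left_commute
          del: fun_diff_def minus_apply)
  qed
  note q = quot_map[OF alg lin rel ker, folded tensor_ideal_def, folded tensor_algebra_def]
  interpret Q: algebra_ideal Cq ?M "tensor_ideal A B" by (rule q(1))
  show "assoc_algebra Cq (tensor_algebra A B)"
    unfolding tensor_algebra_def by (rule Q.assoc_algebra_quot)
  show "alg_map (tensor_algebra A B) \<rho>" unfolding \<rho>_def by (rule q(3))
  show "\<rho> (pure_tensor A B a b) = \<phi> a * \<psi> b" if "a \<in> carrier A" "b \<in> carrier B"
    using q(2)[OF closed[OF that]] by (simp add: \<rho>_def pure_tensor_def)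
  assume stab: "\<And>a. a \<in> carrier A \<Longrightarrow> stab X (\<phi> a)" "\<And>b. b \<in> carrier B \<Longrightarrow> stab X (\<psi> b)"
    and "t \<in> carrier (tensor_algebra A B)"
  then obtain f where f: "f \<in> carrier ?M" "t = tensor_ideal A B +>\<^bsub>?M\<^esub> f"
    by (auto simp: tensor_algebra_def Q.quot_simps)
  have "stab X (lin ?h f)"
    using f(1)
  proof (induction rule: monoid_algebra_induct)
    case zero
    show ?case using stab_simps(1)[of X 0] by (simp only: lin_zero scal_simps)
  next
    case (add r x g)
    have "finite {z. scale r (single x) z \<noteq> 0}" "finite {z. g z \<noteq> 0}" "finite
        {z. single x z \<noteq> (0 :: ratfun)}"
      using add by (auto intro!: finD monoid_algebra_closed single_closed)
    then have "lin ?h (scale r (single x) + g) = scal r * ?h x + lin ?h g"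
      by (simp only: lin_add lin_scale lin_single)
    moreover have "stab X (?h x)"
      using add(1) stab by (auto simp: DirProd_def intro!: stab_simps)
    ultimately show ?case using add.IH by (simp only: stab_simps)
  qed
  then show "stab X (\<rho> t)" using q(2)[OF f(1)] f(2) by (simp add: \<rho>_def)
qed

section \<open>Modules over the quantum group\<close>

lemma free_monoid_simps [simp]:
  "carrier (free_monoid S) = lists S" "x \<otimes>\<^bsub>free_monoid S\<^esub> y = x @ y" "\<one>\<^bsub>free_monoid S\<^esub> = []"
  by (simp_all add: free_monoid_def)

lemma monoid_free_monoid: "monoid (free_monoid S)"
  by (rule monoidI) auto

definition gen_op ::
  "(nat \<Rightarrow> 's linop) \<Rightarrow> (nat \<Rightarrow> 's linop) \<Rightarrow> (nat \<Rightarrow> 's linop) \<Rightarrow> (nat \<Rightarrow> 's linop) \<Rightarrow> qgen \<Rightarrow> 's linop"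
      where
  "gen_op E F K L g =
    (case g of GenE i \<Rightarrow> E i | GenF i \<Rightarrow> F i | GenK i \<Rightarrow> K i | GenKinv i \<Rightarrow> L i)"

definition word_op :: "(qgen \<Rightarrow> 's linop) \<Rightarrow> qgen list \<Rightarrow> 's linop" where
  "word_op h w = prod_list (map h w)"

lemma word_op_simps [simp]: "word_op h [] = 1" "word_op h (g # w) = h g * word_op h w"
  "word_op h (w @ w') = word_op h w * word_op h w'"
  by (simp_all add: word_op_def)

lemma word_op_replicate: "word_op h (replicate k g) = h g ^ k"
  by (induction k) simp_all

lemma word_op_concat: "word_op h (concat ws) = prod_list (map (word_op h) ws)"
  by (induction ws) simp_all

lemma qpow_word_closed: "qpow_word N \<alpha> \<in> lists (qgens N)"
  by (auto simp: qpow_word_def qgens_def split: if_splits)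

lemma qgens_simps [simp]:
  "GenE i \<in> qgens N \<longleftrightarrow> i \<in> {1..<N}" "GenF i \<in> qgens N \<longleftrightarrow> i \<in> {1..<N}"
  "GenK i \<in> qgens N \<longleftrightarrow> i \<in> {1..N}" "GenKinv i \<in> qgens N \<longleftrightarrow> i \<in> {1..N}"
  by (auto simp: qgens_def)

lemma upt_split: "i \<le> j \<Longrightarrow> j \<le> k \<Longrightarrow> [i..<k] = [i..<j] @ [j..<k]"
  by (metis le_add_diff_inverse upt_add_eq_append)

definition qpow_syllable :: "weight \<Rightarrow> nat \<Rightarrow> qgen list" where
  "qpow_syllable \<alpha> i = (if \<alpha> i \<ge> 0 then replicate (nat (\<alpha> i)) (GenK i)
     else replicate (nat (- \<alpha> i)) (GenKinv i))"

lemma qpow_word_syllables: "qpow_word N \<alpha> = concat (map (qpow_syllable \<alpha>) [1..<N + 1])"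
  unfolding qpow_word_def qpow_syllable_def ..

lemma concat_syllables_Nil:
  "(\<And>j. j \<in> {a..<b} \<Longrightarrow> \<alpha> j = 0) \<Longrightarrow> concat (map (qpow_syllable \<alpha>) [a..<b]) = []"
  by (auto simp: qpow_syllable_def)

lemma qpow_word_eps:
  assumes "i \<in> {1..N}"
  shows "qpow_word N (eps i) = [GenK i]"
proof -
  have "[1..<N + 1] = [1..<i] @ [i..<N + 1]" using assms by (intro upt_split) auto
  also have "[i..<N + 1] = i # [i + 1..<N + 1]" using assms by
      (simp add: upt_conv_Cons del: upt_Suc)
  finally have "qpow_word N (eps i) = concat (map (qpow_syllable (eps i)) [1..<i])
      @ qpow_syllable (eps i) i @ concat (map (qpow_syllable (eps i)) [i + 1..<N + 1])"
    unfolding qpow_word_syllables by (simp only: map_append concat_append list.map concat.simps)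
  also have "\<dots> = qpow_syllable (eps i) i"
    by (subst (1 2) concat_syllables_Nil) (auto simp: eps_apply)
  finally show ?thesis by (simp add: qpow_syllable_def eps_apply)
qed

lemma word_op_qpow_word_hwt:
  assumes i: "i \<in> {1..<N}"
  shows "word_op (gen_op E F K L) (qpow_word N (hwt i)) = K i * L (i + 1)"
    "word_op (gen_op E F K L) (qpow_word N (- hwt i)) = L i * K (i + 1)"
proof -
  have upt: "[1..<N + 1] = [1..<i] @ i # (i + 1) # [i + 2..<N + 1]"
  proof -
    have "[1..<N + 1] = [1..<i] @ [i..<N + 1]" using assms by (intro upt_split) auto
    also have "[i..<N + 1] = i # (i + 1) # [i + 2..<N + 1]"
      using assms by (simp add: upt_conv_Cons)
    finally show ?thesis .
  qed
  have *: "qpow_word N \<alpha> = qpow_syllable \<alpha> i @ qpow_syllable \<alpha> (i + 1)" if \<alpha>: "\<alpha> = hwt i \<or> \<alpha> = -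
      hwt i" for \<alpha>
  proof -
    have "\<alpha> j = 0" if "j \<noteq> i" "j \<noteq> i + 1" for j
      using \<alpha> that by (auto simp: eps_apply hwt_def)
    then have "concat (map (qpow_syllable \<alpha>) [1..<i]) = []"
      "concat (map (qpow_syllable \<alpha>) [i + 2..<N + 1]) = []"
      by (intro concat_syllables_Nil; auto)+
    then show ?thesis unfolding qpow_word_syllables upt
      by (simp only: map_append concat_append list.map concat.simps append_Nil append_Nil2)
  qed
  show "word_op (gen_op E F K L) (qpow_word N (hwt i)) = K i * L (i + 1)"
    "word_op (gen_op E F K L) (qpow_word N (- hwt i)) = L i * K (i + 1)"
    using *[of "hwt i"] *[of "- hwt i"]
    by (simp_all add: qpow_syllable_def eps_apply hwt_def gen_op_def)
qed

lemma q_var_minus_inverse_nonzero: "q_var - inverse q_var \<noteq> 0"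
proof
  assume "q_var - inverse q_var = 0"
  then have "q_var * q_var = 1" by (metis eq_iff_diff_eq_0 q_var_nonzero right_inverse)
  then have "to_fract ([:0, 1:] * [:0, 1:]) = to_fract (1 :: complex poly)"
    by (simp only: q_var_def to_fract_mult to_fract_1)
  then have "[:0, 1:] * [:0, 1:] = (1 :: complex poly)" by (simp only: to_fract_eq_iff)
  then have "poly ([:0, 1:] * [:0, 1:]) 0 = poly (1 :: complex poly) 0" by (simp only:)
  then show False by simp
qed

section \<open>The quantum group as a quotient of the free algebra\<close>

lemma free_algebra_closed:
  "(\<And>w. w \<in> lists S \<Longrightarrow> single w \<in> carrier (free_algebra S))"
  "f \<in> carrier (free_algebra S) \<Longrightarrow> scale r f \<in> carrier (free_algebra S)"
  "f \<in> carrier (free_algebra S) \<Longrightarrow> g \<in> carrier (free_algebra S) \<Longrightarrow> f + g \<in> carrier (free_algebra S)"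
  "f \<in> carrier (free_algebra S) \<Longrightarrow> g \<in> carrier (free_algebra S) \<Longrightarrow> f - g \<in> carrier (free_algebra S)"
  using single_closed[of _ "free_monoid S"] monoid_algebra_closed[of _ "free_monoid S"]
  by (simp_all add: free_algebra_def)

lemma Uq_relations_closed: "Uq_relations N \<subseteq> carrier (free_algebra (qgens N))"
  unfolding Uq_relations_def
  by (auto intro!: free_algebra_closed qpow_word_closed)

lemma assoc_algebra_free: "assoc_algebra Cq (free_algebra S)"
  unfolding free_algebra_def by (rule monoid.assoc_algebra_monoid_algebra[OF monoid_free_monoid])

lemma algebra_ideal_Uq: "algebra_ideal Cq (free_algebra (qgens N)) (Uq_ideal N)"
proof -
  interpret assoc_algebra Cq "free_algebra (qgens N)" by (rule assoc_algebra_free)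
  show ?thesis unfolding Uq_ideal_def
    by (intro algebra_ideal.intro assoc_algebra_free genideal_ideal Uq_relations_closed)
qed

lemma assoc_algebra_Uq: "assoc_algebra Cq (Uq N)"
  unfolding Uq_def by (rule algebra_ideal.assoc_algebra_quot[OF algebra_ideal_Uq])

lemma Uq_carrier_iff:
  "X \<in> carrier (Uq N) \<longleftrightarrow>
    (\<exists>f\<in>carrier (free_algebra (qgens N)). X = Uq_ideal N +>\<^bsub>free_algebra (qgens N)\<^esub> f)"
  unfolding Uq_def by (rule algebra_ideal.quot_simps(1)[OF algebra_ideal_Uq])

lemma Uq_word_closed: "w \<in> lists (qgens N) \<Longrightarrow> Uq_word N w \<in> carrier (Uq N)"
  unfolding Uq_carrier_iff Uq_word_def by (rule bexI[where x = "single w"])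
      (rule refl, rule free_algebra_closed(1))

lemma free_algebra_simps:
  "f \<oplus>\<^bsub>free_algebra S\<^esub> g = f + g" "r \<odot>\<^bsub>free_algebra S\<^esub> f = scale r f"
  "single w \<otimes>\<^bsub>free_algebra S\<^esub> single w' = single (w @ w')" "\<one>\<^bsub>free_algebra S\<^esub> = single []"
  "\<zero>\<^bsub>free_algebra S\<^esub> = 0"
  by (simp_all add: free_algebra_def monoid_algebra_simps monoid_algebra_mult_single)

lemma Uq_word_append:
  assumes "w \<in> lists (qgens N)" "w' \<in> lists (qgens N)"
  shows "Uq_word N (w @ w') = Uq_word N w \<otimes>\<^bsub>Uq N\<^esub> Uq_word N w'"
  using algebra_ideal.quot_simps(2)[OF algebra_ideal_Uq free_algebra_closed(1)[OF assms(1)]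
      free_algebra_closed(1)[OF assms(2)]]
  by (simp add: Uq_word_def Uq_def free_algebra_simps)

lemma Uq_one: "\<one>\<^bsub>Uq N\<^esub> = Uq_word N []"
  using algebra_ideal.quot_simps(4)[OF algebra_ideal_Uq, of N]
  by (simp add: Uq_word_def Uq_def free_algebra_simps)

lemma free_algebra_minus:
  assumes "f \<in> carrier (free_algebra S)" "g \<in> carrier (free_algebra S)"
  shows "f \<ominus>\<^bsub>free_algebra S\<^esub> g = f - g"
proof -
  interpret assoc_algebra Cq "free_algebra S" by (rule assoc_algebra_free)
  have "(f \<ominus>\<^bsub>free_algebra S\<^esub> g) + g = f"
    using assms M.minus_eq[of f g] M.a_assoc[of f "\<ominus>\<^bsub>free_algebra S\<^esub> g" g] M.l_neg[of g]
    by (simp add: free_algebra_simps del: plus_fun_apply)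
  then show ?thesis by (simp only: eq_diff_eq)
qed

text \<open>Needed for uniqueness of the action: \<open>is_ext_action\<close> prescribes values for
  \<open>E\<close>, \<open>F\<close> and \<open>K\<close> only, and the inverse generators are
  reached through this relation.\<close>

lemma Uq_K_inverse:
  assumes "i \<in> {1..N}"
  shows "Uq_word N [GenKinv i, GenK i] = Uq_word N []"
proof -
  interpret algebra_ideal Cq "free_algebra (qgens N)" "Uq_ideal N" by (rule algebra_ideal_Uq)
  have "single [GenKinv i, GenK i] - single [] \<in> Uq_relations N"
    using assms unfolding Uq_relations_def by blast
  then have "single [GenKinv i, GenK i] - single [] \<in> Uq_ideal N"
    unfolding Uq_ideal_def using genideal_self[OF Uq_relations_closed] by blast
  then show ?thesis unfolding Uq_word_def using assms
    by (intro quot_eqI) (simp_all add: free_algebra_closed free_algebra_minus)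
qed

lemma lin_free_algebra:
  assumes "f \<in> carrier (free_algebra S)" 
  shows "lin h (scale r f) = scal r * lin h f"
    "g \<in> carrier (free_algebra S) \<Longrightarrow> lin h (f + g) = lin h f + lin h g"
    "g \<in> carrier (free_algebra S) \<Longrightarrow> lin h (f - g) = lin h f - lin h g"
  using assms by (simp_all add: free_algebra_def monoid_algebra_simps lin_add lin_scale)

lemma scal_of_bool_divide: "scal (of_bool b / r) * T = (if b then scal (inverse r) * T else 0)"
  by (simp add: scal_simps divide_inverse)

context uq_rep
begin

definition rep_map :: "uq \<Rightarrow> 'a linop" where
  "rep_map = quot_map (lin (word_op (gen_op E F K L)))"

lemma relations_vanish: "\<forall>x\<in>Uq_relations N. lin (word_op (gen_op E F K L)) x = 0"
proof
  fix x assume x: "x \<in> Uq_relations N"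
  let ?l = "lin (word_op (gen_op E F K L))"
  \<comment> \<open>The locale speaks of q-commutation, the presentation of conjugation by
    \<open>K i\<close>; this converts one into the other.\<close>
  have qc: "S * (T * U) = scal (q_var powi k) * T" if "qcomm k S T" "S * U = 1" for S T U :: "'a
      linop" and k
  proof -
    have "S * (T * U) = (S * T) * U" by (simp only: mult.assoc)
    also have "\<dots> = scal (q_var powi k) * (T * (S * U))"
      using that(1) by (simp only: qcomm_def mult.assoc)
    finally show ?thesis using that(2) by simp
  qed
  note lins = lin_free_algebra[of _ "qgens N"] free_algebra_closed qpow_word_closed lin_single
      word_op_simps
  show "?l x = 0"
    using x unfolding Uq_relations_def Un_iff mem_Collect_eq
  proof (elim disjE exE conjE; hypsubst)
    fix i assume "i \<in> {1..N}"
    then show "?l (single [GenK i, GenKinv i] - single []) = 0" "?l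
        (single [GenKinv i, GenK i] - single []) = 0"
      by (simp_all add: lins gen_op_def K_L del: fun_diff_def minus_apply)
  next
    fix i j assume "i \<in> {1..N}" "j \<in> {1..N}"
    then show "?l (single [GenK i, GenK j] - single [GenK j, GenK i]) = 0"
      by (simp add: lins gen_op_def K_K[of i j] del: fun_diff_def minus_apply)
  next
    fix i j assume ij: "i \<in> {1..N}" "j \<in> {1..<N}"
    show "?l (single [GenK i, GenE j, GenKinv i]
        - scale (q_var powi (of_bool (i = j) - of_bool (i = j + 1))) (single [GenE j])) = 0"
      using ij qc[OF K_E[OF ij] K_L(1)[OF ij(1)]] by
          (simp add: lins gen_op_def del: fun_diff_def minus_apply)
    show "?l (single [GenK i, GenF j, GenKinv i]
        - scale (q_var powi (- of_bool (i = j) + of_bool (i = j + 1))) (single [GenF j])) = 0"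
      using ij qc[OF K_F[OF ij] K_L(1)[OF ij(1)]] by
          (simp add: lins gen_op_def del: fun_diff_def minus_apply)
  next
    fix i j assume ij: "i \<in> {1..<N}" "j \<in> {1..<N}"
    show "?l (single [GenE i, GenF j] - single [GenF j, GenE i]
        - scale (of_bool (i = j) / (q_var - inverse q_var))
            (single (qpow_word N (hwt i)) - single (qpow_word N (- hwt i)))) = 0"
    proof -
      have "?l (single [GenE i, GenF j] - single [GenF j, GenE i]
          - scale (of_bool (i = j) / (q_var - inverse q_var))
            (single (qpow_word N (hwt i)) - single (qpow_word N (- hwt i))))
        = E i * F j - F j * E i - scal (of_bool (i = j) / (q_var - inverse q_var)) *
            (K i * L (i + 1) - L i * K (i + 1))"
        using ij word_op_qpow_word_hwt[OF ij(1), of E F K L]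
        by (simp add: lins gen_op_def del: fun_diff_def minus_apply)
      \<comment> \<open>Reading \<open>E_F\<close> backwards covers both cases at once: for distinct
        \<open>i\<close>, \<open>j\<close> its right side is zero, and so is the coefficient with
        \<open>of_bool\<close>.\<close>
      also have "\<dots> = E i * F j - F j * E i
          - scal (inverse (q_var - inverse q_var)) *
              (scal (q_var - inverse q_var) * (E i * F j - F j * E i))"
        unfolding E_F[OF ij] scal_of_bool_divide by simp
      also have "\<dots> = 0"
      proof -
        have "scal (inverse (q_var - inverse q_var)) * scal (q_var - inverse q_var) =
            (1 :: 'a linop)"
          using q_var_minus_inverse_nonzero by (simp flip: scal_simps(4) add: scal_simps(2))
        then show ?thesis by (metis mult.assoc mult_1 right_minus_eq)
      qed
      finally show ?thesis .
    qed
  next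
    fix i j assume ij: "i \<in> {1..<N}" "j \<in> {1..<N}" "1 < \<bar>int i - int j\<bar>"
    show "?l (single [GenE i, GenE j] - single [GenE j, GenE i]) = 0"
      "?l (single [GenF i, GenF j] - single [GenF j, GenF i]) = 0"
      using E_E[OF ij] F_F[OF ij] ij by (simp_all add: lins gen_op_def del: fun_diff_def
          minus_apply)
  next
    fix i j assume ij: "i \<in> {1..<N}" "j \<in> {1..<N}" "\<bar>int i - int j\<bar> = 1"
    show "?l (single [GenE j, GenE i, GenE i] - scale (q_var + inverse q_var)
        (single [GenE i, GenE j, GenE i])
        + single [GenE i, GenE i, GenE j]) = 0"
      "?l (single [GenF j, GenF i, GenF i] - scale (q_var + inverse q_var)
          (single [GenF i, GenF j, GenF i])
        + single [GenF i, GenF i, GenF j]) = 0"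
      using serre_E[OF ij] serre_F[OF ij] ij
      by (simp_all add: lins gen_op_def serre_def mult.assoc del: fun_diff_def minus_apply
          plus_fun_apply)
  qed
qed

lemma alg_map_word: "alg_map (free_algebra (qgens N)) (lin (word_op (gen_op E F K L)))"
  unfolding free_algebra_def
  by (rule monoid.alg_map_lin[OF monoid_free_monoid]) simp_all

lemmas rep_map_quot = quot_map[OF assoc_algebra_free alg_map_word Uq_relations_closed
    relations_vanish,
    folded Uq_ideal_def Uq_def rep_map_def]

lemma alg_map_rep_map: "alg_map (Uq N) rep_map"
  by (rule rep_map_quot(3))

lemma rep_map_word: "w \<in> lists (qgens N) \<Longrightarrow> rep_map (Uq_word N w) = word_op (gen_op E F K L) w"
  unfolding Uq_word_def by (subst rep_map_quot(2)) (simp_all add: free_algebra_closed)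

lemma rep_map_gens:
  "i \<in> {1..<N} \<Longrightarrow> rep_map (e_gen N i) = E i" "i \<in> {1..<N} \<Longrightarrow> rep_map (f_gen N i) = F i"
  "i \<in> {1..N} \<Longrightarrow> rep_map (qpow N (eps i)) = K i"
  by (simp_all add: e_gen_def f_gen_def qpow_def rep_map_word qpow_word_eps gen_op_def)

text \<open>Commutation and stability are checked on generators only; this carries them to the image
  of all of \<open>Uq N\<close>.\<close>

lemma rep_map_induct:
  assumes X: "X \<in> carrier (Uq N)"
    and scal: "\<And>r. P (scal r)" and add: "\<And>S T. P S \<Longrightarrow> P T \<Longrightarrow> P (S + T)"
    and mult: "\<And>S T. P S \<Longrightarrow> P T \<Longrightarrow> P (S * T)"
    and E: "\<And>i. i \<in> {1..<N} \<Longrightarrow> P (E i)" and F: "\<And>i. i \<in> {1..<N} \<Longrightarrow> P (F i)"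
    and K: "\<And>i. i \<in> {1..N} \<Longrightarrow> P (K i)" and L: "\<And>i. i \<in> {1..N} \<Longrightarrow> P (L i)"
  shows "P (rep_map X)"
proof -
  let ?l = "lin (word_op (gen_op E F K L))"
  obtain f where f: "f \<in> carrier (free_algebra (qgens N))"
      "X = Uq_ideal N +>\<^bsub>free_algebra (qgens N)\<^esub> f"
    using X unfolding Uq_carrier_iff by blast
  have word: "P (word_op (gen_op E F K L) w)" if "w \<in> lists (qgens N)" for w
    using that
  proof (induction w)
    case Nil
    show ?case using scal[of 1] by (simp add: scal_simps)
  next
    case (Cons g w)
    then have "P (gen_op E F K L g)" using E F K L by (cases g) (auto simp: gen_op_def)
    then show ?case using Cons mult by simp
  qed
  have "P (?l f)"
    using f(1)[unfolded free_algebra_def]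
  proof (induction rule: monoid_algebra_induct)
    case zero
    show ?case using scal[of 0] by (simp only: scal_simps lin_zero)
  next
    case (add r w g)
    have "g \<in> carrier (free_algebra (qgens N))" "w \<in> lists (qgens N)"
      using add by (simp_all add: free_algebra_def)
    then have "?l (scale r (single w) + g) = scal r * word_op (gen_op E F K L) w + ?l g"
      by (simp add: lin_free_algebra[where S = "qgens N"] free_algebra_closed del: plus_fun_apply)
    then show ?case using add word scal mult assms(3) by (simp only: free_monoid_simps)
  qed
  then show ?thesis using rep_map_quot(2)[OF f(1)] f(2) by simp
qed

end

section \<open>The exterior power\<close>

text \<open>There is no \<open>k\<close> here: the operators act on all exterior powers at once, and
  a single one is selected by \<open>stab (ext_basis N k)\<close>.\<close>

definition ext_map :: "nat \<Rightarrow> uq \<Rightarrow> nat set linop" where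
  "ext_map N = uq_rep.rep_map (\<lambda>i. hop i (i + 1)) (\<lambda>i. hop (i + 1) i)
     (\<lambda>i. wt_op N (eps i)) (\<lambda>i. wt_op N (- eps i))"

lemma ext_uq_rep:
  "uq_rep N (\<lambda>i. hop i (i + 1)) (\<lambda>i. hop (i + 1) i) (\<lambda>i. wt_op N (eps i)) (\<lambda>i. wt_op N (- eps i))"
  using fermion_rep[of N "\<lambda>i. i" N] by simp

lemma alg_map_ext_map: "alg_map (Uq N) (ext_map N)"
  unfolding ext_map_def by (rule uq_rep.alg_map_rep_map[OF ext_uq_rep])

lemma stab_wt_op: "stab B (wt_op N \<alpha>)"
  by (simp add: stab_def wt_op_def)

lemma finite_ext_basis: "finite (ext_basis N k)"
  by (rule finite_subset[of _ "Pow {1..N}"]) (auto simp: ext_basis_def)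

text \<open>A hop preserves the number of particles, and both of its ends lie in
  \<open>{1..N}\<close>.\<close>

lemma stab_hop:
  assumes "a \<in> {1..N}" "b \<in> {1..N}"
  shows "stab (ext_basis N k) (hop a b)"
  unfolding stab_def
proof
  fix v :: "nat set \<Rightarrow> ratfun" assume v: "v \<in> carrier (coord_space (ext_basis N k))"
  have "apply_op (hop a b) v d = 0" if d: "d \<notin> ext_basis N k" for d
  proof (cases "a \<in> d \<and> b \<notin> d - {a}")
    case True
    have "insert b (d - {a}) \<notin> ext_basis N k"
    proof
      assume e: "insert b (d - {a}) \<in> ext_basis N k"
      then have "d \<subseteq> {1..N}" using assms by (auto simp: ext_basis_def)
      moreover from this have "finite d" by (rule finite_subset) simp
      then have "card (insert b (d - {a})) = card d"
        using True by (metis card.insert_remove card_Suc_Diff1 finite_Diff Diff_insert_absorb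
            card_insert_disjoint)
      ultimately show False using d e by (simp add: ext_basis_def)
    qed
    then show ?thesis using v by (simp add: hop_def)
  qed (auto simp: hop_def)
  then show "apply_op (hop a b) v \<in> carrier (coord_space (ext_basis N k))" by simp
qed

lemma apply_hop_single:
  "apply_op (hop a b) (single c) d =
    (if a \<in> d \<and> b \<notin> d - {a} \<and> insert b (d - {a}) = c then of_int
        (jw_sign a d * jw_sign b (d - {a})) else 0)"
  by (auto simp: hop_def single_apply)

text \<open>Once site \<open>i\<close> is left out, neighbouring sites have the same occupied sites
  below them, so the two signs in the hop agree and multiply to 1.\<close>

lemma jw_sign_adjacent: "jw_sign (Suc i) (d - {i}) = jw_sign i d"
  unfolding jw_sign_def by (rule arg_cong[where f = "\<lambda>X. (- 1) ^ card X"]) auto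

lemma jw_sign_adjacent': "i \<notin> d \<Longrightarrow> jw_sign (Suc i) d = jw_sign i d"
  unfolding jw_sign_def
  by (rule arg_cong[where f = "\<lambda>X. (- 1) ^ card X"]) (auto simp: less_Suc_eq)

lemma is_ext_action_ext_map: "is_ext_action N k (\<lambda>X. apply_op (ext_map N X))"
proof -
  note gens = uq_rep.rep_map_gens[OF ext_uq_rep, folded ext_map_def]
  have stab: "stab (ext_basis N k) (ext_map N X)" if "X \<in> carrier (Uq N)" for X
    unfolding ext_map_def
    by (rule uq_rep.rep_map_induct[OF ext_uq_rep that, where P = "stab (ext_basis N k)"])
      (auto intro: stab_simps stab_wt_op stab_hop)
  have "alg_module Cq (Uq N) (ext_space N k) (\<lambda>X. apply_op (ext_map N X))"
    unfolding ext_space_def by (rule alg_module_alg_map[OF assoc_algebra_Uq alg_map_ext_map stab])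
  moreover have "apply_op (ext_map N (qpow N (eps i))) (single c) =
      (if i \<in> c then scale q_var (single c) else single c)" if "i \<in> {1..N}" for i c
    using that by (intro ext) (auto simp: gens apply_wt_op_eps scale_def single_apply simp del:
        atLeastAtMost_iff)
  moreover have "apply_op (ext_map N (e_gen N i)) (single c) =
      (if i + 1 \<in> c \<and> i \<notin> c then single (c - {i + 1} \<union> {i}) else 0)" if "i \<in> {1..<N}" for i c
    unfolding gens(1)[OF that]
    by (intro ext) (auto simp: apply_hop_single single_apply jw_sign_adjacent)
  moreover have "apply_op (ext_map N (f_gen N i)) (single c) =
      (if i \<in> c \<and> i + 1 \<notin> c then single (c - {i} \<union> {i + 1}) else 0)" if "i \<in> {1..<N}" for i c
    unfolding gens(2)[OF that]
    by (intro ext) (auto simp: apply_hop_single single_apply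
        jw_sign_adjacent'[of i "d - {Suc i}" for d, symmetric])
  ultimately show ?thesis by (simp add: is_ext_action_def)
qed

text \<open>This is what gives access to \<open>ext_act\<close>. Two actions that agree for
  generators on basis vectors agree on all vectors by linearity, then for words by multiplicativity,
  then on all of \<open>Uq N\<close> by linearity again.\<close>

lemma ext_action_unique:
  assumes act: "is_ext_action N k act" and X: "X \<in> carrier (Uq N)" and v: "v \<in> carrier
      (ext_space N k)"
  shows "act X v = apply_op (ext_map N X) v"
proof -
  interpret alg_module Cq "Uq N" "ext_space N k" act
    using act by (simp add: is_ext_action_def)
  let ?V = "carrier (ext_space N k)"
  have act': "is_ext_action N k (\<lambda>X. apply_op (ext_map N X))" by (rule is_ext_action_ext_map)
  then interpret R: alg_module Cq "Uq N" "ext_space N k" "\<lambda>X. apply_op (ext_map N X)"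
    by (simp add: is_ext_action_def)
  have V_iff: "w \<in> ?V \<longleftrightarrow> (\<forall>x. x \<notin> ext_basis N k \<longrightarrow> w x = 0)" for w
    by (simp add: ext_space_def)
  have ops: "a \<oplus>\<^bsub>ext_space N k\<^esub> b = a + b" "r \<odot>\<^bsub>ext_space N k\<^esub> a = scale r a" for a b r
    by (simp_all add: ext_space_def)
  have closed: "w \<in> ?V" if "{x. w x \<noteq> 0} \<subseteq> ext_basis N k" for w
    using that by (auto simp: V_iff)
  have single_V: "single c \<in> ?V" if "c \<in> ext_basis N k" for c
    using that by (auto simp: V_iff single_apply)
  have zero_V: "0 \<in> ?V" by (simp add: V_iff)
  have scale_zero: "scale 0 w = 0" for w :: "nat set \<Rightarrow> ratfun" by (rule scale_simps(6))
  have basis: "act Y w = apply_op (ext_map N Y) w"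
    if Y: "Y \<in> carrier (Uq N)" and w: "w \<in> ?V"
      and agree: "\<And>c. c \<in> ext_basis N k \<Longrightarrow> act Y (single c) = apply_op (ext_map N Y) (single c)" for
          Y w
  proof -
    have sup: "{x. w x \<noteq> 0} \<subseteq> ext_basis N k" using w by (auto simp: V_iff)
    have "finite {x. w x \<noteq> 0}" by (rule finite_subset[OF sup finite_ext_basis])
    then show ?thesis using sup
    proof (induction rule: finite_support_induct)
      case zero
      have "act Y (scale 0 0) = scale 0 (act Y 0)"
        using act_smult_right[of 0 Y 0] Y zero_V by (simp only: ops Cq_simps UNIV_I)
      then show ?case by (simp only: scale_zero apply_op_zero)
    next
      case (add r c g)
      have g: "g \<in> ?V" by (rule closed[OF add(3)])
      have s: "scale r (single c) \<in> ?V"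
        using V.smult_closed[of r "single c"] single_V[OF add(1)] by (simp add: ops)
      have "act Y (scale r (single c) + g) = act Y (scale r (single c)) + act Y g"
        using act_add_right[OF Y s g] by (simp only: ops)
      also have "act Y (scale r (single c)) = scale r (act Y (single c))"
        using act_smult_right[of r Y "single c"] Y single_V[OF add(1)] by
            (simp only: ops Cq_simps UNIV_I)
      finally show ?case using add by (simp only: agree apply_op_linear)
    qed
  qed
  note fa = act[unfolded is_ext_action_def, THEN conjunct2, rule_format]
    and fa' = act'[unfolded is_ext_action_def, THEN conjunct2, rule_format]
  have agree: "i \<in> {1..N} \<Longrightarrow> act (qpow N (eps i)) (single c) = apply_op (ext_map N (qpow N (eps i)))
      (single c)"
    "i \<in> {1..<N} \<Longrightarrow> act (e_gen N i) (single c) = apply_op (ext_map N (e_gen N i)) (single c)"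
    "i \<in> {1..<N} \<Longrightarrow> act (f_gen N i) (single c) = apply_op (ext_map N (f_gen N i)) (single c)"
    if c: "c \<in> ext_basis N k" for c i
    by (simp_all only: fa[OF c, THEN conjunct1, rule_format] fa'[OF c, THEN conjunct1, rule_format]
      fa[OF c, THEN conjunct2, THEN conjunct1, rule_format]
          fa'[OF c, THEN conjunct2, THEN conjunct1, rule_format]
      fa[OF c, THEN conjunct2, THEN conjunct2, rule_format]
          fa'[OF c, THEN conjunct2, THEN conjunct2, rule_format])
  have K: "act (Uq_word N [GenK i]) w = apply_op (ext_map N (Uq_word N [GenK i])) w"
    if "i \<in> {1..N}" "w \<in> ?V" for i w
    using basis[OF Uq_word_closed that(2), of "[GenK i]"] agree(1)[OF _ that(1)] that(1)
    by (simp add: qpow_def qpow_word_eps)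
  have gen: "act (Uq_word N [g]) w = apply_op (ext_map N (Uq_word N [g])) w"
    if g: "g \<in> qgens N" and w: "w \<in> ?V" for g w
  proof (cases g)
    case (GenE i)
    then show ?thesis using basis[OF Uq_word_closed w, of "[g]"] agree(2)[of _ i] g
      by (simp add: e_gen_def)
  next
    case (GenF i)
    then show ?thesis using basis[OF Uq_word_closed w, of "[g]"] agree(3)[of _ i] g
      by (simp add: f_gen_def)
  next
    case (GenK i)
    then show ?thesis using g K[OF _ w] by simp
  next
    case (GenKinv i)
    then have i: "i \<in> {1..N}" using g by simp
    let ?K = "Uq_word N [GenK i]" and ?L = "Uq_word N [GenKinv i]"
    have KL: "?K \<in> carrier (Uq N)" "?L \<in> carrier (Uq N)"
      using i by (auto intro!: Uq_word_closed)
    have 1: "?L \<otimes>\<^bsub>Uq N\<^esub> ?K = \<one>\<^bsub>Uq N\<^esub>"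
      using Uq_word_append[of "[GenKinv i]" N "[GenK i]"] Uq_K_inverse[OF i] i by (simp add: Uq_one)
    \<comment> \<open>\<open>u\<close> is the value expected for the inverse generator.
      \<open>K\<close> maps it to \<open>w\<close> in either action, so applying the inverse to
      \<open>w\<close> in the unknown action returns \<open>u\<close>.\<close>
    define u where "u = apply_op (ext_map N ?L) w"
    have u: "u \<in> ?V" unfolding u_def by (rule R.act_closed[OF KL(2) w])
    have "apply_op (ext_map N ?K) u = w"
      using i uq_rep.rep_map_word[OF ext_uq_rep, of "[GenK i]" N, folded ext_map_def]
        uq_rep.rep_map_word[OF ext_uq_rep, of "[GenKinv i]" N, folded ext_map_def]
        wt_op_inverse(1)[of N "eps i"]
      by (simp add: u_def gen_op_def flip: apply_op_simps(6))
    then have "act ?L w = act ?L (act ?K u)" using K[OF i u] by simp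
    also have "\<dots> = act (?L \<otimes>\<^bsub>Uq N\<^esub> ?K) u" using act_mult[OF KL(2,1) u] by simp
    also have "\<dots> = u" unfolding 1 by (rule act_one[OF u])
    finally show ?thesis by (simp add: u_def GenKinv)
  qed
  have word: "act (Uq_word N w) u = apply_op (ext_map N (Uq_word N w)) u"
    if "w \<in> lists (qgens N)" "u \<in> ?V" for w u
    using that
  proof (induction w arbitrary: u)
    case Nil
    then show ?case using act_one R.act_one by (simp add: Uq_one)
  next
    case (Cons g w)
    have split: "Uq_word N (g # w) = Uq_word N [g] \<otimes>\<^bsub>Uq N\<^esub> Uq_word N w"
      using Uq_word_append[of "[g]" N w] Cons by simp
    have mem: "Uq_word N [g] \<in> carrier (Uq N)" "Uq_word N w \<in> carrier (Uq N)"
      using Cons by (auto intro!: Uq_word_closed)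
    have "apply_op (ext_map N (Uq_word N w)) u \<in> ?V"
      by (rule R.act_closed[OF mem(2) Cons.prems])
    then show ?case
      unfolding split using Cons gen by (simp add: act_mult[OF mem] R.act_mult[OF mem])
  qed
  interpret I: algebra_ideal Cq "free_algebra (qgens N)" "Uq_ideal N" by (rule algebra_ideal_Uq)
  let ?c = "\<lambda>f. Uq_ideal N +>\<^bsub>free_algebra (qgens N)\<^esub> f"
  obtain f where f: "f \<in> carrier (free_algebra (qgens N))" "X = ?c f"
    using X unfolding Uq_carrier_iff by blast
  have mem: "?c g \<in> carrier (Uq N)" if "g \<in> carrier (free_algebra (qgens N))" for g
    unfolding Uq_carrier_iff using that by blast
  have "act (?c f) v = apply_op (ext_map N (?c f)) v"
    using f(1)[unfolded free_algebra_def]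
  proof (induction rule: monoid_algebra_induct)
    case zero
    have "?c 0 = \<zero>\<^bsub>Uq N\<^esub>"
      using I.quot_simps(5) by (simp only: Uq_def free_algebra_simps)
    moreover have "act \<zero>\<^bsub>Uq N\<^esub> v = 0" "apply_op (ext_map N \<zero>\<^bsub>Uq N\<^esub>) v = 0"
      using act_smult_left[of 0 "\<zero>\<^bsub>Uq N\<^esub>" v] R.act_smult_left[of 0 "\<zero>\<^bsub>Uq N\<^esub>" v] v
        A.smult_r_null[of 0]
      by (simp_all only: ops scale_zero Cq_simps UNIV_I A.M.zero_closed)
    ultimately show ?case by (simp only:)
  next
    case (add r w g)
    have g: "g \<in> carrier (free_algebra (qgens N))" and w: "w \<in> lists (qgens N)"
      using add by (simp_all add: free_algebra_def)
    have s: "single w \<in> carrier (free_algebra (qgens N))" "scale r (single w) \<in> carrier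
        (free_algebra (qgens N))"
      using w by (auto intro!: free_algebra_closed)
    have eq: "?c (scale r (single w) + g) = (r \<odot>\<^bsub>Uq N\<^esub> Uq_word N w) \<oplus>\<^bsub>Uq N\<^esub> ?c g"
      using I.quot_smult[of r "single w"] I.quot_simps(3)[OF s(2) g] s
      by (simp add: Uq_def Uq_word_def free_algebra_simps del: plus_fun_apply)
    have W: "Uq_word N w \<in> carrier (Uq N)" "r \<odot>\<^bsub>Uq N\<^esub> Uq_word N w \<in> carrier (Uq N)"
      using Uq_word_closed[OF w] A.smult_closed by auto
    show ?case unfolding eq
      using act_add_left[OF W(2) mem[OF g] v] R.act_add_left[OF W(2) mem[OF g] v]
        act_smult_left[of r, OF _ W(1) v] R.act_smult_left[of r, OF _ W(1) v] word[OF w v] add.IH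
      by (simp only: Cq_simps UNIV_I)
  qed
  then show ?thesis using f(2) by simp
qed

lemma ext_act_eq:
  assumes "X \<in> carrier (Uq N)" "v \<in> carrier (ext_space N k)"
  shows "ext_act N k X v = apply_op (ext_map N X) v"
proof (rule ext_action_unique[OF _ assms])
  show "is_ext_action N k (ext_act N k)"
    unfolding ext_act_def
    using someI[of "is_ext_action N k", OF is_ext_action_ext_map] .
qed

section \<open>Operators of weights, root vectors and their sums\<close>

lemma wt_op_cong: "(\<And>x. x \<in> {1..N} \<Longrightarrow> \<alpha> x = \<beta> x) \<Longrightarrow> wt_op N \<alpha> = wt_op N \<beta>"
  unfolding wt_op_def by (auto intro!: arg_cong[where f = diag] prod.cong simp: fun_eq_iff)

lemma wt_op_power: "wt_op N \<alpha> ^ k = wt_op N (\<lambda>x. int k * \<alpha> x)"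
proof (induction k)
  case 0
  have "wt_op N (\<lambda>x. int 0 * \<alpha> x) = wt_op N 0" by (rule wt_op_cong) simp
  then show ?case by simp
next
  case (Suc k)
  have "wt_op N (\<lambda>x. int (Suc k) * \<alpha> x) = wt_op N (\<alpha> + (\<lambda>x. int k * \<alpha> x))"
    by (rule wt_op_cong) (simp add: algebra_simps)
  then show ?case using Suc by (simp add: wt_op_add)
qed

lemma wt_op_prod_list: "prod_list (map (\<lambda>i. wt_op N (\<beta> i)) xs) = wt_op N (\<Sum>i\<leftarrow>xs. \<beta> i)"
  by (induction xs) (simp_all add: wt_op_add del: plus_fun_apply zero_fun_apply)

text \<open>Each syllable of the word contributes the part of the weight concentrated on one index,
  and weight operators multiply by adding weights.\<close>

lemma ext_map_qpow: "ext_map N (qpow N \<alpha>) = wt_op N \<alpha>"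
  and qpow_closed: "qpow N \<alpha> \<in> carrier (Uq N)"
proof -
  let ?g = "gen_op (\<lambda>i. hop i (i + 1)) (\<lambda>i. hop (i + 1) i) (\<lambda>i. wt_op N (eps i))
      (\<lambda>i. wt_op N (- eps i))"
  show "qpow N \<alpha> \<in> carrier (Uq N)"
    unfolding qpow_def by (rule Uq_word_closed[OF qpow_word_closed])
  have syl: "word_op ?g (qpow_syllable \<alpha> i) = wt_op N (\<lambda>x. if x = i then \<alpha> i else 0)" for i
    unfolding qpow_syllable_def
    by (auto simp: word_op_replicate gen_op_def wt_op_power eps_apply intro!: wt_op_cong)
  have "ext_map N (qpow N \<alpha>) = word_op ?g (qpow_word N \<alpha>)"
    unfolding qpow_def ext_map_def by (rule uq_rep.rep_map_word[OF ext_uq_rep qpow_word_closed])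
  also have "\<dots> = prod_list (map (\<lambda>i. wt_op N (\<lambda>x. if x = i then \<alpha> i else 0)) [1..<N + 1])"
    unfolding qpow_word_syllables word_op_concat map_map
    by (simp only: o_def syl)
  also have "\<dots> = wt_op N (\<Sum>i\<in>{1..<N + 1}. (\<lambda>x. if x = i then \<alpha> i else 0))"
    unfolding wt_op_prod_list by (simp only: interv_sum_list_conv_sum_set_nat set_upt)
  also have "\<dots> = wt_op N \<alpha>"
    by (rule wt_op_cong) (simp add: sum_fun_apply)
  finally show "ext_map N (qpow N \<alpha>) = wt_op N \<alpha>" .
qed

lemma ext_map_gens:
  assumes "i \<in> {1..<N}"
  shows "ext_map N (e_gen N i) = hop i (i + 1)" "ext_map N (f_gen N i) = hop (i + 1) i"
    "e_gen N i \<in> carrier (Uq N)" "f_gen N i \<in> carrier (Uq N)"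
  using uq_rep.rep_map_gens[OF ext_uq_rep, folded ext_map_def] assms
  by (auto simp: e_gen_def f_gen_def intro!: Uq_word_closed)

lemma ext_map_e_string:
  assumes "a \<ge> 1" "a + d < N"
  shows "ext_map N (e_string N a d) = hop a (a + d + 1) \<and> e_string N a d \<in> carrier (Uq N)"
  using assms
proof (induction d arbitrary: a)
  case 0
  then show ?case by (simp add: ext_map_gens)
next
  case (Suc d)
  have IH: "ext_map N (e_string N (Suc a) d) = hop (Suc a) (Suc a + d + 1)"
    "e_string N (Suc a) d \<in> carrier (Uq N)" using Suc.IH[of "Suc a"] Suc.prems by auto
  have a: "a \<in> {1..<N}" using Suc.prems by simp
  show ?case
    using alg_map_commutator[OF assoc_algebra_Uq alg_map_ext_map ext_map_gens(3)[OF a] IH(2)]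
    by (simp add: IH(1) ext_map_gens(1)[OF a] hop_commutator)
qed

lemma ext_map_f_string:
  assumes "a \<ge> 1" "a + d < N"
  shows "ext_map N (f_string N a d) = hop (a + d + 1) a \<and> f_string N a d \<in> carrier (Uq N)"
  using assms
proof (induction d arbitrary: a)
  case 0
  then show ?case by (simp add: ext_map_gens)
next
  case (Suc d)
  have IH: "ext_map N (f_string N (Suc a) d) = hop (Suc a + d + 1) (Suc a)"
    "f_string N (Suc a) d \<in> carrier (Uq N)" using Suc.IH[of "Suc a"] Suc.prems by auto
  have a: "a \<in> {1..<N}" using Suc.prems by simp
  show ?case
    using alg_map_commutator[OF assoc_algebra_Uq alg_map_ext_map IH(2) ext_map_gens(4)[OF a]]
    by (simp add: IH(1) ext_map_gens(2)[OF a] hop_commutator)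
qed

lemma ext_map_qpow_list:
  "ext_map N (list_prod (Uq N) (map (\<lambda>j. qpow N (\<beta> j)) [a..<b])) = wt_op N (\<Sum>j\<in>{a..<b}. \<beta> j)"
  "list_prod (Uq N) (map (\<lambda>j. qpow N (\<beta> j)) [a..<b]) \<in> carrier (Uq N)"
proof -
  note lp = alg_map_list_prod[OF assoc_algebra_Uq alg_map_ext_map, of "map (\<lambda>j. qpow N (\<beta> j))
      [a..<b]" N]
  have "set (map (\<lambda>j. qpow N (\<beta> j)) [a..<b]) \<subseteq> carrier (Uq N)" by (auto intro: qpow_closed)
  note lp = lp[OF this]
  show "list_prod (Uq N) (map (\<lambda>j. qpow N (\<beta> j)) [a..<b]) \<in> carrier (Uq N)" by (rule lp(2))
  show "ext_map N (list_prod (Uq N) (map (\<lambda>j. qpow N (\<beta> j)) [a..<b])) = wt_op N (\<Sum>j\<in>{a..<b}. \<beta> j)"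
    unfolding lp(1) map_map o_def ext_map_qpow wt_op_prod_list
    by (simp only: interv_sum_list_conv_sum_set_nat set_upt)
qed

lemma ext_map_sum:
  assumes "finite J" "\<And>j. j \<in> J \<Longrightarrow> x j \<in> carrier (Uq N)" "\<And>j. j \<in> J \<Longrightarrow> y j \<in> carrier (Uq N)"
  shows "ext_map N (\<Oplus>\<^bsub>Uq N\<^esub>j\<in>J. x j \<otimes>\<^bsub>Uq N\<^esub> y j) = (\<Sum>j\<in>J. ext_map N (x j) * ext_map N (y j))"
    "(\<Oplus>\<^bsub>Uq N\<^esub>j\<in>J. x j \<otimes>\<^bsub>Uq N\<^esub> y j) \<in> carrier (Uq N)"
proof -
  interpret assoc_algebra Cq "Uq N" by (rule assoc_algebra_Uq)
  have mem: "x j \<otimes>\<^bsub>Uq N\<^esub> y j \<in> carrier (Uq N)" if "j \<in> J" for j using assms that by simp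
  show "(\<Oplus>\<^bsub>Uq N\<^esub>j\<in>J. x j \<otimes>\<^bsub>Uq N\<^esub> y j) \<in> carrier (Uq N)"
    by (rule alg_map_finsum(2)[OF assoc_algebra_Uq alg_map_ext_map assms(1)]) (rule mem)
  have "ext_map N (\<Oplus>\<^bsub>Uq N\<^esub>j\<in>J. x j \<otimes>\<^bsub>Uq N\<^esub> y j) = (\<Sum>j\<in>J. ext_map N (x j \<otimes>\<^bsub>Uq N\<^esub> y j))"
    by (rule alg_map_finsum(1)[OF assoc_algebra_Uq alg_map_ext_map assms(1)]) (rule mem)
  then show "ext_map N (\<Oplus>\<^bsub>Uq N\<^esub>j\<in>J. x j \<otimes>\<^bsub>Uq N\<^esub> y j) = (\<Sum>j\<in>J. ext_map N (x j) * ext_map N (y j))"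
    using assms alg_map_ext_map[of N] by (auto simp: alg_map_def intro!: sum.cong)
qed

section \<open>The commuting actions\<close>

text \<open>Row \<open>i\<close> counts from 1 and column \<open>j\<close> from 0, so this site is
  the tensor of the \<open>i\<close>-th and the \<open>(j + 1)\<close>-st basis vector; the right
  generator with index \<open>l\<close> connects the columns \<open>l - 1\<close> and
  \<open>l\<close>.\<close>

abbreviation ix :: "nat \<Rightarrow> nat \<Rightarrow> nat \<Rightarrow> nat" where
  "ix m i j \<equiv> j * m + i"

lemma ix_bounds:
  assumes "i \<in> {1..m}" "j < n"
  shows "ix m i j \<in> {1..m * n}"
proof -
  have "j * m + i \<le> Suc j * m" using assms by simp
  also have "\<dots> \<le> n * m" using assms by (intro mult_le_mono1) simp
  finally show ?thesis using assms by (simp add: mult.commute)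
qed

lemma ix_eq_iff:
  assumes "i \<in> {1..m}" "i' \<in> {1..m}"
  shows "ix m i j = ix m i' j' \<longleftrightarrow> i = i' \<and> j = j'"
proof
  assume "ix m i j = ix m i' j'"
  then have eq: "j * m + (i - 1) = j' * m + (i' - 1)" using assms by auto
  have lt: "i - 1 < m" "i' - 1 < m" "m > 0" using assms by auto
  have "(j * m + (i - 1)) div m = j" "(j' * m + (i' - 1)) div m = j'"
    "(j * m + (i - 1)) mod m = i - 1" "(j' * m + (i' - 1)) mod m = i' - 1"
    using lt by simp_all
  then have "j = j'" "i - 1 = i' - 1" using eq by simp_all
  then show "i = i' \<and> j = j'" using assms by auto
qed simp

abbreviation left_E :: "nat \<Rightarrow> nat \<Rightarrow> nat \<Rightarrow> nat set linop" where
  "left_E m n \<equiv> \<lambda>i. grid_op (m * n) {..<n} (<) (ix m i) (ix m (i + 1))"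

abbreviation left_F :: "nat \<Rightarrow> nat \<Rightarrow> nat \<Rightarrow> nat set linop" where
  "left_F m n \<equiv> \<lambda>i. grid_op (m * n) {..<n} (>) (ix m (i + 1)) (ix m i)"

abbreviation left_wt :: "nat \<Rightarrow> nat \<Rightarrow> nat \<Rightarrow> weight" where
  "left_wt m n \<equiv> \<lambda>i. \<Sum>j<n. eps (ix m i j)"

text \<open>\<open>beta_wt\<close> collects the rows after \<open>i\<close> and
  \<open>alpha_wt\<close> those before it, so the orders are opposite to those of the left
  operators.\<close>

abbreviation right_E :: "nat \<Rightarrow> nat \<Rightarrow> nat \<Rightarrow> nat set linop" where
  "right_E m n \<equiv> \<lambda>l. grid_op (m * n) {1..m} (>) (\<lambda>i. ix m i (l - 1)) (\<lambda>i. ix m i l)"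

abbreviation right_F :: "nat \<Rightarrow> nat \<Rightarrow> nat \<Rightarrow> nat set linop" where
  "right_F m n \<equiv> \<lambda>l. grid_op (m * n) {1..m} (<) (\<lambda>i. ix m i l) (\<lambda>i. ix m i (l - 1))"

abbreviation right_wt :: "nat \<Rightarrow> nat \<Rightarrow> weight" where
  "right_wt m \<equiv> \<lambda>l. \<Sum>i\<in>{1..m}. eps (ix m i (l - 1))"

lemma ext_map_K_left:
  "ext_map (m * n) (K_left m n i) = wt_op (m * n) (left_wt m n i)"
  "K_left m n i \<in> carrier (Uq (m * n))"
  unfolding K_left_def by (simp_all only: ext_map_qpow_list atLeast0LessThan)

lemma ext_map_K_right:
  "ext_map (m * n) (K_right m n l) = wt_op (m * n) (right_wt m l)"
  "K_right m n l \<in> carrier (Uq (m * n))"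
proof -
  have "{1..<m + 1} = {1..m}" by auto
  then show "ext_map (m * n) (K_right m n l) = wt_op (m * n) (right_wt m l)"
    "K_right m n l \<in> carrier (Uq (m * n))"
    unfolding K_right_def by (simp_all only: ext_map_qpow_list)
qed

lemma ext_map_E_left:
  assumes i: "i \<in> {1..<m}"
  shows "ext_map (m * n) (E_left m n i) = left_E m n i"
    "E_left m n i \<in> carrier (Uq (m * n))"
proof -
  let ?N = "m * n"
  have g: "(k - 1) * m + i \<in> {1..<?N}" if "k \<in> {1..n}" for k
  proof -
    have "k - 1 < n" using that by auto
    then show ?thesis using ix_bounds[of "i + 1" m "k - 1" n] i by auto
  qed
  note s = ext_map_sum[of "{1..n}"
      "\<lambda>k. list_prod (Uq ?N) (map (\<lambda>j. qpow ?N (- hwt (j * m + i))) [0..<k - 1])" ?N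
      "\<lambda>k. e_gen ?N ((k - 1) * m + i)", OF finite_atLeastAtMost ext_map_qpow_list(2)
          ext_map_gens(3)[OF g]]
  show "E_left m n i \<in> carrier (Uq ?N)"
    unfolding E_left_def by (rule s(2))
  have "ext_map ?N (E_left m n i) = (\<Sum>k\<in>{1..n}. wt_op ?N (\<Sum>j\<in>{0..<k - 1}. - hwt (j * m + i))
      * hop ((k - 1) * m + i) ((k - 1) * m + i + 1))"
    unfolding E_left_def
  proof (subst s(1))
    show "(\<Sum>k\<in>{1..n}. ext_map ?N (list_prod (Uq ?N)
        (map (\<lambda>j. qpow ?N (- hwt (j * m + i))) [0..<k - 1]))
        * ext_map ?N (e_gen ?N ((k - 1) * m + i)))
      = (\<Sum>k\<in>{1..n}. wt_op ?N (\<Sum>j\<in>{0..<k - 1}. - hwt (j * m + i)) * hop ((k - 1) * m + i)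
          ((k - 1) * m + i + 1))"
      by (rule sum.cong[OF refl]) (simp only: ext_map_qpow_list(1) ext_map_gens(1)[OF g])
  qed
  also have "\<dots> = left_E m n i"
    unfolding grid_op_def
  proof (rule sum.reindex_bij_witness[of _ Suc "\<lambda>k. k - 1"])
    fix k assume k: "k \<in> {1..n}"
    have "{j' \<in> {..<n}. j' < k - 1} = {0..<k - 1}" using k by auto
    then have "grid_wt {..<n} (<) (ix m i) (ix m (i + 1)) (k - 1) =
        (\<Sum>j\<in>{0..<k - 1}. - hwt (j * m + i))"
      by (simp add: grid_wt_def hwt_def add.assoc)
    then show "wt_op ?N (grid_wt {..<n} (<) (ix m i) (ix m (i + 1)) (k - 1)) * hop (ix m i (k - 1))
        (ix m (i + 1) (k - 1))
        = wt_op ?N (\<Sum>j\<in>{0..<k - 1}. - hwt (j * m + i)) * hop ((k - 1) * m + i)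
            ((k - 1) * m + i + 1)"
      by (simp only: add.assoc)
  qed auto
  finally show "ext_map ?N (E_left m n i) = left_E m n i" .
qed

lemma ext_map_F_left:
  assumes i: "i \<in> {1..<m}"
  shows "ext_map (m * n) (F_left m n i) = left_F m n i"
    "F_left m n i \<in> carrier (Uq (m * n))"
proof -
  let ?N = "m * n"
  have g: "(k - 1) * m + i \<in> {1..<?N}" if "k \<in> {1..n}" for k
  proof -
    have "k - 1 < n" using that by auto
    then show ?thesis using ix_bounds[of "i + 1" m "k - 1" n] i by auto
  qed
  note s = ext_map_sum[of "{1..n}"
      "\<lambda>k. list_prod (Uq ?N) (map (\<lambda>j. qpow ?N (hwt (j * m + i))) [k..<n])" ?N
      "\<lambda>k. f_gen ?N ((k - 1) * m + i)", OF finite_atLeastAtMost ext_map_qpow_list(2)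
          ext_map_gens(4)[OF g]]
  show "F_left m n i \<in> carrier (Uq ?N)"
    unfolding F_left_def by (rule s(2))
  have "ext_map ?N (F_left m n i) = (\<Sum>k\<in>{1..n}. wt_op ?N (\<Sum>j\<in>{k..<n}. hwt (j * m + i))
      * hop ((k - 1) * m + i + 1) ((k - 1) * m + i))"
    unfolding F_left_def
  proof (subst s(1))
    show "(\<Sum>k\<in>{1..n}. ext_map ?N (list_prod (Uq ?N) (map (\<lambda>j. qpow ?N (hwt (j * m + i))) [k..<n]))
        * ext_map ?N (f_gen ?N ((k - 1) * m + i)))
      = (\<Sum>k\<in>{1..n}. wt_op ?N (\<Sum>j\<in>{k..<n}. hwt (j * m + i)) * hop ((k - 1) * m + i + 1)
          ((k - 1) * m + i))"
      by (rule sum.cong[OF refl]) (simp only: ext_map_qpow_list(1) ext_map_gens(2)[OF g])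
  qed
  also have "\<dots> = left_F m n i"
    unfolding grid_op_def
  proof (rule sum.reindex_bij_witness[of _ Suc "\<lambda>k. k - 1"])
    fix k assume k: "k \<in> {1..n}"
    have "{j' \<in> {..<n}. j' > k - 1} = {k..<n}" using k by auto
    then have "grid_wt {..<n} (>) (ix m (i + 1)) (ix m i) (k - 1) = (\<Sum>j\<in>{k..<n}. hwt (j * m + i))"
      by (simp add: grid_wt_def hwt_def add.assoc)
    then show "wt_op ?N (grid_wt {..<n} (>) (ix m (i + 1)) (ix m i) (k - 1)) * hop
        (ix m (i + 1) (k - 1)) (ix m i (k - 1))
        = wt_op ?N (\<Sum>j\<in>{k..<n}. hwt (j * m + i)) * hop ((k - 1) * m + i + 1) ((k - 1) * m + i)"
      by (simp only: add.assoc)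
  qed auto
  finally show "ext_map ?N (F_left m n i) = left_F m n i" .
qed

text \<open>A string of \<open>m\<close> generators starting in column \<open>l - 1\<close> bridges
  exactly \<open>m\<close> sites and lands in the same row of column \<open>l\<close>;
  \<open>m - 1\<close> counts its nested commutators.\<close>

lemma ext_map_root:
  assumes l: "l \<in> {1..<n}" and i: "i \<in> {1..m}"
  shows "ext_map (m * n) (e_root (m * n) ((l - 1) * m + i) (l * m + i - 1)) = hop (ix m i (l - 1))
      (ix m i l)"
    "e_root (m * n) ((l - 1) * m + i) (l * m + i - 1) \<in> carrier (Uq (m * n))"
    "ext_map (m * n) (f_root (m * n) ((l - 1) * m + i) (l * m + i - 1)) = hop (ix m i l)
        (ix m i (l - 1))"
    "f_root (m * n) ((l - 1) * m + i) (l * m + i - 1) \<in> carrier (Uq (m * n))"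
proof -
  obtain l' where l': "l = Suc l'" using l by (cases l) auto
  have d: "l * m + i - 1 - ((l - 1) * m + i) = m - 1" "(l - 1) * m + i + (m - 1) + 1 = l * m + i"
    using i by (auto simp: l')
  have b: "(l - 1) * m + i \<ge> 1" "(l - 1) * m + i + (m - 1) < m * n"
    using ix_bounds[OF i, of l n] l d(2) i by auto
  show "ext_map (m * n) (e_root (m * n) ((l - 1) * m + i) (l * m + i - 1)) = hop (ix m i (l - 1))
      (ix m i l)"
    "e_root (m * n) ((l - 1) * m + i) (l * m + i - 1) \<in> carrier (Uq (m * n))"
    unfolding e_root_def using ext_map_e_string[OF b] by (simp_all only: d)
  show "ext_map (m * n) (f_root (m * n) ((l - 1) * m + i) (l * m + i - 1)) = hop (ix m i l)
      (ix m i (l - 1))"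
    "f_root (m * n) ((l - 1) * m + i) (l * m + i - 1) \<in> carrier (Uq (m * n))"
    unfolding f_root_def using ext_map_f_string[OF b] by (simp_all only: d)
qed

lemma ext_map_E_right:
  assumes l: "l \<in> {1..<n}"
  shows "ext_map (m * n) (E_right m n l) = right_E m n l"
    "E_right m n l \<in> carrier (Uq (m * n))"
proof -
  let ?N = "m * n"
  note s = ext_map_sum[of "{1..m}" "\<lambda>i. qpow ?N (beta_wt m i l)" ?N
      "\<lambda>i. e_root ?N ((l - 1) * m + i) (l * m + i - 1)", OF finite_atLeastAtMost qpow_closed
          ext_map_root(2)[OF l]]
  show "E_right m n l \<in> carrier (Uq ?N)" unfolding E_right_def by (rule s(2))
  show "ext_map ?N (E_right m n l) = right_E m n l"
    unfolding E_right_def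
  proof (subst s(1))
    show "(\<Sum>i\<in>{1..m}. ext_map ?N (qpow ?N (beta_wt m i l)) * ext_map ?N
        (e_root ?N ((l - 1) * m + i) (l * m + i - 1)))
      = right_E m n l"
      unfolding grid_op_def
    proof (rule sum.cong[OF refl])
      fix i assume i: "i \<in> {1..m}"
      have "{i' \<in> {1..m}. i' > i} = {i + 1..m}" using i by auto
      then have "grid_wt {1..m} (>) (\<lambda>i. ix m i (l - 1)) (\<lambda>i. ix m i l) i = beta_wt m i l"
        by (simp only: grid_wt_def beta_wt_def)
      then show "ext_map ?N (qpow ?N (beta_wt m i l)) * ext_map ?N
          (e_root ?N ((l - 1) * m + i) (l * m + i - 1))
        = wt_op ?N (grid_wt {1..m} (>) (\<lambda>i. ix m i (l - 1)) (\<lambda>i. ix m i l) i) * hop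
            (ix m i (l - 1)) (ix m i l)"
        by (simp only: ext_map_qpow ext_map_root(1)[OF l i])
    qed
  qed
qed

lemma ext_map_F_right:
  assumes l: "l \<in> {1..<n}"
  shows "ext_map (m * n) (F_right m n l) = right_F m n l"
    "F_right m n l \<in> carrier (Uq (m * n))"
proof -
  let ?N = "m * n"
  note s = ext_map_sum[of "{1..m}" "\<lambda>i. qpow ?N (alpha_wt m i l)" ?N
      "\<lambda>i. f_root ?N ((l - 1) * m + i) (l * m + i - 1)", OF finite_atLeastAtMost qpow_closed
          ext_map_root(4)[OF l]]
  show "F_right m n l \<in> carrier (Uq ?N)" unfolding F_right_def by (rule s(2))
  show "ext_map ?N (F_right m n l) = right_F m n l"
    unfolding F_right_def
  proof (subst s(1))
    show "(\<Sum>i\<in>{1..m}. ext_map ?N (qpow ?N (alpha_wt m i l)) * ext_map ?N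
        (f_root ?N ((l - 1) * m + i) (l * m + i - 1)))
      = right_F m n l"
      unfolding grid_op_def
    proof (rule sum.cong[OF refl])
      fix i assume i: "i \<in> {1..m}"
      have "{i' \<in> {1..m}. i' < i} = {1..<i}" using i by auto
      then have "grid_wt {1..m} (<) (\<lambda>i. ix m i l) (\<lambda>i. ix m i (l - 1)) i = alpha_wt m i l"
        by (simp only: grid_wt_def alpha_wt_def)
      then show "ext_map ?N (qpow ?N (alpha_wt m i l)) * ext_map ?N
          (f_root ?N ((l - 1) * m + i) (l * m + i - 1))
        = wt_op ?N (grid_wt {1..m} (<) (\<lambda>i. ix m i l) (\<lambda>i. ix m i (l - 1)) i) * hop (ix m i l)
            (ix m i (l - 1))"
        by (simp only: ext_map_qpow ext_map_root(3)[OF l i])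
    qed
  qed
qed

section \<open>The two representations and their commutation\<close>

lemma left_rep:
  "uq_rep m (left_E m n)
    (left_F m n)
    (\<lambda>i. wt_op (m * n) (left_wt m n i)) (\<lambda>i. wt_op (m * n) (- (left_wt m n i)))"
  by (rule grid_rep) (use ix_bounds ix_eq_iff in blast)+

lemma grid_op_reverse:
  fixes m :: nat
  assumes "\<And>j j'. j \<in> {1..m} \<Longrightarrow> j' \<in> {1..m} \<Longrightarrow> lt j' j \<longleftrightarrow> lt' (m - j') (m - j)"
  shows "grid_op M {1..m} lt a b = grid_op M {..<m} lt' (\<lambda>j. a (m - j)) (\<lambda>j. b (m - j))"
  unfolding grid_op_def
proof (rule sum.reindex_bij_witness[of _ "\<lambda>j. m - j" "\<lambda>j. m - j"])
  fix j assume j: "j \<in> {1..m}"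
  have "grid_wt {1..m} lt a b j = grid_wt {..<m} lt' (\<lambda>j. a (m - j)) (\<lambda>j. b (m - j)) (m - j)"
    unfolding grid_wt_def
    by (rule sum.reindex_bij_witness[of _ "\<lambda>j. m - j" "\<lambda>j. m - j"])
      (use j in \<open>auto simp: assms\<close>)
  then show "wt_op M (grid_wt {..<m} lt' (\<lambda>j. a (m - j)) (\<lambda>j. b (m - j)) (m - j)) * hop
      (a (m - (m - j))) (b (m - (m - j)))
      = wt_op M (grid_wt {1..m} lt a b j) * hop (a j) (b j)"
    using j by simp
qed auto

text \<open>The same grid with rows and columns exchanged. Enumerating the rows backwards by
  \<open>m - j\<close> turns the descending order on \<open>{1..m}\<close> into the ascending order
  on \<open>{..<m}\<close> that \<open>grid_rep\<close> expects.\<close>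

lemma right_rep:
  "uq_rep n (right_E m n)
    (right_F m n)
    (\<lambda>l. wt_op (m * n) (right_wt m l)) (\<lambda>l. wt_op (m * n) (- (right_wt m l)))"
proof -
  let ?ix = "\<lambda>l j. ix m (m - j) (l - 1)"
  have "uq_rep n (\<lambda>l. grid_op (m * n) {..<m} (<) (?ix l) (?ix (l + 1)))
    (\<lambda>l. grid_op (m * n) {..<m} (>) (?ix (l + 1)) (?ix l))
    (\<lambda>l. wt_op (m * n) (\<Sum>j<m. eps (?ix l j))) (\<lambda>l. wt_op (m * n) (- (\<Sum>j<m. eps (?ix l j))))"
  proof (rule grid_rep)
    fix l j assume lj: "l \<in> {1..n}" "j < m"
    then show "?ix l j \<in> {1..m * n}" by (intro ix_bounds) auto
    fix l' j' assume l'j': "l' \<in> {1..n}" "j' < m" "?ix l j = ?ix l' j'"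
    have "m - j \<in> {1..m}" "m - j' \<in> {1..m}" using lj l'j' by auto
    then have "m - j = m - j'" "l - 1 = l' - 1" using ix_eq_iff l'j'(3) by blast+
    then show "l = l' \<and> j = j'" using lj l'j' by auto
  qed
  moreover have "grid_op (m * n) {1..m} (>) a b = grid_op (m * n) {..<m} (<) (\<lambda>j. a (m - j))
      (\<lambda>j. b (m - j))"
    "grid_op (m * n) {1..m} (<) a b = grid_op (m * n) {..<m} (>) (\<lambda>j. a (m - j)) (\<lambda>j. b (m - j))"
        for a b
    by (rule grid_op_reverse; auto)+
  moreover have "(right_wt m l) = (\<Sum>j<m. eps (?ix l j))" for l
    by (rule sum.reindex_bij_witness[of _ "\<lambda>j. m - j" "\<lambda>j. m - j"]) auto
  ultimately show ?thesis
    by simp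
qed

lemma ix_le: "i \<le> m \<Longrightarrow> j < n \<Longrightarrow> ix m i j \<le> m * n" "i < m \<Longrightarrow> j < n \<Longrightarrow> Suc (ix m i j) \<le> m * n"
  using ix_bounds[of i m j n] ix_bounds[of "Suc i" m j n] by (cases i; auto)+

text \<open>All four are instances of \<open>grid_op_commute\<close>. For \<open>E\<close> with
  \<open>E\<close> the orders along columns and rows are opposite, as required there; for
  \<open>F\<close> with \<open>F\<close> both pairs of neighbours are exchanged. In the mixed cases
  the two orders agree, and transposing the grid restores the hypotheses, with the right operator as
  the first factor.\<close>

lemma left_right_commute:
  assumes i: "i \<in> {1..<m}" and l: "l \<in> {1..<n}"
  shows "left_E m n i * right_E m n l
      = right_E m n l * left_E m n i"
    "left_F m n i * right_F m n l
      = right_F m n l * left_F m n i"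
    "left_E m n i * right_F m n l
      = right_F m n l * left_E m n i"
    "left_F m n i * right_E m n l
      = right_E m n l * left_F m n i"
proof -
  have i': "i \<in> {1..m}" "i + 1 \<in> {1..m}" "i \<noteq> i + 1" and l': "l - 1 \<in> {..<n}" "l \<in> {..<n}" "l - 1 \<noteq>
      l"
    using i l by auto
  note b = ix_le and e = ix_eq_iff
  show "left_E m n i * right_E m n l
      = right_E m n l * left_E m n i"
    by (rule grid_op_commute[where ix = "ix m", OF _ _ _ _ i' l']) (use i l in \<open>auto simp: e b\<close>)
  show "left_F m n i * right_F m n l
      = right_F m n l * left_F m n i"
    by (rule grid_op_commute[where ix = "ix m", OF _ _ _ _ i'(2,1) i'(3)[symmetric] l'(2,1)
        l'(3)[symmetric]])
      (use i l in \<open>auto simp: e b\<close>)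
  show "left_E m n i * right_F m n l
      = right_F m n l * left_E m n i"
    by (rule grid_op_commute[where ix = "\<lambda>j p. ix m p j", OF _ _ _ _ l'(2,1) l'(3)[symmetric] i',
        symmetric])
      (use i l in \<open>auto simp: e b\<close>)
  show "left_F m n i * right_E m n l
      = right_E m n l * left_F m n i"
    by (rule grid_op_commute[where ix = "\<lambda>j p. ix m p j", OF _ _ _ _ l' i'(2,1) i'(3)[symmetric],
        symmetric])
      (use i l in \<open>auto simp: e b\<close>)
qed

lemma left_wt_value:
  assumes "i \<in> {1..m}" "p \<in> {1..m}" "j < n"
  shows "(\<Sum>j'<n. eps (ix m i j')) (ix m p j) = of_bool (p = i)"
proof -
  have "(\<Sum>j'<n. eps (ix m i j')) (ix m p j) = (\<Sum>j'<n. if j' = j then of_bool (p = i) else 0)"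
    unfolding sum_fun_apply by (rule sum.cong)
        (use assms ix_eq_iff[of i m p] in \<open>auto simp: eps_apply\<close>)
  then show ?thesis using assms by simp
qed

lemma right_wt_value:
  assumes "p \<in> {1..m}"
  shows "(\<Sum>i\<in>{1..m}. eps (ix m i l)) (ix m p j) = of_bool (j = l)"
proof -
  have "(\<Sum>i\<in>{1..m}. eps (ix m i l)) (ix m p j) = (\<Sum>i\<in>{1..m}. if i = p then of_bool (j = l) else 0)"
    unfolding sum_fun_apply by (rule sum.cong)
        (use assms ix_eq_iff[of _ m p] in \<open>auto simp: eps_apply\<close>)
  then show ?thesis using assms by simp
qed

lemma stab_sum: "(\<And>j. j \<in> J \<Longrightarrow> stab B (f j)) \<Longrightarrow> stab B (\<Sum>j\<in>J. f j)"
  by (induction J rule: infinite_finite_induct)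
    (use stab_simps(1)[of B 0] in \<open>auto simp: scal_simps intro: stab_simps\<close>)

lemma stab_grid_op:
  assumes "\<And>j. j \<in> J \<Longrightarrow> a j \<in> {1..N} \<and> b j \<in> {1..N}"
  shows "stab (ext_basis N k) (grid_op N J lt a b)"
  unfolding grid_op_def using assms by (blast intro: stab_sum stab_simps stab_wt_op stab_hop)

definition left_map :: "nat \<Rightarrow> nat \<Rightarrow> uq \<Rightarrow> nat set linop" where
  "left_map m n = uq_rep.rep_map (left_E m n)
    (left_F m n)
    (\<lambda>i. wt_op (m * n) (left_wt m n i)) (\<lambda>i. wt_op (m * n) (- (left_wt m n i)))"

definition right_map :: "nat \<Rightarrow> nat \<Rightarrow> uq \<Rightarrow> nat set linop" where
  "right_map m n = uq_rep.rep_map (right_E m n)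
    (right_F m n)
    (\<lambda>l. wt_op (m * n) (right_wt m l)) (\<lambda>l. wt_op (m * n) (- (right_wt m l)))"

text \<open>Induction over both images reduces this to generators. Right hops stay within a row,
  where left weights are constant; left hops stay within a column, where right weights are
  constant.\<close>

lemma left_map_right_map_commute:
  assumes X: "X \<in> carrier (Uq m)" and Y: "Y \<in> carrier (Uq n)"
  shows "left_map m n X * right_map m n Y = right_map m n Y * left_map m n X"
proof -
  let ?N = "m * n"
  have scal: "scal r * T = T * scal r" for r and T :: "nat set linop" by
      (rule scal_central[symmetric])
  have mult: "S * T * U = U * (S * T)" if "S * U = U * S" "T * U = U * T" for S T U :: "nat set
      linop"
    using that by (metis mult.assoc)
  have mult_r: "U * (S * T) = S * T * U" if "U * S = S * U" "U * T = T * U" for S T U :: "nat set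
      linop"
    using that by (metis mult.assoc)
  have wr: "wt_op ?N \<alpha> * right_map m n Y = right_map m n Y * wt_op ?N \<alpha>"
    if \<alpha>: "\<And>p j j'. p \<in> {1..m} \<Longrightarrow> j < n \<Longrightarrow> j' < n \<Longrightarrow> \<alpha> (ix m p j) = \<alpha> (ix m p j')" for \<alpha>
    unfolding right_map_def
  proof (rule uq_rep.rep_map_induct[OF right_rep Y, where P = "\<lambda>T. wt_op ?N \<alpha> * T = T * wt_op ?N
      \<alpha>"])
    fix l assume l: "l \<in> {1..<n}"
    then have "l - 1 < n" "l < n" by auto
    then have *: "ix m p (l - 1) \<in> {1..?N}" "ix m p l \<in> {1..?N}" "\<alpha> (ix m p (l - 1)) = \<alpha> (ix m p l)"
      if "p \<in> {1..m}" for p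
      using that by (blast intro: ix_bounds \<alpha>)+
    show "wt_op ?N \<alpha> * right_E m n l
        = right_E m n l * wt_op ?N \<alpha>"
      by (rule wt_op_grid_commute[symmetric]) (simp only: *)
    show "wt_op ?N \<alpha> * right_F m n l
        = right_F m n l * wt_op ?N \<alpha>"
      by (rule wt_op_grid_commute[symmetric]) (simp only: *)
  qed (simp_all only: scal wt_op_commute[of ?N \<alpha>] distrib_left distrib_right mult_r)
  have comm: "G * right_map m n Y = right_map m n Y * G"
    if G: "\<And>\<beta>. (\<And>p p' j. p \<in> {1..m} \<Longrightarrow> p' \<in> {1..m} \<Longrightarrow> j < n \<Longrightarrow> \<beta> (ix m p j) = \<beta> (ix m p' j)) \<Longrightarrow>
        G * wt_op ?N \<beta> = wt_op ?N \<beta> * G"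
      "\<And>l. l \<in> {1..<n} \<Longrightarrow> G * right_E m n l
        = right_E m n l * G"
      "\<And>l. l \<in> {1..<n} \<Longrightarrow> G * right_F m n l
        = right_F m n l * G"
    for G
    unfolding right_map_def
  proof (rule uq_rep.rep_map_induct[OF right_rep Y, where P = "\<lambda>T. G * T = T * G"])
    fix l
    show "G * wt_op ?N (right_wt m l) = wt_op ?N (right_wt m l) * G"
      by (rule G(1)) (simp only: right_wt_value)
    show "G * wt_op ?N (- (right_wt m l)) = wt_op ?N (- (right_wt m l)) * G"
      by (rule G(1)) (simp only: right_wt_value uminus_apply)
  qed (use G(2,3) in \<open>simp_all only: scal distrib_left distrib_right mult_r\<close>)
  show ?thesis
    unfolding left_map_def
  proof (rule uq_rep.rep_map_induct[OF left_rep X, where P = "\<lambda>T. T * right_map m n Y = right_map m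
      n Y * T"])
    fix i assume i: "i \<in> {1..<m}"
    then have i': "i \<in> {1..m}" "i + 1 \<in> {1..m}" by auto
    note lr = left_right_commute[OF i]
    show "left_E m n i * right_map m n Y
        = right_map m n Y * left_E m n i"
    proof (rule comm[OF _ lr(1,3)])
      fix \<beta> :: weight assume "\<And>p p' j. p \<in> {1..m} \<Longrightarrow> p' \<in> {1..m} \<Longrightarrow> j < n \<Longrightarrow> \<beta> (ix m p j) = \<beta>
          (ix m p' j)"
      then show "left_E m n i * wt_op ?N \<beta>
          = wt_op ?N \<beta> * left_E m n i"
        using i' by (intro wt_op_grid_commute) (blast intro: ix_bounds)
    qed
    show "left_F m n i * right_map m n Y
        = right_map m n Y * left_F m n i"
    proof (rule comm[OF _ lr(4,2)])
      fix \<beta> :: weight assume "\<And>p p' j. p \<in> {1..m} \<Longrightarrow> p' \<in> {1..m} \<Longrightarrow> j < n \<Longrightarrow> \<beta> (ix m p j) = \<beta>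
          (ix m p' j)"
      then show "left_F m n i * wt_op ?N \<beta>
          = wt_op ?N \<beta> * left_F m n i"
        using i' by (intro wt_op_grid_commute) (blast intro: ix_bounds)
    qed
  next
    fix i assume i: "i \<in> {1..m}"
    show "wt_op ?N (left_wt m n i) * right_map m n Y = right_map m n Y * wt_op ?N (left_wt m n i)"
      by (rule wr) (simp only: left_wt_value[OF i])
    show "wt_op ?N (- (left_wt m n i)) * right_map m n Y = right_map m n Y * wt_op ?N
        (- (left_wt m n i))"
      by (rule wr) (simp only: left_wt_value[OF i] uminus_apply)
  qed (simp_all only: scal distrib_left distrib_right mult)
qed

lemma dual_action:
  "\<exists>act. alg_module Cq (tensor_algebra (Uq m) (Uq n)) (ext_space (m * n) k) act \<and>
     (\<forall>v\<in>carrier (ext_space (m * n) k).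
       (\<forall>i\<in>{1..m}.
          act (pure_tensor (Uq m) (Uq n) (qpow m (eps i)) \<one>\<^bsub>Uq n\<^esub>) v
            = ext_act (m * n) k (K_left m n i) v) \<and>
       (\<forall>i\<in>{1..<m}.
          act (pure_tensor (Uq m) (Uq n) (e_gen m i) \<one>\<^bsub>Uq n\<^esub>) v
            = ext_act (m * n) k (E_left m n i) v \<and>
          act (pure_tensor (Uq m) (Uq n) (f_gen m i) \<one>\<^bsub>Uq n\<^esub>) v
            = ext_act (m * n) k (F_left m n i) v) \<and>
       (\<forall>l\<in>{1..n}.
          act (pure_tensor (Uq m) (Uq n) \<one>\<^bsub>Uq m\<^esub> (qpow n (eps l))) v
            = ext_act (m * n) k (K_right m n l) v) \<and>
       (\<forall>l\<in>{1..<n}.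
          act (pure_tensor (Uq m) (Uq n) \<one>\<^bsub>Uq m\<^esub> (e_gen n l)) v
            = ext_act (m * n) k (E_right m n l) v \<and>
          act (pure_tensor (Uq m) (Uq n) \<one>\<^bsub>Uq m\<^esub> (f_gen n l)) v
            = ext_act (m * n) k (F_right m n l) v))"
proof -
  let ?N = "m * n" and ?A = "Uq m" and ?B = "Uq n"
  define \<rho> where "\<rho> = quot_map (lin (\<lambda>(a, b). left_map m n a * right_map m n b))"
  have L: "alg_map ?A (left_map m n)" and R: "alg_map ?B (right_map m n)"
    unfolding left_map_def right_map_def
    by (rule uq_rep.alg_map_rep_map[OF left_rep], rule uq_rep.alg_map_rep_map[OF right_rep])
  note t = tensor_map[OF assoc_algebra_Uq assoc_algebra_Uq L R left_map_right_map_commute, folded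
      \<rho>_def]
  have stab_L: "stab (ext_basis ?N k) (left_map m n a)" if "a \<in> carrier ?A" for a
    unfolding left_map_def
    by (rule uq_rep.rep_map_induct[OF left_rep that, where P = "stab (ext_basis ?N k)"])
      (auto intro!: stab_simps stab_wt_op stab_grid_op simp: ix_le)
  have stab_R: "stab (ext_basis ?N k) (right_map m n b)" if "b \<in> carrier ?B" for b
    unfolding right_map_def
    by (rule uq_rep.rep_map_induct[OF right_rep that, where P = "stab (ext_basis ?N k)"])
      (auto intro!: stab_simps stab_wt_op stab_grid_op simp: ix_le)
  have one: "\<one>\<^bsub>?A\<^esub> \<in> carrier ?A" "\<one>\<^bsub>?B\<^esub> \<in> carrier ?B"
    by (simp_all add: Uq_one Uq_word_closed)
  have one': "left_map m n \<one>\<^bsub>?A\<^esub> = 1" "right_map m n \<one>\<^bsub>?B\<^esub> = 1"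
    using L R by (simp_all add: alg_map_def)
  have alg: "alg_module Cq (tensor_algebra ?A ?B) (ext_space ?N k) (\<lambda>x. apply_op (\<rho> x))"
    unfolding ext_space_def
    by (rule alg_module_alg_map) (use t stab_L stab_R in blast)+
  have left: "\<rho> (pure_tensor ?A ?B a \<one>\<^bsub>?B\<^esub>) = left_map m n a" if "a \<in> carrier ?A" for a
    using t(3)[OF _ _ that one(2)] one' by simp
  have right: "\<rho> (pure_tensor ?A ?B \<one>\<^bsub>?A\<^esub> b) = right_map m n b" if "b \<in> carrier ?B" for b
    using t(3)[OF _ _ one(1) that] one' by simp
  have gens: "e_gen M i \<in> carrier (Uq M)" "f_gen M i \<in> carrier (Uq M)" if "i \<in> {1..<M}" for M i
    using ext_map_gens[OF that] by auto
  note Lg = uq_rep.rep_map_gens[OF left_rep, folded left_map_def]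
    and Rg = uq_rep.rep_map_gens[OF right_rep, folded right_map_def]
  show ?thesis
  proof (intro exI[of _ "\<lambda>x. apply_op (\<rho> x)"] conjI ballI)
    show "alg_module Cq (tensor_algebra ?A ?B) (ext_space ?N k) (\<lambda>x. apply_op (\<rho> x))" by (rule alg)
    fix v assume v: "v \<in> carrier (ext_space ?N k)"
    note ea = ext_act_eq[OF _ v]
    show "apply_op (\<rho> (pure_tensor ?A ?B (qpow m (eps i)) \<one>\<^bsub>?B\<^esub>)) v = ext_act ?N k (K_left m n i) v"
      if i: "i \<in> {1..m}" for i
      by (simp only: left[OF qpow_closed] Lg(3)[OF i] ea[OF ext_map_K_left(2)] ext_map_K_left(1))
    show "apply_op (\<rho> (pure_tensor ?A ?B (e_gen m i) \<one>\<^bsub>?B\<^esub>)) v = ext_act ?N k (E_left m n i) v"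
      if i: "i \<in> {1..<m}" for i
      by (simp only: left[OF gens(1)[OF i]] Lg(1)[OF i] ea[OF ext_map_E_left(2)[OF i]]
          ext_map_E_left(1)[OF i])
    show "apply_op (\<rho> (pure_tensor ?A ?B (f_gen m i) \<one>\<^bsub>?B\<^esub>)) v = ext_act ?N k (F_left m n i) v"
      if i: "i \<in> {1..<m}" for i
      by (simp only: left[OF gens(2)[OF i]] Lg(2)[OF i] ea[OF ext_map_F_left(2)[OF i]]
          ext_map_F_left(1)[OF i])
    show "apply_op (\<rho> (pure_tensor ?A ?B \<one>\<^bsub>?A\<^esub> (qpow n (eps l)))) v = ext_act ?N k (K_right m n l)
        v"
      if l: "l \<in> {1..n}" for l
      by (simp only: right[OF qpow_closed] Rg(3)[OF l] ea[OF ext_map_K_right(2)] ext_map_K_right(1))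
    show "apply_op (\<rho> (pure_tensor ?A ?B \<one>\<^bsub>?A\<^esub> (e_gen n l))) v = ext_act ?N k (E_right m n l) v"
      if l: "l \<in> {1..<n}" for l
      by (simp only: right[OF gens(1)[OF l]] Rg(1)[OF l] ea[OF ext_map_E_right(2)[OF l]]
          ext_map_E_right(1)[OF l])
    show "apply_op (\<rho> (pure_tensor ?A ?B \<one>\<^bsub>?A\<^esub> (f_gen n l))) v = ext_act ?N k (F_right m n l) v"
      if l: "l \<in> {1..<n}" for l
      by (simp only: right[OF gens(2)[OF l]] Rg(2)[OF l] ea[OF ext_map_F_right(2)[OF l]]
          ext_map_F_right(1)[OF l])
  qed
qed

section \<open>Specialization at \<open>q = 1\<close>\<close>

subsection \<open>The classical action in coordinates\<close>

lemma wedge_cong: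
  assumes "\<And>p a. p < k \<Longrightarrow> a \<in> {1..N} \<Longrightarrow> w p a = w' p a"
  shows "wedge N k w d = wedge N k w' d"
proof (cases "d \<in> ext_basis N k")
  case True
  have "w p (sorted_list_of_set d ! \<sigma> p) = w' p (sorted_list_of_set d ! \<sigma> p)"
    if "\<sigma> permutes {..<k}" "p < k" for \<sigma> p
  proof -
    have d: "finite d" "card d = k" "d \<subseteq> {1..N}"
      using True finite_subset[of d "{1..N}"] by (auto simp: ext_basis_def)
    have "\<sigma> p < k" using permutes_in_image[OF that(1), of p] that(2) by simp
    then have "sorted_list_of_set d ! \<sigma> p \<in> d" using d nth_mem[of "\<sigma> p" "sorted_list_of_set d"] by
        simp
    then show ?thesis using assms that(2) d(3) by blast
  qed
  then show ?thesis using True by (auto simp: wedge_def intro!: sum.cong prod.cong)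
qed (simp add: wedge_def)

text \<open>Reindexing the sum over permutations by composition with \<open>\<pi>\<close> restores
  the original products, and the sign of \<open>\<pi>\<close> factors out.\<close>

lemma wedge_permute:
  assumes \<pi>: "\<pi> permutes {..<k}"
  shows "wedge N k (w \<circ> \<pi>) d = of_int (sign \<pi>) * wedge N k w d"
proof (cases "d \<in> ext_basis N k")
  case True
  let ?x = "\<lambda>\<sigma> p. sorted_list_of_set d ! \<sigma> p"
  have "(\<Sum>\<sigma> | \<sigma> permutes {..<k}. of_int (sign \<sigma>) * (\<Prod>p<k. (w \<circ> \<pi>) p (?x \<sigma> p)))
      = (\<Sum>\<sigma> | \<sigma> permutes {..<k}. of_int (sign (\<sigma> \<circ> \<pi>)) * (\<Prod>p<k. (w \<circ> \<pi>) p (?x (\<sigma> \<circ> \<pi>) p)))"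
    by (rule sum_permutations_compose_right[OF \<pi>])
  also have "\<dots> = (\<Sum>\<sigma> | \<sigma> permutes {..<k}. of_int (sign \<pi>) *
      (of_int (sign \<sigma>) * (\<Prod>p<k. w p (?x \<sigma> p))))"
  proof (rule sum.cong[OF refl])
    fix \<sigma> assume "\<sigma> \<in> {\<sigma>. \<sigma> permutes {..<k}}"
    then have "permutation \<sigma>" "permutation \<pi>"
      using \<pi> permutes_imp_permutation finite_lessThan by blast+
    then have "sign (\<sigma> \<circ> \<pi>) = sign \<sigma> * sign \<pi>" by (rule sign_compose)
    moreover have "(\<Prod>p<k. (w \<circ> \<pi>) p (?x (\<sigma> \<circ> \<pi>) p)) = (\<Prod>p<k. w p (?x \<sigma> p))"
      using prod.permute[OF \<pi>, of "\<lambda>p. w p (?x \<sigma> p)"] by (simp add: o_def)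
    ultimately show "of_int (sign (\<sigma> \<circ> \<pi>)) * (\<Prod>p<k. (w \<circ> \<pi>) p (?x (\<sigma> \<circ> \<pi>) p))
        = of_int (sign \<pi>) * (of_int (sign \<sigma>) * (\<Prod>p<k. w p (?x \<sigma> p)))"
      by simp
  qed
  finally show ?thesis using True by (simp add: wedge_def sum_distrib_left)
qed (simp add: wedge_def)

lemma wedge_update_sum:
  assumes "p < k"
  shows "wedge N k (u(p := \<lambda>a. \<Sum>z\<in>Z. f z a)) d = (\<Sum>z\<in>Z. wedge N k (u(p := f z)) d)"
proof (cases "d \<in> ext_basis N k")
  case True
  have upd: "(\<Prod>q<k. (u(p := g)) q (x q)) = g (x p) * (\<Prod>q\<in>{..<k} - {p}. u q (x q))" for g x
    using assms by (subst prod.remove[of _ p]) (auto intro!: prod.cong)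
  show ?thesis
    using True unfolding wedge_def upd
    by (simp add: sum_distrib_left sum_distrib_right sum.swap[of _ Z])
qed (simp add: wedge_def)

text \<open>The wedge of basis vectors in the order of the list, which may be unsorted and may
  repeat entries; in this form signs can be tracked.\<close>

definition wedge_list :: "nat \<Rightarrow> nat list \<Rightarrow> nat set \<Rightarrow> complex" where
  "wedge_list N xs = wedge N (length xs) (\<lambda>p. single (xs ! p))"

lemma wedge_list_swap: "wedge_list N (ys @ x # y # zs) d = - wedge_list N (ys @ y # x # zs) d"
proof -
  let ?k = "length (ys @ x # y # zs)" and ?i = "length ys"
  let ?t = "Transposition.transpose ?i (Suc ?i)"
  have t: "?t permutes {..<?k}" by (rule permutes_swap_id) auto
  have "wedge_list N (ys @ x # y # zs) d = wedge N ?k ((\<lambda>p. single ((ys @ y # x # zs) ! p)) \<circ> ?t) d"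
    unfolding wedge_list_def
  proof (rule wedge_cong)
    fix p a
    have "(ys @ x # y # zs) ! p = (ys @ y # x # zs) ! ?t p"
      by (auto simp: transpose_def nth_append nth_Cons')
    then show "single ((ys @ x # y # zs) ! p) a = ((\<lambda>p. single ((ys @ y # x # zs) ! p)) \<circ> ?t) p a"
        by simp
  qed
  also have "\<dots> = of_int (sign ?t) * wedge N ?k (\<lambda>p. single ((ys @ y # x # zs) ! p)) d"
    by (rule wedge_permute[OF t])
  also have "sign ?t = - 1" by (simp add: sign_swap_id)
  finally show ?thesis by (simp add: wedge_list_def)
qed

text \<open>Each interchange with a neighbour costs one sign. When \<open>zs\<close> lists the
  occupied sites below a given site, the exponent is the Jordan-Wigner count.\<close>

lemma wedge_list_move: "wedge_list N (ys @ zs @ x # ws) d = (- 1) ^ length zs * wedge_list N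
    (ys @ x # zs @ ws) d"
proof (induction zs arbitrary: ys)
  case (Cons z zs)
  show ?case using Cons[of "ys @ [z]"] wedge_list_swap[of N ys z x "zs @ ws" d] by simp
qed simp

lemma wedge_list_repeated: "\<not> distinct xs \<Longrightarrow> wedge_list N xs d = 0"
proof -
  assume "\<not> distinct xs"
  then obtain ys x zs ws where "xs = ys @ x # zs @ x # ws"
    by (metis append_Cons append_Nil not_distinct_decomp append.assoc)
  then have "wedge_list N xs d = (- 1) ^ length zs * wedge_list N (ys @ x # x # zs @ ws) d"
    using wedge_list_move[of N "ys @ [x]" zs x ws d] by simp
  moreover have "wedge_list N (ys @ x # x # zs @ ws) d = 0"
    using wedge_list_swap[of N ys x x "zs @ ws" d] by simp
  ultimately show ?thesis by simp
qed

text \<open>A permutation contributes only if it matches the two lists entry by entry; then the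
  underlying sets agree, and distinctness of the entries leaves the identity alone.\<close>

lemma wedge_list_sorted:
  assumes "finite c" and d: "d \<in> ext_basis N (card c)"
  shows "wedge_list N (sorted_list_of_set c) d = of_bool (c = d)"
proof -
  let ?s = "sorted_list_of_set c" and ?t = "sorted_list_of_set d" and ?k = "card c"
  have fd: "finite d" "card d = ?k" using d finite_subset[of d "{1..N}"] by
      (auto simp: ext_basis_def)
  have len: "length ?s = ?k" "length ?t = ?k" using fd by simp_all
  have key: "c = d \<and> \<sigma> = id" if \<sigma>: "\<sigma> permutes {..<?k}" and eq: "\<forall>p<?k. ?s ! p = ?t ! \<sigma> p" for \<sigma>
  proof -
    have "c \<subseteq> d"
    proof
      fix x assume "x \<in> c"
      then obtain p where "p < ?k" "x = ?s ! p" using len(1) assms(1) by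
          (metis in_set_conv_nth set_sorted_list_of_set)
      moreover from this have "\<sigma> p < ?k" using permutes_in_image[OF \<sigma>, of p] by simp
      ultimately show "x \<in> d" using eq len(2) fd by (metis nth_mem set_sorted_list_of_set)
    qed
    then have "c = d" using fd by (intro card_subset_eq) auto
    moreover have "\<sigma> = id"
    proof
      fix p
      show "\<sigma> p = id p"
      proof (cases "p < ?k")
        case True
        then have "\<sigma> p < ?k" using permutes_in_image[OF \<sigma>, of p] by simp
        then have "p = \<sigma> p" using eq True \<open>c = d\<close> len
            nth_eq_iff_index_eq[OF distinct_sorted_list_of_set, of p d "\<sigma> p"]
          by auto
        then show ?thesis by simp
      next
        case False
        then show ?thesis using permutes_not_in[OF \<sigma>] by simp
      qed
    qed
    ultimately show ?thesis by simp
  qed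
  have prod: "(\<Prod>p<?k. single (?s ! p) (?t ! \<sigma> p)) = (of_bool (c = d \<and> \<sigma> = id) :: complex)"
    if "\<sigma> permutes {..<?k}" for \<sigma>
  proof (cases "\<forall>p<?k. ?s ! p = ?t ! \<sigma> p")
    case True
    then show ?thesis using key[OF that True] by (auto simp: single_apply)
  next
    case False
    then obtain p where "p < ?k" "?t ! \<sigma> p \<noteq> ?s ! p" by metis
    then have "(\<Prod>p<?k. single (?s ! p) (?t ! \<sigma> p)) = (0 :: complex)"
      by (intro prod_zero) (auto simp: single_apply)
    moreover have "\<not> (c = d \<and> \<sigma> = id)" using False by auto
    ultimately show ?thesis by (simp only: of_bool_def if_False)
  qed
  have "wedge_list N ?s d = (\<Sum>\<sigma> | \<sigma> permutes {..<?k}. of_int (sign \<sigma>) *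
      (\<Prod>p<?k. single (?s ! p) (?t ! \<sigma> p)))"
    using d len by (simp add: wedge_list_def wedge_def)
  also have "\<dots> = (\<Sum>\<sigma> | \<sigma> permutes {..<?k}. if \<sigma> = id then of_bool (c = d) else 0)"
    by (rule sum.cong) (auto simp: prod sign_id)
  also have "\<dots> = of_bool (c = d)"
    using permutes_id[of "{..<?k}"] by (simp add: finite_permutations)
  finally show ?thesis .
qed

lemma sorted_list_of_set_split:
  fixes e :: "'a::linorder set"
  assumes e: "finite e" and b: "b \<notin> e"
  defines "ys \<equiv> sorted_list_of_set {x \<in> e. x < b}" and "ws \<equiv> sorted_list_of_set {x \<in> e. b < x}"
  shows "sorted_list_of_set (insert b e) = ys @ b # ws" "sorted_list_of_set e = ys @ ws"
proof -
  have sets: "set ys = {x \<in> e. x < b}" "set ws = {x \<in> e. b < x}" using e by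
      (simp_all add: ys_def ws_def)
  have s: "sorted_wrt (<) (ys @ b # ws)" "sorted_wrt (<) (ys @ ws)"
    unfolding sorted_wrt_append sets by (auto simp: ys_def ws_def sets[unfolded ys_def ws_def] e)
  have eq: "sorted_list_of_set (set l) = l" if "sorted_wrt (<) l" for l :: "'a list"
    using that by (intro strict_sorted_equal) auto
  have st: "set (ys @ b # ws) = insert b e" "set (ys @ ws) = e" using sets b neq_iff by auto
  show "sorted_list_of_set (insert b e) = ys @ b # ws" "sorted_list_of_set e = ys @ ws"
    using eq[OF s(1), unfolded st(1)] eq[OF s(2), unfolded st(2)] by blast+
qed

text \<open>Kept as an integer so that the same entry can be read in the rational functions and in
  the complex numbers.\<close>

definition hop_entry :: "nat \<Rightarrow> nat \<Rightarrow> nat set \<Rightarrow> nat set \<Rightarrow> int" where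
  "hop_entry a b c d = (if a \<in> d \<and> b \<notin> d - {a} \<and> insert b (d - {a}) = c
     then jw_sign a d * jw_sign b (d - {a}) else 0)"

lemma apply_hop_entry: "apply_op (hop a b) (single c) d = of_int (hop_entry a b c d)"
  by (simp add: apply_hop_single hop_entry_def)

lemma gl_ext_act_single:
  assumes c: "c \<in> ext_basis N k"
  defines "s \<equiv> sorted_list_of_set c"
  shows "gl_ext_act N k X (single c) d
    = (\<Sum>p<k. wedge N k ((\<lambda>p. single (s ! p))(p := \<lambda>a. X a (s ! p))) d)"
proof -
  have fc: "finite c" "card c = k" "c \<subseteq> {1..N}"
    using c finite_subset[of c "{1..N}"] by (auto simp: ext_basis_def)
  have "mat_vec N X (single (s ! p)) = (\<lambda>a. X a (s ! p))" if "p < k" for p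
  proof
    fix a
    have "s ! p \<in> {1..N}" using that fc nth_mem[of p s] by (auto simp: s_def)
    then show "mat_vec N X (single (s ! p)) a = X a (s ! p)"
      by (simp add: mat_vec_def single_apply)
  qed
  moreover have "gl_ext_act N k X (single c) d = (\<Sum>c'\<in>ext_basis N k. if c' = c
      then \<Sum>p<k. wedge N k ((\<lambda>p. single (s ! p))(p := mat_vec N X (single (s ! p)))) d else 0)"
    unfolding gl_ext_act_def sum_fun_apply
    by (rule sum.cong) (auto simp: scale_def single_apply s_def Let_def sum_fun_apply)
  ultimately show ?thesis
    using c by (simp add: finite_ext_basis)
qed

lemma gl_ext_act_sum:
  assumes c: "c \<in> ext_basis N k"
    and X: "\<And>a b. a \<in> {1..N} \<Longrightarrow> b \<in> {1..N} \<Longrightarrow> X a b = (\<Sum>z\<in>Z. Y z a b)"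
  shows "gl_ext_act N k X (single c) d = (\<Sum>z\<in>Z. gl_ext_act N k (Y z) (single c) d)"
proof -
  let ?s = "sorted_list_of_set c"
  have fc: "finite c" "card c = k" "c \<subseteq> {1..N}"
    using c finite_subset[of c "{1..N}"] by (auto simp: ext_basis_def)
  have s: "?s ! p \<in> {1..N}" if "p < k" for p
    using that fc nth_mem[of p ?s] by auto
  have "gl_ext_act N k X (single c) d
      = (\<Sum>p<k. wedge N k ((\<lambda>p. single (?s ! p))(p := \<lambda>a. X a (?s ! p))) d)"
    by (rule gl_ext_act_single[OF c])
  also have "\<dots> = (\<Sum>p<k. wedge N k ((\<lambda>p. single (?s ! p))(p := \<lambda>a. \<Sum>z\<in>Z. Y z a (?s ! p))) d)"
    by (intro sum.cong refl wedge_cong) (use s X in auto)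
  also have "\<dots> = (\<Sum>z\<in>Z. gl_ext_act N k (Y z) (single c) d)"
    by (simp add: wedge_update_sum gl_ext_act_single[OF c] sum.swap[of _ Z])
  finally show ?thesis .
qed

text \<open>The classical matrix unit replaces the factor \<open>b\<close> by \<open>a\<close>.
  Pulling that factor to the front and sorting it into its new place gives the signs
  \<open>jw_sign b e\<close> and \<open>jw_sign a e\<close> with \<open>e = c - {b}\<close>, exactly
  those of annihilating at \<open>b\<close> and creating at \<open>a\<close>.\<close>

lemma gl_ext_act_unit:
  assumes c: "c \<in> ext_basis N k" and d: "d \<in> ext_basis N k"
  shows "gl_ext_act N k (unit_mat a b) (single c) d = of_int (hop_entry a b c d)"
proof -
  define s where "s = sorted_list_of_set c"
  have fc: "finite c" "card c = k" "c \<subseteq> {1..N}"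
    using c finite_subset[of c "{1..N}"] by (auto simp: ext_basis_def)
  have len: "length s = k" using fc by (simp add: s_def)
  have col: "(\<lambda>x. unit_mat a b x (s ! p)) = (if s ! p = b then single a else (\<lambda>_. 0))" for p
    by (auto simp: unit_mat_def single_def fun_eq_iff)
  \<comment> \<open>A zero factor is the empty sum, so additivity in one factor already covers
    it.\<close>
  have zero: "wedge N k (u(p := \<lambda>_. 0)) d = 0" if "p < k" for u p
    using wedge_update_sum[OF that, of N u undefined "{}"] by simp
  have sum: "gl_ext_act N k (unit_mat a b) (single c) d
      = (\<Sum>p<k. if s ! p = b then wedge_list N (s[p := a]) d else 0)"
    unfolding gl_ext_act_single[OF c, folded s_def] col
  proof (rule sum.cong[OF refl])
    fix p assume p: "p \<in> {..<k}"
    have "wedge N k ((\<lambda>p. single (s ! p))(p := single a)) d = wedge_list N (s[p := a]) d"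
      unfolding wedge_list_def length_list_update len
      by (rule wedge_cong) (use p len in \<open>auto simp: nth_list_update\<close>)
    then show "wedge N k ((\<lambda>p. single (s ! p))(p := if s ! p = b then single a else (\<lambda>_. 0))) d
        = (if s ! p = b then wedge_list N (s[p := a]) d else 0)"
      using p zero by simp
  qed
  show ?thesis
  proof (cases "b \<in> c")
    case False
    then have "s ! p \<noteq> b" if "p < k" for p using that nth_mem[of p s] fc len by (auto simp: s_def)
    then have "gl_ext_act N k (unit_mat a b) (single c) d = 0" unfolding sum by (intro sum.neutral)
        auto
    moreover have "hop_entry a b c d = 0" using False by (auto simp: hop_entry_def)
    ultimately show ?thesis by simp
  next
    case True
    define e where "e = c - {b}"
    have e: "finite e" "b \<notin> e" "c = insert b e" using fc True by (auto simp: e_def)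
    have card_e: "Suc (card e) = k" using e fc by simp
    define ys where "ys = sorted_list_of_set {x \<in> e. x < b}"
    define ws where "ws = sorted_list_of_set {x \<in> e. b < x}"
    have split: "s = ys @ b # ws" "sorted_list_of_set e = ys @ ws"
      using sorted_list_of_set_split[OF e(1,2)] by (simp_all add: s_def e(3) ys_def ws_def)
    have dist: "distinct s" by (simp add: s_def)
    have nth: "s ! p = b \<longleftrightarrow> p = length ys" if "p < k" for p
      using nth_eq_iff_index_eq[OF dist, of p "length ys"] that len by (simp add: split(1))
    have "length ys < k" using len by (simp add: split(1))
    then have "gl_ext_act N k (unit_mat a b) (single c) d = wedge_list N (s[length ys := a]) d"
      unfolding sum by (simp add: nth cong: if_cong sum.cong_simp)
    also have "s[length ys := a] = ys @ a # ws" by (simp add: split(1) list_update_append)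
    also have "wedge_list N (ys @ a # ws) d = (- 1) ^ length ys * wedge_list N
        (a # sorted_list_of_set e) d"
      using wedge_list_move[of N "[]" ys a ws d] by (simp add: split(2))
    finally have 1: "gl_ext_act N k (unit_mat a b) (single c) d
        = (- 1) ^ length ys * wedge_list N (a # sorted_list_of_set e) d" .
    have sign_b: "(- 1) ^ length ys = of_int (jw_sign b e)"
      using e by (simp add: ys_def jw_sign_def)
    show ?thesis
    proof (cases "a \<in> e")
      case True
      \<comment> \<open>The new factor repeats one that is still present, so the wedge vanishes; on
        the other side a particle cannot be created at an occupied site.\<close>
      then have "hop_entry a b c d = 0"
        using e by (auto simp: hop_entry_def)
      then show ?thesis using True e unfolding 1 by (simp add: wedge_list_repeated)
    next
      case False
      define ys' where "ys' = sorted_list_of_set {x \<in> e. x < a}"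
      define ws' where "ws' = sorted_list_of_set {x \<in> e. a < x}"
      have split': "sorted_list_of_set (insert a e) = ys' @ a # ws'" "sorted_list_of_set e = ys' @
          ws'"
        using sorted_list_of_set_split[OF e(1) False] by (simp_all add: ys'_def ws'_def)
      have "wedge_list N (sorted_list_of_set (insert a e)) d
          = (- 1) ^ length ys' * wedge_list N (a # sorted_list_of_set e) d"
        using wedge_list_move[of N "[]" ys' a ws' d] by (simp add: split')
      moreover have "wedge_list N (sorted_list_of_set (insert a e)) d = of_bool (insert a e = d)"
        by (rule wedge_list_sorted) (use e False card_e d in auto)
      moreover have sign_a: "(- 1) ^ length ys' = (of_int (jw_sign a e) :: complex)"
        using e by (simp add: ys'_def jw_sign_def)
      ultimately have "of_int (jw_sign a e) * (of_int (jw_sign a e) * wedge_list N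
          (a # sorted_list_of_set e) d)
          = of_int (jw_sign a e) * of_bool (insert a e = d)"
        by simp
      then have "wedge_list N (a # sorted_list_of_set e) d = of_int (jw_sign a e) * of_bool
          (insert a e = d)"
        by (metis jw_sign_square mult.assoc mult_1 of_int_1 of_int_mult)
      then have "gl_ext_act N k (unit_mat a b) (single c) d
          = of_int (jw_sign b e * jw_sign a e) * of_bool (insert a e = d)"
        unfolding 1 sign_b by simp
      moreover have "hop_entry a b c d = jw_sign b e * jw_sign a e * of_bool (insert a e = d)"
      proof (cases "insert a e = d")
        case True
        then have "d - {a} = e" "a \<in> d" using False by auto
        moreover from this have "jw_sign a e = jw_sign a d" by (metis jw_sign_self(2))
        ultimately show ?thesis using True e(2,3) by (simp add: hop_entry_def)
      next
        case neq: False
        have "\<not> (a \<in> d \<and> b \<notin> d - {a} \<and> insert b (d - {a}) = c)"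
        proof
          assume *: "a \<in> d \<and> b \<notin> d - {a} \<and> insert b (d - {a}) = c"
          then have "d - {a} = e" by (auto simp: e_def)
          then show False using * neq by auto
        qed
        then have "hop_entry a b c d = 0" unfolding hop_entry_def by (rule if_not_P)
        then show ?thesis using neq by simp
      qed
      ultimately show ?thesis by simp
    qed
  qed
qed

subsection \<open>Values at \<open>q = 1\<close>\<close>

lemma has_value_at_1_add:
  assumes "has_value_at_1 f x" "has_value_at_1 g y"
  shows "has_value_at_1 (f + g) (x + y)"
proof -
  obtain a b where ab: "poly b 1 \<noteq> 0" "f = to_fract a / to_fract b" "x = poly a 1 / poly b 1"
    using assms(1) by (auto simp: has_value_at_1_def)
  obtain a' b' where ab': "poly b' 1 \<noteq> 0" "g = to_fract a' / to_fract b'" "y = poly a' 1 / poly b'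
      1"
    using assms(2) by (auto simp: has_value_at_1_def)
  have nz: "to_fract b \<noteq> 0" "to_fract b' \<noteq> 0" using ab ab' by auto
  have "f + g = to_fract (a * b' + a' * b) / to_fract (b * b')"
    using nz by (simp add: ab ab' add_frac_eq)
  moreover have "x + y = poly (a * b' + a' * b) 1 / poly (b * b') 1"
    using ab(1) ab'(1) by (simp add: ab(3) ab'(3) add_frac_eq)
  moreover have "poly (b * b') 1 \<noteq> 0" using ab(1) ab'(1) by simp
  ultimately show ?thesis unfolding has_value_at_1_def by blast
qed

lemma has_value_at_1_mult:
  assumes "has_value_at_1 f x" "has_value_at_1 g y"
  shows "has_value_at_1 (f * g) (x * y)"
proof -
  obtain a b where ab: "poly b 1 \<noteq> 0" "f = to_fract a / to_fract b" "x = poly a 1 / poly b 1"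
    using assms(1) by (auto simp: has_value_at_1_def)
  obtain a' b' where ab': "poly b' 1 \<noteq> 0" "g = to_fract a' / to_fract b'" "y = poly a' 1 / poly b'
      1"
    using assms(2) by (auto simp: has_value_at_1_def)
  have "f * g = to_fract (a * a') / to_fract (b * b')" by (simp add: ab ab')
  moreover have "x * y = poly (a * a') 1 / poly (b * b') 1" by (simp add: ab(3) ab'(3))
  moreover have "poly (b * b') 1 \<noteq> 0" using ab(1) ab'(1) by simp
  ultimately show ?thesis unfolding has_value_at_1_def by blast
qed

lemma has_value_at_1_const: "has_value_at_1 (to_fract [:x:]) x"
  unfolding has_value_at_1_def by (intro exI[of _ "[:x:]"] exI[of _ 1]) simp

lemma has_value_at_1_0: "has_value_at_1 0 0"
  and has_value_at_1_1: "has_value_at_1 1 1"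
  using has_value_at_1_const[of 0] has_value_at_1_const[of 1]
  by (simp_all flip: one_pCons)

lemma has_value_at_1_minus_1: "has_value_at_1 (- 1) (- 1)"
  unfolding has_value_at_1_def by (intro exI[of _ "- 1"] exI[of _ 1]) simp

lemma has_value_at_1_q: "has_value_at_1 q_var 1" "has_value_at_1 (inverse q_var) 1"
  unfolding has_value_at_1_def q_var_def
  by (intro exI[of _ "[:0, 1:]"] exI[of _ 1]; simp)
      (intro exI[of _ 1] exI[of _ "[:0, 1:]"]; simp add: divide_inverse)

lemma has_value_at_1_power: "has_value_at_1 f 1 \<Longrightarrow> has_value_at_1 (f ^ n) 1"
  by (induction n) (use has_value_at_1_1 has_value_at_1_mult[of f 1] in auto)

lemma has_value_at_1_q_powi: "has_value_at_1 (q_var powi w) 1"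
  by (simp add: power_int_def has_value_at_1_power has_value_at_1_q)

lemma has_value_at_1_prod:
  "(\<And>x. x \<in> X \<Longrightarrow> has_value_at_1 (f x) 1) \<Longrightarrow> has_value_at_1 (\<Prod>x\<in>X. f x) 1"
  by (induction X rule: infinite_finite_induct)
    (use has_value_at_1_1 has_value_at_1_mult[of _ 1 _ 1] in auto)

lemma has_value_at_1_sum:
  "(\<And>x. x \<in> X \<Longrightarrow> has_value_at_1 (f x) (g x)) \<Longrightarrow> has_value_at_1 (\<Sum>x\<in>X. f x) (\<Sum>x\<in>X. g x)"
  by (induction X rule: infinite_finite_induct)
    (use has_value_at_1_0 has_value_at_1_add in auto)

lemma has_value_at_1_hop_entry: "has_value_at_1 (of_int (hop_entry a b c d))
    (of_int (hop_entry a b c d))"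
proof -
  have sign: "has_value_at_1 (of_int (jw_sign a d)) (of_int (jw_sign a d))" for a d
    using has_value_at_1_1 has_value_at_1_minus_1
    by (cases "even (card {x \<in> d. x < a})") (simp_all add: jw_sign_def)
  then show ?thesis
    using has_value_at_1_0 has_value_at_1_mult[OF sign sign] by (simp add: hop_entry_def)
qed

text \<open>Only the operators themselves are specialized, so the denominator \<open>q - 1/q\<close>
  never enters: each entry is a sum of powers of \<open>q\<close> times integers and is regular at
  1.\<close>

lemma specializes_grid_op:
  assumes X: "X \<in> carrier (Uq N)" "ext_map N X = grid_op N J lt a b"
    and G: "\<And>x y. x \<in> {1..N} \<Longrightarrow> y \<in> {1..N} \<Longrightarrow> G x y = (\<Sum>j\<in>J. unit_mat (a j) (b j) x y)"
  shows "specializes_to_gl N k (ext_act N k X) G"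
  unfolding specializes_to_gl_def
proof (intro ballI)
  fix c d assume c: "c \<in> ext_basis N k" and d: "d \<in> ext_basis N k"
  have "single c \<in> carrier (ext_space N k)" using c by (auto simp: ext_space_def single_apply)
  then have "ext_act N k X (single c) d = apply_op (grid_op N J lt a b) (single c) d"
    using X by (simp add: ext_act_eq)
  also have "\<dots> = (\<Sum>j\<in>J. (\<Prod>x\<in>{1..N}. if x \<in> d then q_var powi grid_wt J lt a b j x else 1)
      * of_int (hop_entry (a j) (b j) c d))"
    by (simp add: grid_op_def apply_op_sum sum_fun_apply wt_op_def apply_hop_entry)
  finally have E: "ext_act N k X (single c) d = \<dots>" .
  have "has_value_at_1 (\<Sum>j\<in>J. (\<Prod>x\<in>{1..N}. if x \<in> d then q_var powi grid_wt J lt a b j x else 1)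
      * of_int (hop_entry (a j) (b j) c d)) (\<Sum>j\<in>J. 1 * of_int (hop_entry (a j) (b j) c d))"
    by (intro has_value_at_1_sum has_value_at_1_mult has_value_at_1_prod has_value_at_1_hop_entry)
      (auto simp: has_value_at_1_q_powi has_value_at_1_1)
  moreover have "gl_ext_act N k G (single c) d = (\<Sum>j\<in>J. 1 * of_int (hop_entry (a j) (b j) c d))"
    using gl_ext_act_sum[OF c G] by (simp add: gl_ext_act_unit[OF c d])
  ultimately show "has_value_at_1 (ext_act N k X (single c) d) (gl_ext_act N k G (single c) d)"
    unfolding E by (simp only:)
qed

lemma gl_ext_act_outside:
  assumes "c \<in> ext_basis N k" "d \<notin> ext_basis N k"
  shows "gl_ext_act N k G (single c) d = 0"
  using assms by (simp add: gl_ext_act_single wedge_def)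

lemma hop_entry_diag: "hop_entry a a c d = of_bool (c = d \<and> a \<in> c)"
  by (auto simp: hop_entry_def insert_absorb)

lemma weights_match_wt_op:
  assumes X: "X \<in> carrier (Uq N)" "ext_map N X = wt_op N (\<Sum>z\<in>Z. eps (f z))"
    and G: "\<And>x y. x \<in> {1..N} \<Longrightarrow> y \<in> {1..N} \<Longrightarrow> G x y = (\<Sum>z\<in>Z. unit_mat (f z) (f z) x y)"
  shows "weights_match_gl N k (ext_act N k X) G"
  unfolding weights_match_gl_def
proof (intro ballI exI conjI)
  fix c assume c: "c \<in> ext_basis N k"
  have fc: "finite c" "c \<subseteq> {1..N}"
    using c finite_subset[of c "{1..N}"] by (auto simp: ext_basis_def)
  let ?\<alpha> = "\<Sum>z\<in>Z. eps (f z)"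
  \<comment> \<open>The number of summands whose site is occupied in \<open>c\<close>; it is at once
    the exponent of \<open>q\<close> and the classical weight of \<open>single c\<close>.\<close>
  let ?w = "\<Sum>z\<in>Z. of_bool (f z \<in> c) :: int"
  have w: "(\<Sum>x\<in>c. ?\<alpha> x) = ?w"
  proof -
    have "(\<Sum>x\<in>c. ?\<alpha> x) = (\<Sum>z\<in>Z. \<Sum>x\<in>c. eps (f z) x)"
      unfolding sum_fun_apply by (rule sum.swap)
    also have "\<dots> = ?w"
      using fc(1) by (intro sum.cong) (auto simp: eps_def single_def)
    finally show ?thesis .
  qed
  have prod: "(\<Prod>x\<in>{1..N}. if x \<in> c then q_var powi ?\<alpha> x else 1) = q_var powi ?w"
  proof -
    have "(\<Prod>x\<in>{1..N}. if x \<in> c then q_var powi ?\<alpha> x else 1) = (\<Prod>x\<in>c. q_var powi ?\<alpha> x)"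
      using fc by (intro prod.mono_neutral_cong_right) auto
    also have "\<dots> = q_var powi (\<Sum>x\<in>c. ?\<alpha> x)"
      using fc(1) by (induction c rule: finite_induct)
          (simp_all add: power_int_add del: sum_fun_apply)
    finally show ?thesis by (simp only: w)
  qed
  have "single c \<in> carrier (ext_space N k)" using c by (auto simp: ext_space_def single_apply)
  then have "ext_act N k X (single c) = apply_op (wt_op N ?\<alpha>) (single c)"
    using X by (simp add: ext_act_eq)
  also have "\<dots> = scale (q_var powi ?w) (single c)"
    unfolding wt_op_def by (rule ext) (simp add: prod[symmetric] scale_def single_apply)
  finally show "ext_act N k X (single c) = scale (q_var powi ?w) (single c)" .
  show "gl_ext_act N k G (single c) = scale (of_int ?w) (single c)"
  proof
    fix d
    show "gl_ext_act N k G (single c) d = scale (of_int ?w) (single c) d"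
    proof (cases "d \<in> ext_basis N k")
      case True
      have "gl_ext_act N k G (single c) d = (\<Sum>z\<in>Z. of_bool (c = d \<and> f z \<in> c))"
        using gl_ext_act_sum[OF c G] by (simp add: gl_ext_act_unit[OF c True] hop_entry_diag)
      then show ?thesis by (auto simp: scale_def single_apply)
    next
      case False
      then have "d \<noteq> c" using c by auto
      then show ?thesis using gl_ext_act_outside[OF c False] by (simp add: scale_def single_apply)
    qed
  qed
qed

subsection \<open>The embedding of the two classical algebras\<close>

lemma ix_cases:
  assumes "a \<in> {1..m * n}"
  obtains i j where "i \<in> {1..m}" "j < n" "a = ix m i j"
proof -
  have m: "m > 0" using assms by (cases m) auto
  have "a = ix m ((a - 1) mod m + 1) ((a - 1) div m)"
    using assms div_mult_mod_eq[of "a - 1" m] by simp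
  moreover have "(a - 1) mod m + 1 \<in> {1..m}" using m by (simp add: Suc_leI)
  moreover have "(a - 1) div m < n"
  proof (rule less_mult_imp_div_less)
    show "a - 1 < n * m" using assms by (auto simp: mult.commute)
  qed
  ultimately show ?thesis using that by blast
qed

lemma ix_div_mod:
  assumes "i \<in> {1..m}"
  shows "(ix m i j - 1) div m = j" "(ix m i j - 1) mod m + 1 = i"
proof -
  have "ix m i j - 1 = (i - 1) + j * m" "i - 1 < m" using assms by auto
  then show "(ix m i j - 1) div m = j" "(ix m i j - 1) mod m + 1 = i"
    using assms by (simp_all only: div_mult_self1 mod_mult_self1) auto
qed

text \<open>Beyond \<open>m * n\<close> the embedded matrix goes on repeating its block while the
  finite sum vanishes, so this can only be an identity of entries in range, which is what
  \<open>gl_ext_act_sum\<close> asks for.\<close>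

lemma gl_embed_left:
  assumes i: "i \<in> {1..m}" "i' \<in> {1..m}" and ab: "a \<in> {1..m * n}" "b \<in> {1..m * n}"
  shows "gl_embed m (unit_mat i i') 0 a b = (\<Sum>j<n. unit_mat (ix m i j) (ix m i' j) a b)"
proof -
  obtain p r where a: "p \<in> {1..m}" "r < n" "a = ix m p r" using ix_cases[OF ab(1)] .
  obtain p' r' where b: "p' \<in> {1..m}" "r' < n" "b = ix m p' r'" using ix_cases[OF ab(2)] .
  have "(\<Sum>j<n. unit_mat (ix m i j) (ix m i' j) a b)
      = (\<Sum>j<n. if j = r then of_bool (p = i \<and> p' = i' \<and> r = r') else 0)"
    unfolding a(3) b(3) unit_mat_def ix_eq_iff[OF a(1) i(1)] ix_eq_iff[OF b(1) i(2)]
    by (rule sum.cong) auto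
  also have "\<dots> = gl_embed m (unit_mat i i') 0 a b"
    unfolding gl_embed_def Let_def a(3) b(3) ix_div_mod[OF a(1)] ix_div_mod[OF b(1)]
    using a(2) by (auto simp: unit_mat_def)
  finally show ?thesis ..
qed

lemma gl_embed_right:
  assumes l: "l \<ge> 1" "l' \<ge> 1" and ab: "a \<in> {1..m * n}" "b \<in> {1..m * n}"
  shows "gl_embed m 0 (unit_mat l l') a b = (\<Sum>i\<in>{1..m}. unit_mat (ix m i (l - 1)) (ix m i (l' - 1))
      a b)"
proof -
  obtain p r where a: "p \<in> {1..m}" "r < n" "a = ix m p r" using ix_cases[OF ab(1)] .
  obtain p' r' where b: "p' \<in> {1..m}" "r' < n" "b = ix m p' r'" using ix_cases[OF ab(2)] .
  have "(\<Sum>i\<in>{1..m}. unit_mat (ix m i (l - 1)) (ix m i (l' - 1)) a b)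
      = (\<Sum>i\<in>{1..m}. if i = p then of_bool (p = p' \<and> r = l - 1 \<and> r' = l' - 1) else 0)"
    unfolding a(3) b(3) unit_mat_def
    by (rule sum.cong[OF refl]) (auto simp only: ix_eq_iff[OF a(1)] ix_eq_iff[OF b(1)] of_bool_def
        split: if_splits)
  also have "\<dots> = gl_embed m 0 (unit_mat l l') a b"
    unfolding gl_embed_def Let_def a(3) b(3) ix_div_mod[OF a(1)] ix_div_mod[OF b(1)]
    using a(1) l by (auto simp: unit_mat_def)
  finally show ?thesis ..
qed

theorem proposition33:
  fixes m n k :: nat
  assumes "m \<ge> 1" and "n \<ge> 1" and "k \<le> m * n"
  shows
    "(\<exists>act. alg_module Cq (tensor_algebra (Uq m) (Uq n)) (ext_space (m * n) k) act \<and>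
       (\<forall>v\<in>carrier (ext_space (m * n) k).
         (\<forall>i\<in>{1..m}.
            act (pure_tensor (Uq m) (Uq n) (qpow m (eps i)) \<one>\<^bsub>Uq n\<^esub>) v
              = ext_act (m * n) k (K_left m n i) v) \<and>
         (\<forall>i\<in>{1..<m}.
            act (pure_tensor (Uq m) (Uq n) (e_gen m i) \<one>\<^bsub>Uq n\<^esub>) v
              = ext_act (m * n) k (E_left m n i) v \<and>
            act (pure_tensor (Uq m) (Uq n) (f_gen m i) \<one>\<^bsub>Uq n\<^esub>) v
              = ext_act (m * n) k (F_left m n i) v) \<and>
         (\<forall>l\<in>{1..n}.
            act (pure_tensor (Uq m) (Uq n) \<one>\<^bsub>Uq m\<^esub> (qpow n (eps l))) v
              = ext_act (m * n) k (K_right m n l) v) \<and>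
         (\<forall>l\<in>{1..<n}.
            act (pure_tensor (Uq m) (Uq n) \<one>\<^bsub>Uq m\<^esub> (e_gen n l)) v
              = ext_act (m * n) k (E_right m n l) v \<and>
            act (pure_tensor (Uq m) (Uq n) \<one>\<^bsub>Uq m\<^esub> (f_gen n l)) v
              = ext_act (m * n) k (F_right m n l) v))) \<and>
     (\<forall>i\<in>{1..m}. weights_match_gl (m * n) k (ext_act (m * n) k (K_left m n i))
        (gl_embed m (unit_mat i i) 0)) \<and>
     (\<forall>i\<in>{1..<m}.
        specializes_to_gl (m * n) k (ext_act (m * n) k (E_left m n i))
          (gl_embed m (unit_mat i (i + 1)) 0) \<and>
        specializes_to_gl (m * n) k (ext_act (m * n) k (F_left m n i))
          (gl_embed m (unit_mat (i + 1) i) 0)) \<and>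
     (\<forall>l\<in>{1..n}. weights_match_gl (m * n) k (ext_act (m * n) k (K_right m n l))
        (gl_embed m 0 (unit_mat l l))) \<and>
     (\<forall>l\<in>{1..<n}.
        specializes_to_gl (m * n) k (ext_act (m * n) k (E_right m n l))
          (gl_embed m 0 (unit_mat l (l + 1))) \<and>
        specializes_to_gl (m * n) k (ext_act (m * n) k (F_right m n l))
          (gl_embed m 0 (unit_mat (l + 1) l)))"
proof (intro conjI ballI dual_action)
  fix i assume i: "i \<in> {1..m}"
  show "weights_match_gl (m * n) k (ext_act (m * n) k (K_left m n i)) (gl_embed m (unit_mat i i) 0)"
    by (rule weights_match_wt_op[OF ext_map_K_left(2,1)]) (rule gl_embed_left[OF i i])
next
  fix i assume i: "i \<in> {1..<m}"
  then have i': "i \<in> {1..m}" "i + 1 \<in> {1..m}" by auto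
  show "specializes_to_gl (m * n) k (ext_act (m * n) k (E_left m n i))
      (gl_embed m (unit_mat i (i + 1)) 0)"
    by (rule specializes_grid_op[OF ext_map_E_left(2,1)[OF i]]) (rule gl_embed_left[OF i'])
  show "specializes_to_gl (m * n) k (ext_act (m * n) k (F_left m n i))
      (gl_embed m (unit_mat (i + 1) i) 0)"
    by (rule specializes_grid_op[OF ext_map_F_left(2,1)[OF i]]) (rule gl_embed_left[OF i'(2,1)])
next
  fix l assume l: "l \<in> {1..n}"
  then have l': "l \<ge> 1" by simp
  show "weights_match_gl (m * n) k (ext_act (m * n) k (K_right m n l))
      (gl_embed m 0 (unit_mat l l))"
    by (rule weights_match_wt_op[OF ext_map_K_right(2,1)]) (rule gl_embed_right[OF l' l'])
next
  fix l assume l: "l \<in> {1..<n}"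
  then have l': "l \<ge> 1" "l + 1 \<ge> 1" by auto
  show "specializes_to_gl (m * n) k (ext_act (m * n) k (E_right m n l))
      (gl_embed m 0 (unit_mat l (l + 1)))"
    by (rule specializes_grid_op[OF ext_map_E_right(2,1)[OF l]])
        (simp only: gl_embed_right[OF l'] add_diff_cancel_right')
  show "specializes_to_gl (m * n) k (ext_act (m * n) k (F_right m n l))
      (gl_embed m 0 (unit_mat (l + 1) l))"
    by (rule specializes_grid_op[OF ext_map_F_right(2,1)[OF l]])
        (simp only: gl_embed_right[OF l'(2,1)] add_diff_cancel_right')
qed

end
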